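(* (a) Let $(A,I,f)$ be an affine triple, and let $\varphi\in\mathrm{Aut}\,A$ be an automorphism such that $\varphi(I)=I$ and $\varphi(f)=\alpha f$, where $\alpha\in A$ is an invertible element. Then there exists a unique extension $\varphi'\in\mathrm{Aut}\,A'$ of $\varphi$ to an automorphism of the affine modification $A'=\Sigma_{I,f}(A)$. (b) Furthermore, the induced automorphism $\widehat\varphi$ of $X=\mathrm{spec}\,A$ preserves the divisor $D=D_f=f^*(0)$ and the center $C=V(I)$ of the blow up. It can be lifted in a unique way to an automorphism $\widehat{\varphi'}$ of the affine modification $X'=\Sigma_{I,f}(X)$ which preserves the exceptional divisor $E'\subset X'$ of the blow up; in the complement $X'\setminus E'$ one has $\widehat{\varphi'}=\sigma_I^{-1}\circ\widehat\varphi\circ\sigma_I$, where $\sigma_I:X'\to X$ is the blowup morphism.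
   Context: An affine triple $(A,I,f)$ consists of an affine domain $A$ over $\mathbb{C}$ (finitely generated $\mathbb{C}$-algebra which is a domain), an ideal $I\subset A$ and a nonzero element $f\in I$. Its affine modification is $\Sigma_{I,f}(A):=A[It]/(1-ft)$, where $A[It]=A\oplus\bigoplus_{n\ge1}(It)^n\subset A[t]$ is the blowup (Rees) algebra; it is canonically isomorphic over $A$ to $A[I/f]=\{a/f^k: a\in I^k,\ k\ge0\}\subset\mathrm{Frac}\,A$. For $X=\mathrm{spec}\,A$, $\Sigma_{I,f}(X)=\mathrm{spec}\,\Sigma_{I,f}(A)$, and the blowup morphism $\sigma_I:\Sigma_{I,f}(X)\to X$ is induced by the inclusion $A\hookrightarrow\Sigma_{I,f}(A)$. The exceptional divisor is $E'=\sigma_I^{-1}(V(I))\subset X'$; $\sigma_I$ restricts to an isomorphism $X'\setminus E'\to X\setminus\mathrm{supp}\,D_f$. Automorphisms of $A$, $A'$ are $\mathbb{C}$-algebra automorphisms; $\widehat\varphi$ and $\widehat{\varphi'}$ denote the automorphisms of $X$ and $X'$ induced by $\varphi$ and $\varphi'$. *)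

theory Defs
  imports
    "HOL-Analysis.Abstract_Topology"
    "HOL-Algebra.Algebra"
    "HOL-Algebra.Algebraic_Closure_Type"
begin

section \<open>Algebras over the complex numbers and affine modifications\<close>

text \<open>
  A commutative \<open>\<complex>\<close>-algebra is a commutative ring \<open>A\<close> together with its structure homomorphism
  \<open>\<eta>\<close> from \<open>\<complex>\<close> to \<open>A\<close>.  Finite generation: \<open>A\<close> is generated as a ring by the
  image of \<open>\<complex>\<close> and finitely many further elements.
\<close>

definition affine_domain :: "('a, 'm) ring_scheme \<Rightarrow> (complex \<Rightarrow> 'a) \<Rightarrow> bool" where
  "affine_domain A \<eta> \<longleftrightarrow>
     domain A \<and> \<eta> \<in> ring_hom (ring_of_type_algebra :: complex ring) A \<and>
     (\<exists>S. finite S \<and> S \<subseteq> carrier A \<and> generate_ring A (range \<eta> \<union> S) = carrier A)"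

definition affine_triple ::
    "('a, 'm) ring_scheme \<Rightarrow> (complex \<Rightarrow> 'a) \<Rightarrow> 'a set \<Rightarrow> 'a \<Rightarrow> bool" where
  "affine_triple A \<eta> I f \<longleftrightarrow> affine_domain A \<eta> \<and> ideal I A \<and> f \<in> I \<and> f \<noteq> \<zero>\<^bsub>A\<^esub>"

text \<open>Automorphisms are extensional functions, so that equality of functions is equality of maps.\<close>

definition alg_aut :: "('a, 'm) ring_scheme \<Rightarrow> (complex \<Rightarrow> 'a) \<Rightarrow> ('a \<Rightarrow> 'a) set" where
  "alg_aut A \<eta> = {\<phi> \<in> extensional (carrier A). \<phi> \<in> ring_iso A A \<and> (\<forall>k. \<phi> (\<eta> k) = \<eta> k)}"

text \<open>
  The blowup (Rees) algebra \<open>A[It]\<close> as a subring of \<open>A[t]\<close>; the powers of \<open>I\<close> are taken in the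
  monoid of ideals, so the zeroth power is \<open>A\<close>.
\<close>

definition rees :: "('a, 'm) ring_scheme \<Rightarrow> 'a set \<Rightarrow> ('a, nat \<Rightarrow> 'a) up_ring" where
  "rees A I = (UP A)\<lparr>carrier :=
     {p \<in> carrier (UP A). \<forall>n. up_ring.coeff (UP A) p n \<in> I [^]\<^bsub>ideals_set A\<^esub> (n::nat)}\<rparr>"

definition modif_ideal :: "('a, 'm) ring_scheme \<Rightarrow> 'a set \<Rightarrow> 'a \<Rightarrow> (nat \<Rightarrow> 'a) set" where
  "modif_ideal A I f = PIdl\<^bsub>rees A I\<^esub> (\<one>\<^bsub>UP A\<^esub> \<ominus>\<^bsub>UP A\<^esub> up_ring.monom (UP A) f 1)"

definition modif :: "('a, 'm) ring_scheme \<Rightarrow> 'a set \<Rightarrow> 'a \<Rightarrow> (nat \<Rightarrow> 'a) set ring" where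
  "modif A I f = rees A I Quot modif_ideal A I f"

definition modif_emb :: "('a, 'm) ring_scheme \<Rightarrow> 'a set \<Rightarrow> 'a \<Rightarrow> 'a \<Rightarrow> (nat \<Rightarrow> 'a) set" where
  "modif_emb A I f a = modif_ideal A I f +>\<^bsub>rees A I\<^esub> up_ring.monom (UP A) a 0"


section \<open>Ringed spaces over the complex numbers and their morphisms\<close>

text \<open>
  A space with a sheaf of \<open>\<complex>\<close>-algebras: \<open>rsec S U\<close> is the ring of sections over \<open>U\<close>,
  \<open>rres S U W\<close> the restriction map for \<open>W \<subseteq> U\<close>, and \<open>rcst S U\<close> the structure map of the
  algebra \<open>rsec S U\<close>.  Only the values at open sets are meaningful.
\<close>

record ('p, 's) rspace =
  rtop :: "'p topology"
  rsec :: "'p set \<Rightarrow> 's ring"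
  rres :: "'p set \<Rightarrow> 'p set \<Rightarrow> 's \<Rightarrow> 's"
  rcst :: "'p set \<Rightarrow> complex \<Rightarrow> 's"

text \<open>
  A morphism from \<open>S\<close> to \<open>T\<close> is a pair \<open>(h, c)\<close> of a map \<open>h\<close> of points and, for every
  open \<open>V\<close> of \<open>T\<close>, a comorphism \<open>c V\<close> from the sections over \<open>V\<close> to those over the preimage of \<open>V\<close>.
\<close>

type_synonym ('p, 's, 'q, 't) rmap = "('p \<Rightarrow> 'q) \<times> ('q set \<Rightarrow> 't \<Rightarrow> 's)"

definition rpre :: "('p, 's) rspace \<Rightarrow> ('p, 's, 'q, 't) rmap \<Rightarrow> 'q set \<Rightarrow> 'p set" where
  "rpre S F V = {x \<in> topspace (rtop S). fst F x \<in> V}"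

text \<open>The germ of the section \<open>s\<close> over \<open>U\<close> at \<open>x\<close> is a unit of the stalk (a filtered colimit).\<close>

definition germ_unit :: "('p, 's) rspace \<Rightarrow> 'p set \<Rightarrow> 's \<Rightarrow> 'p \<Rightarrow> bool" where
  "germ_unit S U s x \<longleftrightarrow>
     (\<exists>W. openin (rtop S) W \<and> x \<in> W \<and> W \<subseteq> U \<and> rres S U W s \<in> Units (rsec S W))"

text \<open>
  Morphisms of locally ringed spaces over \<open>\<complex>\<close>.  The last conjunct says that the induced maps of
  stalks are local: they reflect units.  All functions involved are extensional, so that equality of
  pairs is equality of morphisms.
\<close>

definition rmor :: "('p, 's) rspace \<Rightarrow> ('q, 't) rspace \<Rightarrow> ('p, 's, 'q, 't) rmap set" where
  "rmor S T = {F.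
     fst F \<in> extensional (topspace (rtop S)) \<and> continuous_map (rtop S) (rtop T) (fst F) \<and>
     snd F \<in> extensional {V. openin (rtop T) V} \<and>
     (\<forall>V. openin (rtop T) V \<longrightarrow>
        snd F V \<in> extensional (carrier (rsec T V)) \<and>
        snd F V \<in> ring_hom (rsec T V) (rsec S (rpre S F V)) \<and>
        (\<forall>k. snd F V (rcst T V k) = rcst S (rpre S F V) k)) \<and>
     (\<forall>V W s. openin (rtop T) V \<and> openin (rtop T) W \<and> W \<subseteq> V \<and> s \<in> carrier (rsec T V) \<longrightarrow>
        snd F W (rres T V W s) = rres S (rpre S F V) (rpre S F W) (snd F V s)) \<and>
     (\<forall>x V s. x \<in> topspace (rtop S) \<and> openin (rtop T) V \<and> fst F x \<in> V \<and> s \<in> carrier (rsec T V) \<and>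
        germ_unit S (rpre S F V) (snd F V s) x \<longrightarrow> germ_unit T V s (fst F x))}"

definition rid :: "('p, 's) rspace \<Rightarrow> ('p, 's, 'p, 's) rmap" where
  "rid S = (\<lambda>x\<in>topspace (rtop S). x, \<lambda>V\<in>{V. openin (rtop S) V}. \<lambda>s\<in>carrier (rsec S V). s)"

text \<open>\<open>rcomp S T R G F\<close> is the composition of \<open>F\<close> from \<open>S\<close> to \<open>T\<close> with \<open>G\<close> from \<open>T\<close> to \<open>R\<close>.\<close>

definition rcomp ::
    "('p, 's) rspace \<Rightarrow> ('q, 't) rspace \<Rightarrow> ('r, 'u) rspace \<Rightarrow>
     ('q, 't, 'r, 'u) rmap \<Rightarrow> ('p, 's, 'q, 't) rmap \<Rightarrow> ('p, 's, 'r, 'u) rmap" where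
  "rcomp S T R G F =
     (\<lambda>x\<in>topspace (rtop S). fst G (fst F x),
      \<lambda>V\<in>{V. openin (rtop R) V}. \<lambda>s\<in>carrier (rsec R V). snd F (rpre T G V) (snd G V s))"

definition rinverse ::
    "('p, 's) rspace \<Rightarrow> ('q, 't) rspace \<Rightarrow>
     ('p, 's, 'q, 't) rmap \<Rightarrow> ('q, 't, 'p, 's) rmap \<Rightarrow> bool" where
  "rinverse S T F G \<longleftrightarrow> F \<in> rmor S T \<and> G \<in> rmor T S \<and>
     rcomp S T S G F = rid S \<and> rcomp T S T F G = rid T"

definition raut :: "('p, 's) rspace \<Rightarrow> ('p, 's, 'p, 's) rmap set" where
  "raut S = {F. \<exists>G. rinverse S S F G}"

definition ropen_sub :: "('p, 's) rspace \<Rightarrow> 'p set \<Rightarrow> ('p, 's) rspace" where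
  "ropen_sub S U = S\<lparr>rtop := subtopology (rtop S) U\<rparr>"

text \<open>The restriction of \<open>F\<close> from \<open>S\<close> to \<open>T\<close> to a morphism between open subspaces \<open>U\<close> and \<open>V\<close>,
  meaningful if \<open>F\<close> maps \<open>U\<close> into \<open>V\<close>.\<close>

definition rrestr ::
    "('p, 's) rspace \<Rightarrow> ('q, 't) rspace \<Rightarrow> 'p set \<Rightarrow> 'q set \<Rightarrow>
     ('p, 's, 'q, 't) rmap \<Rightarrow> ('p, 's, 'q, 't) rmap" where
  "rrestr S T U V F =
     (restrict (fst F) U,
      \<lambda>W\<in>{W. openin (rtop (ropen_sub T V)) W}. \<lambda>s\<in>carrier (rsec T W).
        rres S (rpre S F W) (rpre S F W \<inter> U) (snd F W s))"


section \<open>Closed subschemes\<close>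

text \<open>
  A closed subscheme is given by its ideal sheaf \<open>J\<close>, where \<open>J U\<close> is an ideal of \<open>rsec S U\<close>.
  A point lies outside the support iff the stalk of the ideal sheaf there contains 1.
\<close>

definition supp :: "('p, 's) rspace \<Rightarrow> ('p set \<Rightarrow> 's set) \<Rightarrow> 'p set" where
  "supp S J = {x \<in> topspace (rtop S). \<not> (\<exists>W. openin (rtop S) W \<and> x \<in> W \<and> \<one>\<^bsub>rsec S W\<^esub> \<in> J W)}"

text \<open>The scheme-theoretic inverse image: its ideal sheaf is generated by the pulled back
  sections of \<open>J\<close>.\<close>

definition inv_img ::
    "('p, 's) rspace \<Rightarrow> ('q, 't) rspace \<Rightarrow> ('p, 's, 'q, 't) rmap \<Rightarrow>
     ('q set \<Rightarrow> 't set) \<Rightarrow> 'p set \<Rightarrow> 's set" where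
  "inv_img S T F J U = {s \<in> carrier (rsec S U). \<forall>x\<in>U. \<exists>W V.
     openin (rtop S) W \<and> x \<in> W \<and> W \<subseteq> U \<and> openin (rtop T) V \<and> W \<subseteq> rpre S F V \<and>
     rres S U W s \<in> Idl\<^bsub>rsec S W\<^esub> ((\<lambda>j. rres S (rpre S F V) W (snd F V j)) ` J V)}"

text \<open>An automorphism preserves a closed subscheme if it preserves the support and the ideal sheaf.\<close>

definition preserves ::
    "('p, 's) rspace \<Rightarrow> ('p, 's, 'p, 's) rmap \<Rightarrow> ('p set \<Rightarrow> 's set) \<Rightarrow> bool" where
  "preserves S F J \<longleftrightarrow> fst F ` supp S J = supp S J \<and>
     (\<forall>V. openin (rtop S) V \<longrightarrow> snd F V ` J V = J (rpre S F V))"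


section \<open>Affine schemes\<close>

text \<open>The fraction \<open>a/s\<close> in the localization of \<open>A\<close> at the prime ideal \<open>P\<close>, as an equivalence class
  of pairs.\<close>

definition lfrac :: "('a, 'm) ring_scheme \<Rightarrow> 'a set \<Rightarrow> 'a \<Rightarrow> 'a \<Rightarrow> ('a \<times> 'a) set" where
  "lfrac A P a s = {(b, t). b \<in> carrier A \<and> t \<in> carrier A - P \<and>
     (\<exists>u\<in>carrier A - P. u \<otimes>\<^bsub>A\<^esub> (t \<otimes>\<^bsub>A\<^esub> a \<ominus>\<^bsub>A\<^esub> s \<otimes>\<^bsub>A\<^esub> b) = \<zero>\<^bsub>A\<^esub>)}"

definition loc :: "('a, 'm) ring_scheme \<Rightarrow> 'a set \<Rightarrow> ('a \<times> 'a) set ring" where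
  "loc A P = \<lparr>
     carrier = {lfrac A P a s | a s. a \<in> carrier A \<and> s \<in> carrier A - P},
     monoid.mult = (\<lambda>x y. \<Union>(a, s)\<in>x. \<Union>(b, t)\<in>y. lfrac A P (a \<otimes>\<^bsub>A\<^esub> b) (s \<otimes>\<^bsub>A\<^esub> t)),
     monoid.one = lfrac A P \<one>\<^bsub>A\<^esub> \<one>\<^bsub>A\<^esub>,
     ring.zero = lfrac A P \<zero>\<^bsub>A\<^esub> \<one>\<^bsub>A\<^esub>,
     ring.add = (\<lambda>x y. \<Union>(a, s)\<in>x. \<Union>(b, t)\<in>y.
       lfrac A P (t \<otimes>\<^bsub>A\<^esub> a \<oplus>\<^bsub>A\<^esub> s \<otimes>\<^bsub>A\<^esub> b) (s \<otimes>\<^bsub>A\<^esub> t))\<rparr>"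

definition zariski :: "('a, 'm) ring_scheme \<Rightarrow> 'a set topology" where
  "zariski A = topology_generated_by {{P. primeideal P A \<and> a \<notin> P} | a. a \<in> carrier A}"

text \<open>Sections of the structure sheaf: families of elements of the localizations which are locally
  given by one fraction.\<close>

definition spec_sec ::
    "('a, 'm) ring_scheme \<Rightarrow> 'a set set \<Rightarrow> ('a set \<Rightarrow> ('a \<times> 'a) set) ring" where
  "spec_sec A U = \<lparr>
     carrier = {s \<in> (\<Pi>\<^sub>E P\<in>U. carrier (loc A P)). \<forall>P\<in>U. \<exists>W a b.
       openin (zariski A) W \<and> P \<in> W \<and> W \<subseteq> U \<and> a \<in> carrier A \<and> b \<in> carrier A \<and>
       (\<forall>Q\<in>W. b \<notin> Q \<and> s Q = lfrac A Q a b)},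
     monoid.mult = (\<lambda>s t. \<lambda>P\<in>U. s P \<otimes>\<^bsub>loc A P\<^esub> t P),
     monoid.one = (\<lambda>P\<in>U. \<one>\<^bsub>loc A P\<^esub>),
     ring.zero = (\<lambda>P\<in>U. \<zero>\<^bsub>loc A P\<^esub>),
     ring.add = (\<lambda>s t. \<lambda>P\<in>U. s P \<oplus>\<^bsub>loc A P\<^esub> t P)\<rparr>"

definition Spec ::
    "('a, 'm) ring_scheme \<Rightarrow> (complex \<Rightarrow> 'a) \<Rightarrow> ('a set, 'a set \<Rightarrow> ('a \<times> 'a) set) rspace" where
  "Spec A \<eta> = \<lparr>
     rtop = zariski A,
     rsec = spec_sec A,
     rres = (\<lambda>U W s. restrict s W),
     rcst = (\<lambda>U k. \<lambda>P\<in>U. lfrac A P (\<eta> k) \<one>\<^bsub>A\<^esub>)\<rparr>"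

text \<open>The morphism from the spectrum of \<open>B\<close> to that of \<open>A\<close> induced by \<open>\<theta>\<close> from \<open>A\<close> to \<open>B\<close>.\<close>

definition spec_pt ::
    "('a, 'm) ring_scheme \<Rightarrow> ('b, 'n) ring_scheme \<Rightarrow> ('a \<Rightarrow> 'b) \<Rightarrow> 'b set \<Rightarrow> 'a set" where
  "spec_pt A B \<theta> Q = {a \<in> carrier A. \<theta> a \<in> Q}"

definition loc_map :: "('b, 'n) ring_scheme \<Rightarrow> ('a \<Rightarrow> 'b) \<Rightarrow> 'b set \<Rightarrow>
    ('a \<times> 'a) set \<Rightarrow> ('b \<times> 'b) set" where
  "loc_map B \<theta> Q x = (\<Union>(a, s)\<in>x. lfrac B Q (\<theta> a) (\<theta> s))"

definition spec_map ::
    "('a, 'm) ring_scheme \<Rightarrow> ('b, 'n) ring_scheme \<Rightarrow> ('a \<Rightarrow> 'b) \<Rightarrow>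
     ('b set, 'b set \<Rightarrow> ('b \<times> 'b) set, 'a set, 'a set \<Rightarrow> ('a \<times> 'a) set) rmap" where
  "spec_map A B \<theta> =
     (\<lambda>Q\<in>{Q. primeideal Q B}. spec_pt A B \<theta> Q,
      \<lambda>V\<in>{V. openin (zariski A) V}. \<lambda>s\<in>carrier (spec_sec A V).
        \<lambda>Q\<in>{Q. primeideal Q B \<and> spec_pt A B \<theta> Q \<in> V}. loc_map B \<theta> Q (s (spec_pt A B \<theta> Q)))"

text \<open>
  The closed subscheme \<open>V(J)\<close> of the spectrum of \<open>A\<close>.  For a principal ideal generated by \<open>f \<noteq> 0\<close> in
  a domain this is the effective Cartier divisor of \<open>f\<close>, multiplicities included.
\<close>

definition vanishing ::
    "('a, 'm) ring_scheme \<Rightarrow> 'a set \<Rightarrow> 'a set set \<Rightarrow> ('a set \<Rightarrow> ('a \<times> 'a) set) set" where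
  "vanishing A J U = {s \<in> carrier (spec_sec A U).
     \<forall>P\<in>U. \<exists>a\<in>J. \<exists>b\<in>carrier A - P. s P = lfrac A P a b}"

end

theory Submission
  imports Defs
begin

text \<open>
  In \<open>A' = A[It]/(1 - ft)\<close> the image of \<open>f\<close> is a nonzerodivisor, every element \<open>x\<close> satisfies
  \<open>f\<^sup>k x = a\<close> for some \<open>a\<close> in \<open>I\<^sup>k\<close>, and every such \<open>a\<close> is divisible by \<open>f\<^sup>k\<close>.  Hence \<open>A'\<close> is a
  domain, and an extension \<open>\<phi>'\<close> of \<open>\<phi>\<close> must send \<open>x\<close> to the solution \<open>y\<close> of
  \<open>\<phi>(f)\<^sup>k y = \<phi>(a)\<close>; it exists since \<open>\<phi>(a)\<close> is in \<open>I\<^sup>k\<close> and \<open>\<phi>(f)\<close> is associated to \<open>f\<close>.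

  On the geometric side a morphism of locally ringed spaces into a spectrum is determined by its
  values on the global sections coming from the ring: units of the stalks recover the points, and
  fractions recover the comorphisms.  This turns uniqueness of the lift into the cancellation
  argument above.  Over the locus \<open>f \<noteq> 0\<close> the blowup morphism is a homeomorphism inducing bijections
  on sections, so it is invertible there, and \<open>\<sigma> \<circ> \<psi> = \<phi>hat \<circ> \<sigma>\<close> can be solved for \<open>\<psi>\<close>.
\<close>

section \<open>Morphisms of ringed spaces\<close>

text \<open>In the quotient by \<open>1 - ft\<close> elements are cosets, not members of a fraction
  field. That \<open>f\<close> is a nonzerodivisor there is proved by dividing by
  \<open>1 - ft\<close> as a power series and showing that the quotient is a polynomial. Afterwards
  only the interface \<open>affine_modification\<close> is used.

  Bijectivity of the extension, invertibility of the lift and preservation of \<open>D\<close>,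
  \<open>C\<close> and \<open>E'\<close> have one source: the inverse of \<open>\<phi>\<close>
  satisfies the same hypotheses as \<open>\<phi>\<close>, with another unit in place of
  \<open>\<alpha>\<close>. So existence statements and inclusions suffice, each applied to
  \<open>\<phi>\<close> and to its inverse.

  The lift has to be unique among all automorphisms of the ringed space. The cancellation therefore
  happens in each local ring, where the image of \<open>\<phi>(f^k)\<close> may be a nonunit but is
  still a nonzerodivisor; the ring of all global sections is never determined. The complement of
  \<open>E'\<close> is the locus where \<open>f\<close> does not vanish because \<open>I\<close> and
  \<open>f\<close> generate the same ideal of \<open>A'\<close>.\<close>

lemma rmor_extensional: "F \<in> rmor S T \<Longrightarrow> fst F \<in> extensional (topspace (rtop S))"
  by (simp add: rmor_def)

lemma rmor_continuous: "F \<in> rmor S T \<Longrightarrow> continuous_map (rtop S) (rtop T) (fst F)"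
  by (simp add: rmor_def)

lemma rmor_point: "F \<in> rmor S T \<Longrightarrow> x \<in> topspace (rtop S) \<Longrightarrow> fst F x \<in> topspace (rtop T)"
  using rmor_continuous by (metis continuous_map_image_subset_topspace image_subset_iff)

lemma rmor_snd_extensional: "F \<in> rmor S T \<Longrightarrow> snd F \<in> extensional {V. openin (rtop T) V}"
  by (simp add: rmor_def)

lemma rmor_comorphism_extensional:
  "F \<in> rmor S T \<Longrightarrow> openin (rtop T) V \<Longrightarrow> snd F V \<in> extensional (carrier (rsec T V))"
  by (simp add: rmor_def)

lemma rmor_hom:
  "F \<in> rmor S T \<Longrightarrow> openin (rtop T) V \<Longrightarrow> snd F V \<in> ring_hom (rsec T V) (rsec S (rpre S F V))"
  by (simp add: rmor_def)

lemma rmor_closed: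
  "F \<in> rmor S T \<Longrightarrow> openin (rtop T) V \<Longrightarrow> s \<in> carrier (rsec T V) \<Longrightarrow>
    snd F V s \<in> carrier (rsec S (rpre S F V))"
  using rmor_hom ring_hom_closed by metis

lemma rmor_const:
  "F \<in> rmor S T \<Longrightarrow> openin (rtop T) V \<Longrightarrow> snd F V (rcst T V k) = rcst S (rpre S F V) k"
  by (simp add: rmor_def)

lemma rmor_restrict:
  "F \<in> rmor S T \<Longrightarrow> openin (rtop T) V \<Longrightarrow> openin (rtop T) W \<Longrightarrow> W \<subseteq> V \<Longrightarrow> s \<in> carrier (rsec T V) \<Longrightarrow>
    snd F W (rres T V W s) = rres S (rpre S F V) (rpre S F W) (snd F V s)"
  by (simp add: rmor_def)

lemma rmor_local:
  "F \<in> rmor S T \<Longrightarrow> x \<in> topspace (rtop S) \<Longrightarrow> openin (rtop T) V \<Longrightarrow> fst F x \<in> V \<Longrightarrow>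
    s \<in> carrier (rsec T V) \<Longrightarrow> germ_unit S (rpre S F V) (snd F V s) x \<Longrightarrow> germ_unit T V s (fst F x)"
  by (simp add: rmor_def)

lemma rpre_open: "F \<in> rmor S T \<Longrightarrow> openin (rtop T) V \<Longrightarrow> openin (rtop S) (rpre S F V)"
  unfolding rpre_def using rmor_continuous openin_continuous_map_preimage by fast

lemma rpre_mono: "V \<subseteq> W \<Longrightarrow> rpre S F V \<subseteq> rpre S F W"
  by (auto simp: rpre_def)

text \<open>Three layers of functions are compared: the point map, the family of comorphisms, and
  each comorphism. Each layer is extensional, so agreement where values are meaningful gives
  equality of pairs.\<close>

lemma rmor_eqI:
  assumes F: "F \<in> rmor S T" and G: "G \<in> rmor S T"
    and pt: "\<And>x. x \<in> topspace (rtop S) \<Longrightarrow> fst F x = fst G x"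
    and sec: "\<And>V s. openin (rtop T) V \<Longrightarrow> s \<in> carrier (rsec T V) \<Longrightarrow> snd F V s = snd G V s"
  shows "F = G"
proof (rule prod_eqI)
  show "fst F = fst G"
    by (rule extensionalityI[OF rmor_extensional[OF F] rmor_extensional[OF G] pt])
  show "snd F = snd G"
  proof (rule extensionalityI[OF rmor_snd_extensional[OF F] rmor_snd_extensional[OF G]])
    fix V assume "V \<in> {V. openin (rtop T) V}"
    then have V: "openin (rtop T) V" by simp
    show "snd F V = snd G V"
      by (rule extensionalityI[OF rmor_comorphism_extensional[OF F V]
            rmor_comorphism_extensional[OF G V] sec[OF V]])
  qed
qed

lemma fst_rcomp: "x \<in> topspace (rtop S) \<Longrightarrow> fst (rcomp S T R G F) x = fst G (fst F x)"
  by (simp add: rcomp_def)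

lemma snd_rcomp:
  "openin (rtop R) V \<Longrightarrow> s \<in> carrier (rsec R V) \<Longrightarrow>
    snd (rcomp S T R G F) V s = snd F (rpre T G V) (snd G V s)"
  by (simp add: rcomp_def)

lemma rpre_rcomp: "F \<in> rmor S T \<Longrightarrow> rpre S (rcomp S T R G F) V = rpre S F (rpre T G V)"
  by (auto simp: rpre_def rcomp_def rmor_point)

lemma rcomp_assoc:
  assumes F: "F \<in> rmor S T" and G: "G \<in> rmor T R" and H: "H \<in> rmor R Q"
  shows "rcomp S R Q H (rcomp S T R G F) = rcomp S T Q (rcomp T R Q H G) F"
proof (rule prod_eqI)
  show "fst (rcomp S R Q H (rcomp S T R G F)) = fst (rcomp S T Q (rcomp T R Q H G) F)"
    using rmor_point[OF F] by (auto simp: rcomp_def restrict_def)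
  show "snd (rcomp S R Q H (rcomp S T R G F)) = snd (rcomp S T Q (rcomp T R Q H G) F)"
  proof (intro ext)
    fix V s
    show "snd (rcomp S R Q H (rcomp S T R G F)) V s = snd (rcomp S T Q (rcomp T R Q H G) F) V s"
    proof (cases "openin (rtop Q) V \<and> s \<in> carrier (rsec Q V)")
      case True
      then show ?thesis
        using rpre_open[OF H] rmor_closed[OF H] by (simp add: snd_rcomp rpre_rcomp[OF G])
    next
      \<comment> \<open>Away from open sets and carriers both composites come from
        \<open>restrict\<close> and take the same default value.\<close>
      case False
      then show ?thesis by (auto simp: rcomp_def)
    qed
  qed
qed

lemma rpre_rid: "openin (rtop S) V \<Longrightarrow> rpre S (rid S) V = V"
  using openin_subset by (fastforce simp: rpre_def rid_def)

lemma rcomp_rid_left: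
  assumes F: "F \<in> rmor S T"
  shows "rcomp S T T (rid T) F = F"
proof (rule prod_eqI)
  show "fst (rcomp S T T (rid T) F) = fst F"
    using rmor_point[OF F] by (intro extensionalityI[OF _ rmor_extensional[OF F]])
      (auto simp: rcomp_def rid_def)
  show "snd (rcomp S T T (rid T) F) = snd F"
  proof (intro extensionalityI[OF _ rmor_snd_extensional[OF F]])
    fix V assume "V \<in> {V. openin (rtop T) V}"
    then have V: "openin (rtop T) V" by simp
    show "snd (rcomp S T T (rid T) F) V = snd F V"
      using V rpre_rid[OF V] by (intro extensionalityI[OF _ rmor_comorphism_extensional[OF F V]])
        (auto simp: rcomp_def rid_def)
  qed (auto simp: rcomp_def)
qed

lemma rinverse_sym: "rinverse S T F G \<Longrightarrow> rinverse T S G F"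
  by (auto simp: rinverse_def)

lemma rinverse_rmor: "rinverse S T F G \<Longrightarrow> F \<in> rmor S T" "rinverse S T F G \<Longrightarrow> G \<in> rmor T S"
  by (simp_all add: rinverse_def)

lemma rinverse_rpre:
  assumes "rinverse S T F G" "openin (rtop S) V"
  shows "rpre S F (rpre T G V) = V"
  using assms rpre_rcomp[of F S T S G V] rpre_rid by (metis rinverse_def)

lemma rinverse_point:
  assumes "rinverse S T F G" "x \<in> topspace (rtop S)"
  shows "fst G (fst F x) = x"
  using assms fst_rcomp[of x S T S G F] by (simp add: rinverse_def rid_def)

lemma rinverse_comorphism:
  assumes "rinverse S T F G" "openin (rtop S) V" "s \<in> carrier (rsec S V)"
  shows "snd F (rpre T G V) (snd G V s) = s"
  using assms snd_rcomp[of S V s S T G F] by (simp add: rinverse_def rid_def)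

text \<open>The record \<open>rspace\<close> carries no axioms. These are the facts about rings of
  sections on which restriction and inversion of morphisms rest: functorial restriction by ring
  homomorphisms, compatible with scalars. Spectra and their open subspaces satisfy them.\<close>

locale presheaf =
  fixes S :: "('p, 's) rspace"
  assumes sec_ring: "openin (rtop S) U \<Longrightarrow> ring (rsec S U)"
    and res_hom: "openin (rtop S) U \<Longrightarrow> openin (rtop S) W \<Longrightarrow> W \<subseteq> U \<Longrightarrow>
      rres S U W \<in> ring_hom (rsec S U) (rsec S W)"
    and res_res: "openin (rtop S) U \<Longrightarrow> openin (rtop S) V \<Longrightarrow> openin (rtop S) W \<Longrightarrow> W \<subseteq> V \<Longrightarrow> V \<subseteq> U \<Longrightarrow>
      s \<in> carrier (rsec S U) \<Longrightarrow> rres S V W (rres S U V s) = rres S U W s"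
    and cst_closed: "openin (rtop S) U \<Longrightarrow> rcst S U k \<in> carrier (rsec S U)"
    and res_cst: "openin (rtop S) U \<Longrightarrow> openin (rtop S) W \<Longrightarrow> W \<subseteq> U \<Longrightarrow>
      rres S U W (rcst S U k) = rcst S W k"
begin

lemma res_closed:
  "openin (rtop S) U \<Longrightarrow> openin (rtop S) W \<Longrightarrow> W \<subseteq> U \<Longrightarrow> s \<in> carrier (rsec S U) \<Longrightarrow>
    rres S U W s \<in> carrier (rsec S W)"
  using res_hom ring_hom_closed by metis

end

section \<open>Open subspaces and restriction of morphisms to them\<close>

lemma openin_ropen_sub:
  "openin (rtop S) U \<Longrightarrow> openin (rtop (ropen_sub S U)) W \<longleftrightarrow> openin (rtop S) W \<and> W \<subseteq> U"
  by (simp add: ropen_sub_def openin_open_subtopology)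

lemma topspace_ropen_sub:
  "openin (rtop S) U \<Longrightarrow> topspace (rtop (ropen_sub S U)) = U"
  using openin_subset by (fastforce simp: ropen_sub_def)

lemma ropen_sub_simps [simp]:
  "rsec (ropen_sub S U) = rsec S" "rres (ropen_sub S U) = rres S" "rcst (ropen_sub S U) = rcst S"
  by (simp_all add: ropen_sub_def)

lemma presheaf_ropen_sub:
  assumes "presheaf S" "openin (rtop S) U"
  shows "presheaf (ropen_sub S U)"
proof -
  interpret presheaf S by fact
  show ?thesis
    by (rule presheaf.intro)
      (auto simp: openin_ropen_sub[OF assms(2)] sec_ring res_hom res_res cst_closed res_cst)
qed

lemma germ_unit_ropen_sub:
  assumes "openin (rtop S) U" "V \<subseteq> U"
  shows "germ_unit (ropen_sub S U) V s x \<longleftrightarrow> germ_unit S V s x"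
  using assms by (auto simp: germ_unit_def openin_ropen_sub)

lemma rpre_rrestr:
  "openin (rtop S) U \<Longrightarrow> rpre (ropen_sub S U) (rrestr S T U V F) W = rpre S F W \<inter> U"
  using openin_subset[of "rtop S" U] by (auto simp: rpre_def rrestr_def topspace_ropen_sub)

lemma snd_rrestr:
  "openin (rtop T) V \<Longrightarrow> openin (rtop T) W \<Longrightarrow> W \<subseteq> V \<Longrightarrow> s \<in> carrier (rsec T W) \<Longrightarrow>
    snd (rrestr S T U V F) W s = rres S (rpre S F W) (rpre S F W \<inter> U) (snd F W s)"
  by (simp add: rrestr_def openin_ropen_sub)

text \<open>\<open>ring_hom\<close> depends only on values on the carrier. This transfers the
  homomorphism property to extensional restrictions, which are different functions.\<close>

lemma ring_hom_cong:
  assumes "ring R" "h \<in> ring_hom R S" "\<And>x. x \<in> carrier R \<Longrightarrow> g x = h x"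
  shows "g \<in> ring_hom R S"
proof -
  interpret ring R by fact
  show ?thesis
    using assms(2,3) by (intro ring_hom_memI) (auto simp: ring_hom_closed ring_hom_mult ring_hom_add ring_hom_one)
qed

lemma rrestr_rmor:
  assumes "presheaf S" "presheaf T" and F: "F \<in> rmor S T"
    and U: "openin (rtop S) U" and V: "openin (rtop T) V" and UV: "fst F ` U \<subseteq> V"
  shows "rrestr S T U V F \<in> rmor (ropen_sub S U) (ropen_sub T V)"
proof -
  interpret S: presheaf S by fact
  interpret T: presheaf T by fact
  let ?F = "rrestr S T U V F" and ?S = "ropen_sub S U" and ?T = "ropen_sub T V"
  note pre = rpre_rrestr[OF U, of T V F] and opT = openin_ropen_sub[OF V]
  have preo: "openin (rtop S) (rpre S F W \<inter> U)" if "openin (rtop T) W" for W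
    using that rpre_open[OF F] U by blast
  have ring: "snd ?F W \<in> ring_hom (rsec T W) (rsec S (rpre S F W \<inter> U))"
    if W: "openin (rtop T) W" "W \<subseteq> V" for W
  proof (rule ring_hom_cong)
    show "ring (rsec T W)" using W T.sec_ring by simp
    show "rres S (rpre S F W) (rpre S F W \<inter> U) \<circ> snd F W \<in> ring_hom (rsec T W) (rsec S (rpre S F W \<inter> U))"
      using W rmor_hom[OF F] S.res_hom preo rpre_open[OF F] by (intro ring_hom_trans) auto
  qed (simp add: snd_rrestr V W)
  have "continuous_map (rtop ?S) (rtop ?T) (fst ?F)"
    using continuous_map_from_subtopology[OF rmor_continuous[OF F], of U] UV
      openin_subset[OF U]
    by (auto simp: ropen_sub_def rrestr_def continuous_map_in_subtopology
        intro: continuous_map_eq[of "subtopology (rtop S) U" "rtop T" "fst F"])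
  moreover have "fst ?F \<in> extensional (topspace (rtop ?S))"
    using topspace_ropen_sub[OF U] by (simp add: rrestr_def)
  moreover have "snd ?F \<in> extensional {V. openin (rtop ?T) V}"
    by (simp add: rrestr_def)
  moreover have "snd ?F W \<in> extensional (carrier (rsec ?T W))" if "openin (rtop ?T) W" for W
    using that by (simp add: rrestr_def)
  moreover have "snd ?F W \<in> ring_hom (rsec ?T W) (rsec ?S (rpre ?S ?F W))" if "openin (rtop ?T) W" for W
    using that ring by (simp add: opT pre)
  moreover have "snd ?F W (rcst ?T W k) = rcst ?S (rpre ?S ?F W) k" if "openin (rtop ?T) W" for W k
    using that by (simp add: opT pre snd_rrestr V T.cst_closed rmor_const[OF F] S.res_cst preo rpre_open[OF F])
  moreover have "snd ?F W (rres ?T O' W s) = rres ?S (rpre ?S ?F O') (rpre ?S ?F W) (snd ?F O' s)"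
    if "openin (rtop ?T) O'" "openin (rtop ?T) W" "W \<subseteq> O'" "s \<in> carrier (rsec ?T O')" for O' W s
  proof -
    note op = preo rpre_open[OF F] rpre_mono[OF that(3), of S F]
    have "rpre S F W \<inter> U \<subseteq> rpre S F O' \<inter> U" using op by blast
    then show ?thesis
      using that op by (simp add: opT pre snd_rrestr V T.res_closed rmor_restrict[OF F] S.res_res rmor_closed[OF F])
  qed
  moreover have "germ_unit ?T W s (fst ?F x)"
    if x: "x \<in> topspace (rtop ?S)" and W: "openin (rtop ?T) W" and xW: "fst ?F x \<in> W"
      and s: "s \<in> carrier (rsec ?T W)" and u: "germ_unit ?S (rpre ?S ?F W) (snd ?F W s) x" for x W s
  proof -
    have xU: "x \<in> U" "x \<in> topspace (rtop S)"
      using x U openin_subset[OF U] by (auto simp: topspace_ropen_sub)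
    then have Fx: "fst ?F x = fst F x" by (simp add: rrestr_def)
    have W': "openin (rtop T) W" "W \<subseteq> V" using W opT by auto
    have "germ_unit S (rpre S F W \<inter> U) (rres S (rpre S F W) (rpre S F W \<inter> U) (snd F W s)) x"
      using u s by (simp add: pre snd_rrestr V W' germ_unit_ropen_sub U)
    then obtain O' where O': "openin (rtop S) O'" "x \<in> O'" "O' \<subseteq> rpre S F W \<inter> U"
      and unit: "rres S (rpre S F W \<inter> U) O' (rres S (rpre S F W) (rpre S F W \<inter> U) (snd F W s)) \<in> Units (rsec S O')"
      unfolding germ_unit_def by blast
    \<comment> \<open>The neighbourhood \<open>O'\<close> lies inside \<open>U\<close>, so the
      intermediate restriction to \<open>U\<close> loses nothing: the same \<open>O'\<close> shows
      that the unrestricted germ is a unit.\<close>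
    have "rres S (rpre S F W) O' (snd F W s) \<in> Units (rsec S O')"
      using unit S.res_res[OF rpre_open[OF F W'(1)] preo[OF W'(1)] O'(1,3) _ rmor_closed[OF F W'(1)]] s by simp
    then have "germ_unit S (rpre S F W) (snd F W s) x"
      using O' unfolding germ_unit_def by blast
    then show ?thesis
      using rmor_local[OF F xU(2) W'(1)] xW s Fx germ_unit_ropen_sub[OF V W'(2)] by simp
  qed
  ultimately show ?thesis unfolding rmor_def mem_Collect_eq by (intro conjI allI impI; (elim conjE)?) assumption+
qed

text \<open>On the right the section is cut down to \<open>rpre T G O' \<inter> V\<close> before
  \<open>snd F\<close> is applied, on the left only at the end. Naturality of \<open>snd F\<close>
  moves the restriction outward, and since \<open>fst F\<close> maps \<open>U\<close> into
  \<open>V\<close> the two preimages agree on \<open>U\<close>.\<close>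

lemma rrestr_rcomp:
  assumes "presheaf S" "presheaf T" "presheaf R" and F: "F \<in> rmor S T" and G: "G \<in> rmor T R"
    and U: "openin (rtop S) U" and V: "openin (rtop T) V" and W: "openin (rtop R) W"
    and UV: "fst F ` U \<subseteq> V" and VW: "fst G ` V \<subseteq> W"
  shows "rrestr S R U W (rcomp S T R G F) =
    rcomp (ropen_sub S U) (ropen_sub T V) (ropen_sub R W) (rrestr T R V W G) (rrestr S T U V F)"
proof (rule prod_eqI)
  interpret S: presheaf S by fact
  interpret T: presheaf T by fact
  interpret R: presheaf R by fact
  show "fst (rrestr S R U W (rcomp S T R G F)) =
    fst (rcomp (ropen_sub S U) (ropen_sub T V) (ropen_sub R W) (rrestr T R V W G) (rrestr S T U V F))"
    using UV openin_subset[OF U] topspace_ropen_sub[OF U]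
    by (auto simp: rrestr_def rcomp_def restrict_def fun_eq_iff)
  have "snd (rrestr S R U W (rcomp S T R G F)) O' s =
    snd (rcomp (ropen_sub S U) (ropen_sub T V) (ropen_sub R W) (rrestr T R V W G) (rrestr S T U V F)) O' s"
    if O': "openin (rtop R) O'" "O' \<subseteq> W" and s: "s \<in> carrier (rsec R O')" for O' s
  proof -
    have o1: "openin (rtop T) (rpre T G O')" "openin (rtop T) (rpre T G O' \<inter> V)"
      using rpre_open[OF G O'(1)] V by auto
    have o2: "openin (rtop S) (rpre S F (rpre T G O'))" "openin (rtop S) (rpre S F (rpre T G O' \<inter> V))"
      "openin (rtop S) (rpre S F (rpre T G O') \<inter> U)"
      using rpre_open[OF F o1(1)] rpre_open[OF F o1(2)] U by auto
    have c: "snd G O' s \<in> carrier (rsec T (rpre T G O'))" using rmor_closed[OF G O'(1) s] .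
    have eq: "rpre S F (rpre T G O' \<inter> V) \<inter> U = rpre S F (rpre T G O') \<inter> U"
      using UV by (auto simp: rpre_def)
    have sub: "rpre S F (rpre T G O') \<inter> U \<subseteq> rpre S F (rpre T G O' \<inter> V)"
      "rpre S F (rpre T G O' \<inter> V) \<subseteq> rpre S F (rpre T G O')"
      using UV by (auto simp: rpre_def)
    have "snd (rcomp (ropen_sub S U) (ropen_sub T V) (ropen_sub R W) (rrestr T R V W G) (rrestr S T U V F)) O' s
      = snd (rrestr S T U V F) (rpre T G O' \<inter> V) (snd (rrestr T R V W G) O' s)"
      using O' s by (simp add: snd_rcomp openin_ropen_sub W rpre_rrestr V)
    also have "\<dots> = rres S (rpre S F (rpre T G O' \<inter> V)) (rpre S F (rpre T G O') \<inter> U)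
        (snd F (rpre T G O' \<inter> V) (rres T (rpre T G O') (rpre T G O' \<inter> V) (snd G O' s)))"
      using O' s c o1 by (simp add: snd_rrestr W V T.res_closed eq)
    also have "\<dots> = rres S (rpre S F (rpre T G O')) (rpre S F (rpre T G O') \<inter> U) (snd F (rpre T G O') (snd G O' s))"
      using c o1 o2 sub by (simp add: rmor_restrict[OF F] S.res_res rmor_closed[OF F])
    also have "\<dots> = snd (rrestr S R U W (rcomp S T R G F)) O' s"
      using O' s by (simp add: snd_rrestr W snd_rcomp rpre_rcomp[OF F])
    finally show ?thesis by simp
  qed
  then show "snd (rrestr S R U W (rcomp S T R G F)) =
    snd (rcomp (ropen_sub S U) (ropen_sub T V) (ropen_sub R W) (rrestr T R V W G) (rrestr S T U V F))"
    by (auto simp: rrestr_def rcomp_def restrict_def fun_eq_iff openin_ropen_sub[OF W])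
qed

section \<open>Inverting a morphism that is bijective on points and on sections\<close>

lemma ring_hom_Units:
  assumes "h \<in> ring_hom R S" "x \<in> Units R"
  shows "h x \<in> Units S"
proof -
  obtain y where y: "y \<in> carrier R" "x \<otimes>\<^bsub>R\<^esub> y = \<one>\<^bsub>R\<^esub>" "y \<otimes>\<^bsub>R\<^esub> x = \<one>\<^bsub>R\<^esub>" and x: "x \<in> carrier R"
    using assms(2) by (auto simp: Units_def)
  note h = ring_hom_closed[OF assms(1)] ring_hom_mult[OF assms(1), symmetric] ring_hom_one[OF assms(1)]
  show ?thesis
    unfolding Units_def using x y by (auto simp: h intro!: bexI[of _ "h y"])
qed

text \<open>The comorphism of the inverse over \<open>W\<close> must be the inverse function of the
  comorphism of \<open>F\<close> over the image of \<open>W\<close>. Ring operations, scalars and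
  restrictions are then respected because \<open>F\<close> respects them and is injective on
  sections; locality needs its own argument with units.\<close>

lemma rinverse_of_homeomorphism:
  assumes "presheaf S" "presheaf T" and F: "F \<in> rmor S T"
    and homeo: "homeomorphic_map (rtop S) (rtop T) (fst F)"
    and bij: "\<And>V. openin (rtop T) V \<Longrightarrow> bij_betw (snd F V) (carrier (rsec T V)) (carrier (rsec S (rpre S F V)))"
  shows "\<exists>G. rinverse S T F G"
proof -
  interpret S: presheaf S by fact
  interpret T: presheaf T by fact
  from homeo obtain g where g: "homeomorphic_maps (rtop S) (rtop T) (fst F) g"
    unfolding homeomorphic_map_maps by blast
  have gF: "g (fst F x) = x" if "x \<in> topspace (rtop S)" for x
    using g that unfolding homeomorphic_maps_def by blast
  have Fg: "fst F (g y) = y" if "y \<in> topspace (rtop T)" for y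
    using g that unfolding homeomorphic_maps_def by blast
  have gc: "continuous_map (rtop T) (rtop S) g"
    using g unfolding homeomorphic_maps_def by blast
  have gpt: "g y \<in> topspace (rtop S)" if "y \<in> topspace (rtop T)" for y
    using gc that by (metis continuous_map_image_subset_topspace image_subset_iff)
  \<comment> \<open>\<open>q W\<close> is the image of \<open>W\<close> under \<open>fst F\<close>,
    written as a preimage under \<open>g\<close> so that its openness is continuity of
    \<open>g\<close>.\<close>
  define q where "q W = {y \<in> topspace (rtop T). g y \<in> W}" for W
  have qo: "openin (rtop T) (q W)" if "openin (rtop S) W" for W
    using openin_continuous_map_preimage[OF gc that] by (simp add: q_def)
  have Fq: "rpre S F (q W) = W" if "openin (rtop S) W" for W
    using openin_subset[OF that] gF rmor_point[OF F] by (auto simp: rpre_def q_def)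
  have qF: "q (rpre S F V) = V" if "openin (rtop T) V" for V
    using openin_subset[OF that] Fg gpt by (auto simp: rpre_def q_def)
  define c where "c W s = inv_into (carrier (rsec T (q W))) (snd F (q W)) s" for W s
  define G where "G = (\<lambda>y\<in>topspace (rtop T). g y,
    \<lambda>W\<in>{W. openin (rtop S) W}. \<lambda>s\<in>carrier (rsec S W). c W s)"
  have fstG: "fst G y = g y" if "y \<in> topspace (rtop T)" for y
    using that by (simp add: G_def)
  have preG: "rpre T G W = q W" for W
    unfolding rpre_def q_def by (rule Collect_cong, rule conj_cong[OF refl]) (simp only: fstG)
  have bijq: "bij_betw (snd F (q W)) (carrier (rsec T (q W))) (carrier (rsec S W))" if "openin (rtop S) W" for W
    using bij[OF qo[OF that]] Fq[OF that] by simp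
  have cc: "c W s \<in> carrier (rsec T (q W))" and Fc: "snd F (q W) (c W s) = s"
    if "openin (rtop S) W" "s \<in> carrier (rsec S W)" for W s
    using bijq[OF that(1)] that(2) unfolding c_def
    by (auto simp: bij_betw_def inv_into_into f_inv_into_f)
  have cF: "c W (snd F (q W) t) = t"
    if "openin (rtop S) W" "t \<in> carrier (rsec T (q W))" for W t
    using bijq[OF that(1)] that(2) unfolding c_def by (simp add: bij_betw_def)
  have hF: "snd F (q W) \<in> ring_hom (rsec T (q W)) (rsec S W)" if "openin (rtop S) W" for W
    using rmor_hom[OF F qo[OF that]] Fq[OF that] by simp
  have hc: "c W \<in> ring_hom (rsec S W) (rsec T (q W))" if W: "openin (rtop S) W" for W
  proof (rule ring_hom_memI)
    interpret SW: ring "rsec S W" using W S.sec_ring by simp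
    interpret TW: ring "rsec T (q W)" using qo[OF W] T.sec_ring by simp
    fix x y assume xy: "x \<in> carrier (rsec S W)" "y \<in> carrier (rsec S W)"
    note * = cc[OF W] Fc[OF W]
    show "c W (x \<otimes>\<^bsub>rsec S W\<^esub> y) = c W x \<otimes>\<^bsub>rsec T (q W)\<^esub> c W y"
      using cF[OF W, of "c W x \<otimes>\<^bsub>rsec T (q W)\<^esub> c W y"] xy
      by (simp add: * ring_hom_mult[OF hF[OF W]])
    show "c W (x \<oplus>\<^bsub>rsec S W\<^esub> y) = c W x \<oplus>\<^bsub>rsec T (q W)\<^esub> c W y"
      using cF[OF W, of "c W x \<oplus>\<^bsub>rsec T (q W)\<^esub> c W y"] xy
      by (simp add: * ring_hom_add[OF hF[OF W]])
  next
    interpret TW: ring "rsec T (q W)" using qo[OF W] T.sec_ring by simp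
    show "c W \<one>\<^bsub>rsec S W\<^esub> = \<one>\<^bsub>rsec T (q W)\<^esub>"
      using cF[OF W, of "\<one>\<^bsub>rsec T (q W)\<^esub>"] ring_hom_one[OF hF[OF W]] by simp
  qed (simp add: cc W)
  have sndG: "snd G W s = c W s" if "openin (rtop S) W" "s \<in> carrier (rsec S W)" for W s
    using that by (simp add: G_def)
  have G: "G \<in> rmor T S"
    unfolding rmor_def mem_Collect_eq
  proof (intro conjI allI impI; (elim conjE)?)
    show "fst G \<in> extensional (topspace (rtop T))" by (simp add: G_def)
    show "continuous_map (rtop T) (rtop S) (fst G)"
      by (rule continuous_map_eq[OF gc]) (simp add: G_def)
    show "snd G \<in> extensional {V. openin (rtop S) V}" by (simp add: G_def)
  next
    fix W assume W: "openin (rtop S) W"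
    show "snd G W \<in> extensional (carrier (rsec S W))" using W by (simp add: G_def)
    show "snd G W \<in> ring_hom (rsec S W) (rsec T (rpre T G W))"
      using ring_hom_cong[OF S.sec_ring[OF W] hc[OF W]] sndG[OF W] by (simp add: preG)
    fix k show "snd G W (rcst S W k) = rcst T (rpre T G W) k"
      using cF[OF W T.cst_closed[OF qo[OF W]]] rmor_const[OF F qo[OF W]] Fq[OF W]
      by (simp add: sndG W S.cst_closed preG)
  next
    fix V W s assume as: "openin (rtop S) V" "openin (rtop S) W" "W \<subseteq> V" "s \<in> carrier (rsec S V)"
    have "q W \<subseteq> q V" using as(3) by (auto simp: q_def)
    \<comment> \<open>Compatibility with restriction is tested after applying the injective map
      \<open>snd F (q W)\<close>.\<close>
    then have "snd F (q W) (rres T (q V) (q W) (c V s)) = rres S V W s"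
      using as qo by (simp add: rmor_restrict[OF F] cc Fc Fq)
    then have "c W (rres S V W s) = rres T (q V) (q W) (c V s)"
      using cF[OF as(2), of "rres T (q V) (q W) (c V s)"] as qo cc \<open>q W \<subseteq> q V\<close> T.res_closed by simp
    then show "snd G W (rres S V W s) = rres T (rpre T G V) (rpre T G W) (snd G V s)"
      using as S.res_closed by (simp add: sndG preG)
  next
    fix y V s assume y: "y \<in> topspace (rtop T)" and V: "openin (rtop S) V" "fst G y \<in> V"
      and s: "s \<in> carrier (rsec S V)" and u: "germ_unit T (rpre T G V) (snd G V s) y"
    then obtain W where W: "openin (rtop T) W" "y \<in> W" "W \<subseteq> q V" and unit: "rres T (q V) W (c V s) \<in> Units (rsec T W)"
      unfolding germ_unit_def preG by (auto simp: sndG)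
    \<comment> \<open>Locality: a unit over \<open>W\<close> goes under the ring homomorphism
      \<open>snd F W\<close> to a unit over the preimage of \<open>W\<close>, and this unit is the
      restriction of \<open>s\<close>.\<close>
    have "snd F W (rres T (q V) W (c V s)) \<in> Units (rsec S (rpre S F W))"
      by (rule ring_hom_Units[OF rmor_hom[OF F W(1)] unit])
    then have "rres S V (rpre S F W) s \<in> Units (rsec S (rpre S F W))"
      using rmor_restrict[OF F qo[OF V(1)] W(1,3) cc[OF V(1) s]] Fq[OF V(1)] Fc[OF V(1) s] by simp
    moreover have "fst G y \<in> rpre S F W" using y W Fg gpt by (simp add: fstG rpre_def)
    moreover have "rpre S F W \<subseteq> V" using rpre_mono[OF W(3), of S F] Fq[OF V(1)] by simp
    ultimately show "germ_unit S V s (fst G y)"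
      using rpre_open[OF F W(1)] unfolding germ_unit_def by blast
  qed
  have "rcomp S T S G F = rid S"
    using gF rmor_point[OF F] Fc
    by (auto simp: rcomp_def rid_def preG restrict_def fun_eq_iff sndG fstG)
  moreover have "rcomp T S T F G = rid T"
  proof -
    have "c (rpre S F V) (snd F V s) = s" if "openin (rtop T) V" "s \<in> carrier (rsec T V)" for V s
      using cF[OF rpre_open[OF F that(1)], of s] qF[OF that(1)] that(2) by simp
    then show ?thesis
      using Fg rpre_open[OF F] rmor_closed[OF F]
      by (auto simp: rcomp_def rid_def restrict_def fun_eq_iff sndG fstG gpt)
  qed
  ultimately have "rinverse S T F G" using F G by (simp add: rinverse_def)
  then show ?thesis ..
qed

section \<open>Closed subschemes preserved by an automorphism\<close>

text \<open>Inclusions for \<open>F\<close> and for its inverse \<open>G\<close> suffice. The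
  reverse inclusion of ideals is the one for \<open>G\<close>, transported back by \<open>F\<close>;
  the supports agree because a neighbourhood on which the ideal contains 1 can be pulled back along
  either morphism.\<close>

lemma preservesI:
  assumes "presheaf S" and FG: "rinverse S S F G"
    and J: "\<And>V. openin (rtop S) V \<Longrightarrow> J V \<subseteq> carrier (rsec S V)"
    and FJ: "\<And>V. openin (rtop S) V \<Longrightarrow> snd F V ` J V \<subseteq> J (rpre S F V)"
    and GJ: "\<And>V. openin (rtop S) V \<Longrightarrow> snd G V ` J V \<subseteq> J (rpre S G V)"
  shows "preserves S F J"
proof -
  interpret presheaf S by fact
  note F = rinverse_rmor(1)[OF FG] and G = rinverse_rmor(2)[OF FG]
  note GF = rinverse_sym[OF FG]
  have eq: "snd F V ` J V = J (rpre S F V)" if V: "openin (rtop S) V" for V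
  proof
    show "J (rpre S F V) \<subseteq> snd F V ` J V"
    proof
      fix t assume t: "t \<in> J (rpre S F V)"
      have pre: "rpre S G (rpre S F V) = V" by (rule rinverse_rpre[OF GF V])
      have "snd G (rpre S F V) t \<in> J V" using GJ[OF rpre_open[OF F V]] t pre by auto
      moreover have "snd F V (snd G (rpre S F V) t) = t"
        using rinverse_comorphism[OF FG rpre_open[OF F V], of t] J[OF rpre_open[OF F V]] t pre by auto
      ultimately show "t \<in> snd F V ` J V" by (metis image_eqI)
    qed
  qed (rule FJ[OF V])
  \<comment> \<open>Quantified over its own pair of inverse morphisms, since both orders of
    \<open>F\<close> and \<open>G\<close> are needed.\<close>
  have out: "x \<in> supp S J" if FG: "rinverse S S F G" and x: "x \<in> topspace (rtop S)" and Fx: "fst F x \<in> supp S J"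
    and GJ: "\<And>V. openin (rtop S) V \<Longrightarrow> snd G V ` J V \<subseteq> J (rpre S G V)" for x F G
  proof (rule ccontr)
    assume "x \<notin> supp S J"
    then obtain W where W: "openin (rtop S) W" "x \<in> W" "\<one>\<^bsub>rsec S W\<^esub> \<in> J W"
      using x by (auto simp: supp_def)
    note F = rinverse_rmor(1)[OF FG] and G = rinverse_rmor(2)[OF FG]
    have "snd G W \<one>\<^bsub>rsec S W\<^esub> = \<one>\<^bsub>rsec S (rpre S G W)\<^esub>"
      by (rule ring_hom_one[OF rmor_hom[OF G W(1)]])
    then have "\<one>\<^bsub>rsec S (rpre S G W)\<^esub> \<in> J (rpre S G W)"
      using GJ[OF W(1)] W(3) by force
    moreover have "fst F x \<in> rpre S G W"
      using W(2) x rmor_point[OF F] rinverse_point[OF FG] by (simp add: rpre_def)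
    ultimately show False
      using Fx rpre_open[OF G W(1)] unfolding supp_def by blast
  qed
  have top: "x \<in> topspace (rtop S)" if "x \<in> supp S J" for x using that by (simp add: supp_def)
  have "fst F ` supp S J = supp S J"
  proof (intro equalityI subsetI)
    fix y assume "y \<in> fst F ` supp S J"
    then obtain x where x: "x \<in> supp S J" "y = fst F x" by blast
    show "y \<in> supp S J"
      using out[OF GF _ _ FJ, of y] x rinverse_point[OF FG] top rmor_point[OF F] by simp
  next
    fix y assume y: "y \<in> supp S J"
    have "fst G y \<in> supp S J"
      using out[OF FG _ _ GJ, of "fst G y"] y rinverse_point[OF GF] top rmor_point[OF G] by simp
    then show "y \<in> fst F ` supp S J"
      using rinverse_point[OF GF top[OF y]] by (metis image_eqI)
  qed
  then show ?thesis using eq by (simp add: preserves_def)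
qed

text \<open>A point mapped into the support has the same image as some point of the support, and
  \<open>fst F\<close> is injective because it has an inverse.\<close>

lemma preserves_compl:
  assumes F: "rinverse S S F G" and J: "preserves S F J"
  shows "fst F ` (topspace (rtop S) - supp S J) \<subseteq> topspace (rtop S) - supp S J"
proof -
  have "x \<in> supp S J" if x: "x \<in> topspace (rtop S)" "fst F x \<in> supp S J" for x
  proof -
    obtain z where z: "z \<in> supp S J" "fst F x = fst F z"
      using x(2) J unfolding preserves_def by blast
    moreover from z(1) have "z \<in> topspace (rtop S)" by (simp add: supp_def)
    ultimately have "x = z" using rinverse_point[OF F x(1)] rinverse_point[OF F] by metis
    then show ?thesis using z(1) by simp
  qed
  then show ?thesis using rmor_point[OF rinverse_rmor(1)[OF F]] by blast
qed

text \<open>A neighbourhood on which 1 lies in the ideal serves all of its points at once.\<close>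

lemma openin_compl_supp: "openin (rtop S) (topspace (rtop S) - supp S J)"
proof (subst openin_subopen, intro ballI)
  fix x assume "x \<in> topspace (rtop S) - supp S J"
  then obtain W where W: "openin (rtop S) W" "x \<in> W" "\<one>\<^bsub>rsec S W\<^esub> \<in> J W"
    by (auto simp: supp_def)
  then have "W \<subseteq> topspace (rtop S) - supp S J"
    using openin_subset[OF W(1)] by (auto simp: supp_def)
  then show "\<exists>T. openin (rtop S) T \<and> x \<in> T \<and> T \<subseteq> topspace (rtop S) - supp S J"
    using W by blast
qed

section \<open>Ideal sheaves generated by pulled back sections\<close>

lemma ring_hom_genideal:
  assumes R: "ring R" and S: "ring S" and h: "h \<in> ring_hom R S" and x: "x \<in> Idl\<^bsub>R\<^esub> M"
    and sub: "M \<subseteq> carrier R" "h ` M \<subseteq> N" "N \<subseteq> carrier S"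
  shows "h x \<in> Idl\<^bsub>S\<^esub> N"
proof -
  have "ideal {r \<in> carrier R. h r \<in> Idl\<^bsub>S\<^esub> N} R"
    by (rule ring_hom_ring.ideal_vimage[OF ring_hom_ringI2[OF R S h] ring.genideal_ideal[OF S sub(3)]])
  moreover have "M \<subseteq> {r \<in> carrier R. h r \<in> Idl\<^bsub>S\<^esub> N}"
    using ring.genideal_self[OF S sub(3)] sub(1,2) by blast
  ultimately have "Idl\<^bsub>R\<^esub> M \<subseteq> {r \<in> carrier R. h r \<in> Idl\<^bsub>S\<^esub> N}"
    by (rule ring.genideal_minimal[OF R])
  then show ?thesis using x by blast
qed

text \<open>A local presentation over \<open>W\<close> by sections over \<open>Z\<close> is pulled
  back to the preimage of \<open>W\<close> under \<open>F\<close> and that of \<open>Z\<close> under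
  \<open>H\<close>. Because the square commutes, generators are sent to generators. Applied to the
  lift and to its inverse, this gives the two inclusions behind preservation of the exceptional
  divisor.\<close>

lemma inv_img_comorphism:
  assumes "presheaf S" "presheaf T" and F: "F \<in> rmor S S" and H: "H \<in> rmor T T" and \<sigma>: "\<sigma> \<in> rmor S T"
    and comm: "rcomp S S T \<sigma> F = rcomp S T T H \<sigma>"
    and C: "\<And>V. openin (rtop T) V \<Longrightarrow> C V \<subseteq> carrier (rsec T V)"
    and HC: "\<And>V. openin (rtop T) V \<Longrightarrow> snd H V ` C V \<subseteq> C (rpre T H V)"
    and V: "openin (rtop S) V"
  shows "snd F V ` inv_img S T \<sigma> C V \<subseteq> inv_img S T \<sigma> C (rpre S F V)"
proof
  interpret S: presheaf S by fact
  interpret T: presheaf T by fact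
  fix t assume "t \<in> snd F V ` inv_img S T \<sigma> C V"
  then obtain s where s: "s \<in> inv_img S T \<sigma> C V" and t: "t = snd F V s" by blast
  then have sc: "s \<in> carrier (rsec S V)" by (simp add: inv_img_def)
  have "\<exists>W Z. openin (rtop S) W \<and> x \<in> W \<and> W \<subseteq> rpre S F V \<and> openin (rtop T) Z \<and> W \<subseteq> rpre S \<sigma> Z \<and>
      rres S (rpre S F V) W t \<in> Idl\<^bsub>rsec S W\<^esub> ((\<lambda>j. rres S (rpre S \<sigma> Z) W (snd \<sigma> Z j)) ` C Z)"
    if x: "x \<in> rpre S F V" for x
  proof -
    have "fst F x \<in> V" using x by (simp add: rpre_def)
    then obtain W Z where W: "openin (rtop S) W" "fst F x \<in> W" "W \<subseteq> V" "openin (rtop T) Z" "W \<subseteq> rpre S \<sigma> Z"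
      and g: "rres S V W s \<in> Idl\<^bsub>rsec S W\<^esub> ((\<lambda>j. rres S (rpre S \<sigma> Z) W (snd \<sigma> Z j)) ` C Z)"
      using s unfolding inv_img_def by blast
    let ?W = "rpre S F W" and ?Z = "rpre T H Z"
    have oW: "openin (rtop S) ?W" and oZ: "openin (rtop T) ?Z"
      using rpre_open[OF F W(1)] rpre_open[OF H W(4)] by auto
    \<comment> \<open>The square enters on the level of open sets: its two composites have the same
      preimage of \<open>Z\<close>.\<close>
    have pre: "rpre S F (rpre S \<sigma> Z) = rpre S \<sigma> ?Z"
      using comm rpre_rcomp[OF F, of T \<sigma> Z] rpre_rcomp[OF \<sigma>, of T H Z] by simp
    have WZ: "?W \<subseteq> rpre S \<sigma> ?Z" using rpre_mono[OF W(5), of S F] pre by simp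
    have o\<sigma>: "openin (rtop S) (rpre S \<sigma> Z)" "openin (rtop S) (rpre S \<sigma> ?Z)"
      using rpre_open[OF \<sigma>] W(4) oZ by auto
    have sub1: "(\<lambda>j. rres S (rpre S \<sigma> Z) W (snd \<sigma> Z j)) ` C Z \<subseteq> carrier (rsec S W)"
      using C[OF W(4)] rmor_closed[OF \<sigma> W(4)] S.res_closed[OF o\<sigma>(1) W(1,5)] by blast
    have sub2: "(\<lambda>j. rres S (rpre S \<sigma> ?Z) ?W (snd \<sigma> ?Z j)) ` C ?Z \<subseteq> carrier (rsec S ?W)"
      using C[OF oZ] rmor_closed[OF \<sigma> oZ] S.res_closed[OF o\<sigma>(2) oW WZ] by blast
    have "snd F W (rres S (rpre S \<sigma> Z) W (snd \<sigma> Z j)) = rres S (rpre S \<sigma> ?Z) ?W (snd \<sigma> ?Z (snd H Z j))"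
      if "j \<in> C Z" for j
    proof -
      have j: "j \<in> carrier (rsec T Z)" using that C[OF W(4)] by blast
      have "snd F (rpre S \<sigma> Z) (snd \<sigma> Z j) = snd \<sigma> ?Z (snd H Z j)"
        using snd_rcomp[of T Z j S S \<sigma> F] snd_rcomp[of T Z j S T H \<sigma>] W(4) j comm by simp
      then show ?thesis
        using rmor_restrict[OF F o\<sigma>(1) W(1,5) rmor_closed[OF \<sigma> W(4) j]] pre by simp
    qed
    then have img: "snd F W ` ((\<lambda>j. rres S (rpre S \<sigma> Z) W (snd \<sigma> Z j)) ` C Z)
        \<subseteq> (\<lambda>j. rres S (rpre S \<sigma> ?Z) ?W (snd \<sigma> ?Z j)) ` C ?Z"
      using HC[OF W(4)] by auto
    have "snd F W (rres S V W s) \<in> Idl\<^bsub>rsec S ?W\<^esub> ((\<lambda>j. rres S (rpre S \<sigma> ?Z) ?W (snd \<sigma> ?Z j)) ` C ?Z)"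
      by (rule ring_hom_genideal[OF S.sec_ring[OF W(1)] S.sec_ring[OF oW] rmor_hom[OF F W(1)] g sub1 img sub2])
    moreover have "snd F W (rres S V W s) = rres S (rpre S F V) ?W t"
      using rmor_restrict[OF F V W(1,3) sc] t by simp
    moreover have "x \<in> ?W" using x W(2) by (simp add: rpre_def)
    ultimately show ?thesis using oW rpre_mono[OF W(3), of S F] oZ WZ by metis
  qed
  then show "t \<in> inv_img S T \<sigma> C (rpre S F V)"
    using rmor_closed[OF F V sc] t unfolding inv_img_def by blast
qed

section \<open>Localizations at prime ideals\<close>

context primeideal
begin

lemma compl_mult: "s \<in> carrier R - I \<Longrightarrow> t \<in> carrier R - I \<Longrightarrow> s \<otimes> t \<in> carrier R - I"
  using I_prime[of s t] by auto

lemma compl_one: "\<one> \<in> carrier R - I"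
  using I_notcarr one_imp_carrier by blast

lemma compl_nat_pow: "s \<in> carrier R - I \<Longrightarrow> s [^] (n::nat) \<in> carrier R - I"
  by (induction n) (use compl_one compl_mult in auto)

lemma minus_eq_zero_iff: "x \<in> carrier R \<Longrightarrow> y \<in> carrier R \<Longrightarrow> x \<ominus> y = \<zero> \<longleftrightarrow> x = y"
  using r_right_minus_eq by simp

text \<open>\<open>lfrac\<close> tests whether a difference is annihilated; the form with an
  equation keeps subtraction out of all later manipulations of fractions.\<close>

lemma mem_lfrac_iff:
  assumes "a \<in> carrier R" "s \<in> carrier R"
  shows "(b, t) \<in> lfrac R I a s \<longleftrightarrow> b \<in> carrier R \<and> t \<in> carrier R - I \<and>
    (\<exists>u\<in>carrier R - I. u \<otimes> (t \<otimes> a) = u \<otimes> (s \<otimes> b))"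
proof -
  have "u \<otimes> (t \<otimes> a \<ominus> s \<otimes> b) = \<zero> \<longleftrightarrow> u \<otimes> (t \<otimes> a) = u \<otimes> (s \<otimes> b)"
    if "u \<in> carrier R" "b \<in> carrier R" "t \<in> carrier R" for u
  proof -
    have "u \<otimes> (t \<otimes> a \<ominus> s \<otimes> b) = u \<otimes> (t \<otimes> a) \<ominus> u \<otimes> (s \<otimes> b)"
      using assms that by (simp add: a_minus_def r_distr r_minus)
    then show ?thesis using assms that minus_eq_zero_iff by simp
  qed
  then show ?thesis unfolding lfrac_def by auto
qed

lemma lfrac_self: "a \<in> carrier R \<Longrightarrow> s \<in> carrier R - I \<Longrightarrow> (a, s) \<in> lfrac R I a s"
  using compl_one by (auto simp: mem_lfrac_iff)

text \<open>Transitivity of equality of fractions with \<open>(a, s)\<close> in the middle. If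
  \<open>u\<close> and \<open>v\<close> are the multipliers of the two given equations,
  \<open>u \<otimes> v \<otimes> s\<close> is one for the third; the factor \<open>s\<close> absorbs
  the middle denominator and is outside the prime like the others.\<close>

lemma lfrac_subset:
  assumes as: "a \<in> carrier R" "s \<in> carrier R - I" and bt: "(b, t) \<in> lfrac R I a s"
  shows "lfrac R I a s \<subseteq> lfrac R I b t"
proof clarify
  fix c r assume cr: "(c, r) \<in> lfrac R I a s"
  have car: "a \<in> carrier R" "s \<in> carrier R" "b \<in> carrier R" "t \<in> carrier R" "c \<in> carrier R" "r \<in> carrier R"
    using as bt cr by (auto simp: mem_lfrac_iff)
  obtain u where u: "u \<in> carrier R - I" "u \<otimes> (t \<otimes> a) = u \<otimes> (s \<otimes> b)"
    using bt car by (auto simp: mem_lfrac_iff)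
  obtain v where v: "v \<in> carrier R - I" "v \<otimes> (r \<otimes> a) = v \<otimes> (s \<otimes> c)"
    using cr car by (auto simp: mem_lfrac_iff)
  have uv: "u \<in> carrier R" "v \<in> carrier R" using u v by auto
  have "(u \<otimes> v \<otimes> s) \<otimes> (r \<otimes> b) = (v \<otimes> r) \<otimes> (u \<otimes> (s \<otimes> b))"
    using car uv by (simp add: m_ac)
  also have "\<dots> = (v \<otimes> r) \<otimes> (u \<otimes> (t \<otimes> a))" using u by simp
  also have "\<dots> = (u \<otimes> t) \<otimes> (v \<otimes> (r \<otimes> a))" using car uv by (simp add: m_ac)
  also have "\<dots> = (u \<otimes> t) \<otimes> (v \<otimes> (s \<otimes> c))" using v by simp
  also have "\<dots> = (u \<otimes> v \<otimes> s) \<otimes> (t \<otimes> c)" using car uv by (simp add: m_ac)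
  finally have "\<exists>w\<in>carrier R - I. w \<otimes> (r \<otimes> b) = w \<otimes> (t \<otimes> c)"
    using compl_mult[OF compl_mult[OF u(1) v(1)] as(2)] by blast
  then show "(c, r) \<in> lfrac R I b t"
    using cr car as by (auto simp: mem_lfrac_iff)
qed

lemma lfrac_sym:
  "a \<in> carrier R \<Longrightarrow> s \<in> carrier R - I \<Longrightarrow> (b, t) \<in> lfrac R I a s \<Longrightarrow> (a, s) \<in> lfrac R I b t"
proof -
  assume as: "a \<in> carrier R" "s \<in> carrier R - I" "(b, t) \<in> lfrac R I a s"
  then obtain u where u: "b \<in> carrier R" "t \<in> carrier R" "u \<in> carrier R - I" "u \<otimes> (s \<otimes> b) = u \<otimes> (t \<otimes> a)"
    by (auto simp: mem_lfrac_iff)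
  then show "(a, s) \<in> lfrac R I b t"
    using as(1,2) by (auto simp: mem_lfrac_iff)
qed

lemma lfrac_eq_iff_mem:
  assumes "a \<in> carrier R" "s \<in> carrier R - I" "b \<in> carrier R" "t \<in> carrier R - I"
  shows "lfrac R I a s = lfrac R I b t \<longleftrightarrow> (b, t) \<in> lfrac R I a s"
  using assms lfrac_self lfrac_subset lfrac_sym by (metis subset_antisym)

lemma lfrac_eq_iff:
  assumes "a \<in> carrier R" "s \<in> carrier R - I" "b \<in> carrier R" "t \<in> carrier R - I"
  shows "lfrac R I a s = lfrac R I b t \<longleftrightarrow> (\<exists>u\<in>carrier R - I. u \<otimes> (t \<otimes> a) = u \<otimes> (s \<otimes> b))"
  using assms by (simp add: lfrac_eq_iff_mem mem_lfrac_iff)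

lemma lfrac_eqI:
  assumes "a \<in> carrier R" "s \<in> carrier R - I" "b \<in> carrier R" "t \<in> carrier R - I" "t \<otimes> a = s \<otimes> b"
  shows "lfrac R I a s = lfrac R I b t"
  using assms compl_one by (auto simp: lfrac_eq_iff)

lemma lfrac_cancel:
  assumes "a \<in> carrier R" "s \<in> carrier R - I" "u \<in> carrier R - I"
  shows "lfrac R I (u \<otimes> a) (u \<otimes> s) = lfrac R I a s"
  using assms compl_mult by (intro lfrac_eqI) (auto simp: m_ac)

lemma mem_lfrac_eq:
  assumes "a \<in> carrier R" "s \<in> carrier R - I" "p \<in> lfrac R I a s"
  obtains b t where "p = (b, t)" "b \<in> carrier R" "t \<in> carrier R - I" "lfrac R I a s = lfrac R I b t"
proof (cases p)
  case (Pair b t)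
  then have "b \<in> carrier R" "t \<in> carrier R - I"
    using assms by (auto simp: mem_lfrac_iff)
  then show ?thesis using that Pair assms lfrac_eq_iff_mem by blast
qed

lemma lfrac_closed: "a \<in> carrier R \<Longrightarrow> s \<in> carrier R - I \<Longrightarrow> lfrac R I a s \<in> carrier (loc R I)"
  by (auto simp: loc_def)

lemma loc_carrierE:
  assumes "x \<in> carrier (loc R I)"
  obtains a s where "x = lfrac R I a s" "a \<in> carrier R" "s \<in> carrier R - I"
  using assms by (auto simp: loc_def)

text \<open>The operations on a localization are unions over all representatives. If every
  representative yields the same \<open>z\<close>, the union is \<open>z\<close>, because a class of
  fractions is never empty.\<close>

lemma UN_lfrac_const:
  assumes "a \<in> carrier R" "s \<in> carrier R - I"
    and "\<And>b t. b \<in> carrier R \<Longrightarrow> t \<in> carrier R - I \<Longrightarrow> lfrac R I b t = lfrac R I a s \<Longrightarrow> g b t = z"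
  shows "(\<Union>(b, t)\<in>lfrac R I a s. g b t) = z"
proof -
  have "g b t = z" if "(b, t) \<in> lfrac R I a s" for b t
    by (rule mem_lfrac_eq[OF assms(1,2) that]) (simp add: assms(3))
  then show ?thesis using lfrac_self[OF assms(1,2)] by auto
qed

lemma lfrac_mult_cong:
  assumes "a \<in> carrier R" "s \<in> carrier R - I" "b \<in> carrier R" "t \<in> carrier R - I"
    and "a' \<in> carrier R" "s' \<in> carrier R - I" "b' \<in> carrier R" "t' \<in> carrier R - I"
    and "lfrac R I a' s' = lfrac R I a s" "lfrac R I b' t' = lfrac R I b t"
  shows "lfrac R I (a' \<otimes> b') (s' \<otimes> t') = lfrac R I (a \<otimes> b) (s \<otimes> t)"
proof -
  obtain u where u: "u \<in> carrier R - I" "u \<otimes> (s \<otimes> a') = u \<otimes> (s' \<otimes> a)"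
    using assms lfrac_eq_iff[of a' s' a s] by auto
  obtain v where v: "v \<in> carrier R - I" "v \<otimes> (t \<otimes> b') = v \<otimes> (t' \<otimes> b)"
    using assms lfrac_eq_iff[of b' t' b t] by auto
  have car: "a \<in> carrier R" "s \<in> carrier R" "b \<in> carrier R" "t \<in> carrier R" "a' \<in> carrier R"
    "s' \<in> carrier R" "b' \<in> carrier R" "t' \<in> carrier R" "u \<in> carrier R" "v \<in> carrier R"
    using assms u v by auto
  have "(u \<otimes> v) \<otimes> ((s \<otimes> t) \<otimes> (a' \<otimes> b')) = (u \<otimes> (s \<otimes> a')) \<otimes> (v \<otimes> (t \<otimes> b'))"
    using car by (simp add: m_ac)
  also have "\<dots> = (u \<otimes> (s' \<otimes> a)) \<otimes> (v \<otimes> (t' \<otimes> b))" using u v by simp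
  also have "\<dots> = (u \<otimes> v) \<otimes> ((s' \<otimes> t') \<otimes> (a \<otimes> b))" using car by (simp add: m_ac)
  finally have "\<exists>w\<in>carrier R - I. w \<otimes> ((s \<otimes> t) \<otimes> (a' \<otimes> b')) = w \<otimes> ((s' \<otimes> t') \<otimes> (a \<otimes> b))"
    using compl_mult[OF u(1) v(1)] by blast
  then show ?thesis
    using assms compl_mult by (subst lfrac_eq_iff) auto
qed

lemma lfrac_add_cong:
  assumes "a \<in> carrier R" "s \<in> carrier R - I" "b \<in> carrier R" "t \<in> carrier R - I"
    and "a' \<in> carrier R" "s' \<in> carrier R - I" "b' \<in> carrier R" "t' \<in> carrier R - I"
    and "lfrac R I a' s' = lfrac R I a s" "lfrac R I b' t' = lfrac R I b t"
  shows "lfrac R I (t' \<otimes> a' \<oplus> s' \<otimes> b') (s' \<otimes> t') = lfrac R I (t \<otimes> a \<oplus> s \<otimes> b) (s \<otimes> t)"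
proof -
  obtain u where u: "u \<in> carrier R - I" "u \<otimes> (s \<otimes> a') = u \<otimes> (s' \<otimes> a)"
    using assms lfrac_eq_iff[of a' s' a s] by auto
  obtain v where v: "v \<in> carrier R - I" "v \<otimes> (t \<otimes> b') = v \<otimes> (t' \<otimes> b)"
    using assms lfrac_eq_iff[of b' t' b t] by auto
  have car: "a \<in> carrier R" "s \<in> carrier R" "b \<in> carrier R" "t \<in> carrier R" "a' \<in> carrier R"
    "s' \<in> carrier R" "b' \<in> carrier R" "t' \<in> carrier R" "u \<in> carrier R" "v \<in> carrier R"
    using assms u v by auto
  have "(u \<otimes> v) \<otimes> ((s \<otimes> t) \<otimes> (t' \<otimes> a' \<oplus> s' \<otimes> b')) =
      (v \<otimes> (t \<otimes> t')) \<otimes> (u \<otimes> (s \<otimes> a')) \<oplus> (u \<otimes> (s \<otimes> s')) \<otimes> (v \<otimes> (t \<otimes> b'))"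
    using car by (simp add: m_ac r_distr l_distr)
  also have "\<dots> = (v \<otimes> (t \<otimes> t')) \<otimes> (u \<otimes> (s' \<otimes> a)) \<oplus> (u \<otimes> (s \<otimes> s')) \<otimes> (v \<otimes> (t' \<otimes> b))"
    using u v by simp
  also have "\<dots> = (u \<otimes> v) \<otimes> ((s' \<otimes> t') \<otimes> (t \<otimes> a \<oplus> s \<otimes> b))"
    using car by (simp add: m_ac r_distr l_distr)
  finally have "\<exists>w\<in>carrier R - I. w \<otimes> ((s \<otimes> t) \<otimes> (t' \<otimes> a' \<oplus> s' \<otimes> b')) = w \<otimes> ((s' \<otimes> t') \<otimes> (t \<otimes> a \<oplus> s \<otimes> b))"
    using compl_mult[OF u(1) v(1)] by blast
  then show ?thesis
    using assms compl_mult by (subst lfrac_eq_iff) auto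
qed

lemma loc_mult:
  assumes "a \<in> carrier R" "s \<in> carrier R - I" "b \<in> carrier R" "t \<in> carrier R - I"
  shows "lfrac R I a s \<otimes>\<^bsub>loc R I\<^esub> lfrac R I b t = lfrac R I (a \<otimes> b) (s \<otimes> t)"
proof -
  have "(\<Union>(a', s')\<in>lfrac R I a s. \<Union>(b', t')\<in>lfrac R I b t. lfrac R I (a' \<otimes> b') (s' \<otimes> t'))
      = lfrac R I (a \<otimes> b) (s \<otimes> t)"
    using assms by (intro UN_lfrac_const lfrac_mult_cong) auto
  then show ?thesis by (simp add: loc_def)
qed

lemma loc_add:
  assumes "a \<in> carrier R" "s \<in> carrier R - I" "b \<in> carrier R" "t \<in> carrier R - I"
  shows "lfrac R I a s \<oplus>\<^bsub>loc R I\<^esub> lfrac R I b t = lfrac R I (t \<otimes> a \<oplus> s \<otimes> b) (s \<otimes> t)"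
proof -
  have "(\<Union>(a', s')\<in>lfrac R I a s. \<Union>(b', t')\<in>lfrac R I b t. lfrac R I (t' \<otimes> a' \<oplus> s' \<otimes> b') (s' \<otimes> t'))
      = lfrac R I (t \<otimes> a \<oplus> s \<otimes> b) (s \<otimes> t)"
    using assms by (intro UN_lfrac_const lfrac_add_cong) auto
  then show ?thesis by (simp add: loc_def)
qed

lemma loc_one: "\<one>\<^bsub>loc R I\<^esub> = lfrac R I \<one> \<one>"
  and loc_zero: "\<zero>\<^bsub>loc R I\<^esub> = lfrac R I \<zero> \<one>"
  by (simp_all add: loc_def)

lemma lfrac_zero: "s \<in> carrier R - I \<Longrightarrow> lfrac R I \<zero> s = \<zero>\<^bsub>loc R I\<^esub>"
  unfolding loc_zero using compl_one by (intro lfrac_eqI) auto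

lemma lfrac_one: "s \<in> carrier R - I \<Longrightarrow> lfrac R I s s = \<one>\<^bsub>loc R I\<^esub>"
  unfolding loc_one using compl_one by (intro lfrac_eqI) auto

lemma loc_l_neg:
  assumes "a \<in> carrier R" "s \<in> carrier R - I"
  shows "lfrac R I (\<ominus> a) s \<oplus>\<^bsub>loc R I\<^esub> lfrac R I a s = \<zero>\<^bsub>loc R I\<^esub>"
proof -
  have "s \<otimes> \<ominus> a \<oplus> s \<otimes> a = \<zero>" using assms by (simp add: r_minus l_neg)
  then show ?thesis using assms compl_mult[of s s] by (simp add: loc_add lfrac_zero)
qed

lemma cring_loc: "cring (loc R I)"
proof (rule cringI)
  note c = compl_mult compl_one and e = loc_carrierE
  show "abelian_group (loc R I)"
  proof (rule abelian_groupI)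
    fix x y assume "x \<in> carrier (loc R I)" "y \<in> carrier (loc R I)"
    then obtain a s b t where xy: "x = lfrac R I a s" "a \<in> carrier R" "s \<in> carrier R - I"
      "y = lfrac R I b t" "b \<in> carrier R" "t \<in> carrier R - I"
      by (elim e)
    then show "x \<oplus>\<^bsub>loc R I\<^esub> y \<in> carrier (loc R I)"
      using c by (auto simp: loc_add intro!: lfrac_closed)
    show "x \<oplus>\<^bsub>loc R I\<^esub> y = y \<oplus>\<^bsub>loc R I\<^esub> x"
      using xy by (simp add: loc_add m_comm a_comm)
    fix z assume "z \<in> carrier (loc R I)"
    then obtain d r where z: "z = lfrac R I d r" "d \<in> carrier R" "r \<in> carrier R - I" by (elim e)
    show "x \<oplus>\<^bsub>loc R I\<^esub> y \<oplus>\<^bsub>loc R I\<^esub> z = x \<oplus>\<^bsub>loc R I\<^esub> (y \<oplus>\<^bsub>loc R I\<^esub> z)"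
      using xy z by (simp add: loc_add compl_mult[simplified] m_ac a_ac r_distr l_distr)
  next
    show "\<zero>\<^bsub>loc R I\<^esub> \<in> carrier (loc R I)" using c by (simp add: loc_zero lfrac_closed)
  next
    fix x assume "x \<in> carrier (loc R I)"
    then obtain a s where x: "x = lfrac R I a s" "a \<in> carrier R" "s \<in> carrier R - I" by (elim e)
    show "\<zero>\<^bsub>loc R I\<^esub> \<oplus>\<^bsub>loc R I\<^esub> x = x"
      using x c by (simp add: loc_add loc_zero)
    show "\<exists>y\<in>carrier (loc R I). y \<oplus>\<^bsub>loc R I\<^esub> x = \<zero>\<^bsub>loc R I\<^esub>"
      using loc_l_neg[OF x(2,3)] x lfrac_closed[of "\<ominus> a" s] by (auto intro!: bexI)
  qed
  show "comm_monoid (loc R I)"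
  proof (rule comm_monoidI)
    fix x y assume "x \<in> carrier (loc R I)" "y \<in> carrier (loc R I)"
    then obtain a s b t where xy: "x = lfrac R I a s" "a \<in> carrier R" "s \<in> carrier R - I"
      "y = lfrac R I b t" "b \<in> carrier R" "t \<in> carrier R - I"
      by (elim e)
    then show "x \<otimes>\<^bsub>loc R I\<^esub> y \<in> carrier (loc R I)"
      using c by (auto simp: loc_mult intro!: lfrac_closed)
    show "x \<otimes>\<^bsub>loc R I\<^esub> y = y \<otimes>\<^bsub>loc R I\<^esub> x"
      using xy by (simp add: loc_mult m_comm)
    fix z assume "z \<in> carrier (loc R I)"
    then obtain d r where z: "z = lfrac R I d r" "d \<in> carrier R" "r \<in> carrier R - I" by (elim e)
    show "x \<otimes>\<^bsub>loc R I\<^esub> y \<otimes>\<^bsub>loc R I\<^esub> z = x \<otimes>\<^bsub>loc R I\<^esub> (y \<otimes>\<^bsub>loc R I\<^esub> z)"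
      using xy z by (simp add: loc_mult compl_mult[simplified] m_assoc)
  next
    show "\<one>\<^bsub>loc R I\<^esub> \<in> carrier (loc R I)" using c by (simp add: loc_one lfrac_closed)
  next
    fix x assume "x \<in> carrier (loc R I)"
    then obtain a s where x: "x = lfrac R I a s" "a \<in> carrier R" "s \<in> carrier R - I" by (elim e)
    show "\<one>\<^bsub>loc R I\<^esub> \<otimes>\<^bsub>loc R I\<^esub> x = x"
      using x c by (simp add: loc_mult loc_one)
  qed
  fix x y z assume "x \<in> carrier (loc R I)" "y \<in> carrier (loc R I)" "z \<in> carrier (loc R I)"
  then obtain a s b t d r where xyz: "x = lfrac R I a s" "a \<in> carrier R" "s \<in> carrier R - I"
      "y = lfrac R I b t" "b \<in> carrier R" "t \<in> carrier R - I"
      "z = lfrac R I d r" "d \<in> carrier R" "r \<in> carrier R - I"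
    by (elim e)
  have "(x \<oplus>\<^bsub>loc R I\<^esub> y) \<otimes>\<^bsub>loc R I\<^esub> z = lfrac R I ((t \<otimes> a \<oplus> s \<otimes> b) \<otimes> d) (s \<otimes> t \<otimes> r)"
    using xyz by (simp add: loc_mult loc_add compl_mult[simplified])
  \<comment> \<open>The products of \<open>x\<close> and of \<open>y\<close> with \<open>z\<close>
    have denominators \<open>s r\<close> and \<open>t r\<close>, so their sum has one factor
    \<open>r\<close> too many above and below; it is inserted here to match.\<close>
  also have "\<dots> = lfrac R I (r \<otimes> ((t \<otimes> a \<oplus> s \<otimes> b) \<otimes> d)) (r \<otimes> (s \<otimes> t \<otimes> r))"
    using xyz by (intro lfrac_cancel[symmetric]) (auto simp: compl_mult[simplified])
  also have "\<dots> = x \<otimes>\<^bsub>loc R I\<^esub> z \<oplus>\<^bsub>loc R I\<^esub> y \<otimes>\<^bsub>loc R I\<^esub> z"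
    using xyz by (simp add: loc_mult loc_add compl_mult[simplified] m_ac a_ac r_distr l_distr)
  finally show "(x \<oplus>\<^bsub>loc R I\<^esub> y) \<otimes>\<^bsub>loc R I\<^esub> z = x \<otimes>\<^bsub>loc R I\<^esub> z \<oplus>\<^bsub>loc R I\<^esub> y \<otimes>\<^bsub>loc R I\<^esub> z" .
qed

text \<open>If \<open>a/s\<close> times \<open>b/t\<close> is 1, then \<open>u a b = u s t\<close>
  for some \<open>u\<close> outside the prime, so \<open>a\<close> cannot lie in it. This is the
  bridge from units of stalks to points: a prime is the set of all \<open>a\<close> for which
  \<open>a/1\<close> is not a unit.\<close>

lemma lfrac_Units_iff:
  assumes "a \<in> carrier R" "s \<in> carrier R - I"
  shows "lfrac R I a s \<in> Units (loc R I) \<longleftrightarrow> a \<notin> I"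
proof
  assume "a \<notin> I"
  then have "lfrac R I a s \<otimes>\<^bsub>loc R I\<^esub> lfrac R I s a = \<one>\<^bsub>loc R I\<^esub>" "lfrac R I s a \<otimes>\<^bsub>loc R I\<^esub> lfrac R I a s = \<one>\<^bsub>loc R I\<^esub>"
    using assms compl_mult[of s a] by (simp_all add: loc_mult lfrac_one m_comm)
  then show "lfrac R I a s \<in> Units (loc R I)"
    using assms \<open>a \<notin> I\<close> lfrac_closed[of a s] lfrac_closed[of s a] by (auto simp: Units_def)
next
  assume "lfrac R I a s \<in> Units (loc R I)"
  then obtain y where "y \<in> carrier (loc R I)" "lfrac R I a s \<otimes>\<^bsub>loc R I\<^esub> y = \<one>\<^bsub>loc R I\<^esub>"
    by (auto simp: Units_def)
  then obtain b t where bt: "b \<in> carrier R" "t \<in> carrier R - I" "lfrac R I (a \<otimes> b) (s \<otimes> t) = lfrac R I \<one> \<one>"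
    using assms by (auto elim!: loc_carrierE simp: loc_mult loc_one)
  then obtain u where u: "u \<in> carrier R - I" "u \<otimes> (\<one> \<otimes> (a \<otimes> b)) = u \<otimes> ((s \<otimes> t) \<otimes> \<one>)"
    using assms compl_mult compl_one lfrac_eq_iff[of "a \<otimes> b" "s \<otimes> t" \<one> \<one>] by auto
  have "u \<otimes> ((s \<otimes> t) \<otimes> \<one>) \<in> carrier R - I"
    using u bt assms compl_mult compl_one by blast
  then have "a \<otimes> (u \<otimes> b) \<notin> I"
    using u bt assms by (auto simp: m_ac)
  then show "a \<notin> I" using assms u bt I_r_closed by auto
qed

end

lemma spec_pt_prime:
  assumes "cring A" "cring B" "\<theta> \<in> ring_hom A B" "primeideal Q B"
  shows "primeideal (spec_pt A B \<theta> Q) A"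
  unfolding spec_pt_def
  by (rule ring_hom_ring.primeideal_vimage[OF ring_hom_ringI2[OF _ _ assms(3)] assms(1,4)])
    (use assms(1,2) cring.axioms(1) in blast)+

lemma spec_pt_compl:
  "\<theta> \<in> ring_hom A B \<Longrightarrow> t \<in> carrier A - spec_pt A B \<theta> Q \<Longrightarrow> \<theta> t \<in> carrier B - Q"
  using ring_hom_closed by (fastforce simp: spec_pt_def)

text \<open>\<open>loc_map\<close> takes a union over representatives. The multiplier
  \<open>u\<close> relating two of them is mapped outside \<open>Q\<close>, so their images are
  equal fractions.\<close>

lemma loc_map_lfrac:
  assumes "cring A" "cring B" and h: "\<theta> \<in> ring_hom A B" and Q: "primeideal Q B"
    and a: "a \<in> carrier A" and s: "s \<in> carrier A - spec_pt A B \<theta> Q"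
  shows "loc_map B \<theta> Q (lfrac A (spec_pt A B \<theta> Q) a s) = lfrac B Q (\<theta> a) (\<theta> s)"
proof -
  interpret A: primeideal "spec_pt A B \<theta> Q" A by (rule spec_pt_prime[OF assms(1-4)])
  interpret B: primeideal Q B by fact
  note c = spec_pt_compl[OF h]
  show ?thesis unfolding loc_map_def
  proof (rule A.UN_lfrac_const[OF a s])
    fix b t assume bt: "b \<in> carrier A" "t \<in> carrier A - spec_pt A B \<theta> Q"
      "lfrac A (spec_pt A B \<theta> Q) b t = lfrac A (spec_pt A B \<theta> Q) a s"
    then obtain u where u: "u \<in> carrier A - spec_pt A B \<theta> Q"
      "u \<otimes>\<^bsub>A\<^esub> (s \<otimes>\<^bsub>A\<^esub> b) = u \<otimes>\<^bsub>A\<^esub> (t \<otimes>\<^bsub>A\<^esub> a)"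
      using a s A.lfrac_eq_iff[of b t a s] by auto
    have "\<theta> (u \<otimes>\<^bsub>A\<^esub> (s \<otimes>\<^bsub>A\<^esub> b)) = \<theta> u \<otimes>\<^bsub>B\<^esub> (\<theta> s \<otimes>\<^bsub>B\<^esub> \<theta> b)"
      "\<theta> (u \<otimes>\<^bsub>A\<^esub> (t \<otimes>\<^bsub>A\<^esub> a)) = \<theta> u \<otimes>\<^bsub>B\<^esub> (\<theta> t \<otimes>\<^bsub>B\<^esub> \<theta> a)"
      using u(1) a s bt(1,2) by (simp_all add: ring_hom_mult[OF h])
    then have "\<theta> u \<otimes>\<^bsub>B\<^esub> (\<theta> s \<otimes>\<^bsub>B\<^esub> \<theta> b) = \<theta> u \<otimes>\<^bsub>B\<^esub> (\<theta> t \<otimes>\<^bsub>B\<^esub> \<theta> a)" using u by simp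
    then show "lfrac B Q (\<theta> b) (\<theta> t) = lfrac B Q (\<theta> a) (\<theta> s)"
      using c[OF u(1)] c[OF s] c[OF bt(2)] ring_hom_closed[OF h] a bt(1)
      by (subst B.lfrac_eq_iff) auto
  qed
qed

lemma loc_map_hom:
  assumes "cring A" "cring B" and h: "\<theta> \<in> ring_hom A B" and Q: "primeideal Q B"
  shows "loc_map B \<theta> Q \<in> ring_hom (loc A (spec_pt A B \<theta> Q)) (loc B Q)"
proof -
  let ?P = "spec_pt A B \<theta> Q"
  interpret A: primeideal ?P A by (rule spec_pt_prime[OF assms])
  interpret B: primeideal Q B by fact
  note m = loc_map_lfrac[OF assms]
  note c = spec_pt_compl[OF h]
  note hs = ring_hom_mult[OF h] ring_hom_add[OF h] ring_hom_closed[OF h] ring_hom_one[OF h]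
  show ?thesis
  proof (rule ring_hom_memI)
    fix x assume "x \<in> carrier (loc A ?P)"
    then obtain a s where x: "x = lfrac A ?P a s" "a \<in> carrier A" "s \<in> carrier A - ?P" by (elim A.loc_carrierE)
    then show "loc_map B \<theta> Q x \<in> carrier (loc B Q)" using c by (simp add: m hs B.lfrac_closed)
    fix y assume "y \<in> carrier (loc A ?P)"
    then obtain b t where y: "y = lfrac A ?P b t" "b \<in> carrier A" "t \<in> carrier A - ?P" by (elim A.loc_carrierE)
    show "loc_map B \<theta> Q (x \<otimes>\<^bsub>loc A ?P\<^esub> y) = loc_map B \<theta> Q x \<otimes>\<^bsub>loc B Q\<^esub> loc_map B \<theta> Q y"
      using x y c[of s] c[of t] A.compl_mult[of s t] by (simp add: A.loc_mult B.loc_mult m hs)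
    show "loc_map B \<theta> Q (x \<oplus>\<^bsub>loc A ?P\<^esub> y) = loc_map B \<theta> Q x \<oplus>\<^bsub>loc B Q\<^esub> loc_map B \<theta> Q y"
      using x y c[of s] c[of t] A.compl_mult[of s t] by (simp add: A.loc_add B.loc_add m hs)
  next
    show "loc_map B \<theta> Q \<one>\<^bsub>loc A ?P\<^esub> = \<one>\<^bsub>loc B Q\<^esub>"
      using A.compl_one by (simp add: A.loc_one B.loc_one m hs)
  qed
qed

section \<open>Spectra\<close>

definition basic_open :: "('a, 'm) ring_scheme \<Rightarrow> 'a \<Rightarrow> 'a set set" where
  "basic_open A a = {P. primeideal P A \<and> a \<notin> P}"

lemma basic_open_inter:
  assumes "a \<in> carrier A" "b \<in> carrier A"
  shows "basic_open A (a \<otimes>\<^bsub>A\<^esub> b) = basic_open A a \<inter> basic_open A b"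
proof -
  have "a \<otimes>\<^bsub>A\<^esub> b \<notin> P \<longleftrightarrow> a \<notin> P \<and> b \<notin> P" if "primeideal P A" for P
  proof -
    interpret primeideal P A by fact
    show ?thesis using assms I_prime I_r_closed I_l_closed by blast
  qed
  then show ?thesis by (auto simp: basic_open_def)
qed

lemma openin_basic_open: "a \<in> carrier A \<Longrightarrow> openin (zariski A) (basic_open A a)"
  unfolding zariski_def basic_open_def by (rule topology_generated_by_Basis) blast

lemma topspace_zariski:
  assumes "cring A" shows "topspace (zariski A) = {P. primeideal P A}"
proof -
  interpret cring A by fact
  have "P \<in> basic_open A \<one>\<^bsub>A\<^esub>" if "primeideal P A" for P
    using primeideal.compl_one[OF that] that by (simp add: basic_open_def)
  then show ?thesis unfolding zariski_def by (auto simp: basic_open_def)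
qed

lemma openin_zariski_prime: "openin (zariski A) U \<Longrightarrow> P \<in> U \<Longrightarrow> primeideal P A"
  using openin_subset[of "zariski A" U] unfolding zariski_def by auto

text \<open>The sets \<open>basic_open A a\<close> generate the topology as a subbasis. Since two of
  them meet in the one of the product, they form a basis; the proof is an induction over the
  generation of open sets.\<close>

lemma openin_zariskiE:
  assumes A: "cring A" and U: "openin (zariski A) U" and P: "P \<in> U"
  obtains a where "a \<in> carrier A" "P \<in> basic_open A a" "basic_open A a \<subseteq> U"
proof -
  interpret cring A by fact
  have "generate_topology_on {{P. primeideal P A \<and> a \<notin> P} | a. a \<in> carrier A} U"
    using U unfolding zariski_def openin_topology_generated_by_iff .
  then have "\<forall>P\<in>U. \<exists>a\<in>carrier A. P \<in> basic_open A a \<and> basic_open A a \<subseteq> U"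
  proof (induction rule: generate_topology_on.induct)
    case (Int V W)
    show ?case
    proof
      fix P assume "P \<in> V \<inter> W"
      then have P: "P \<in> V" "P \<in> W" by blast+
      obtain a where a: "a \<in> carrier A" "P \<in> basic_open A a" "basic_open A a \<subseteq> V"
        using Int.IH(1) P(1) by blast
      obtain b where b: "b \<in> carrier A" "P \<in> basic_open A b" "basic_open A b \<subseteq> W"
        using Int.IH(2) P(2) by blast
      have "P \<in> basic_open A (a \<otimes>\<^bsub>A\<^esub> b) \<and> basic_open A (a \<otimes>\<^bsub>A\<^esub> b) \<subseteq> V \<inter> W"
        unfolding basic_open_inter[OF a(1) b(1)] using a b by blast
      then show "\<exists>a\<in>carrier A. P \<in> basic_open A a \<and> basic_open A a \<subseteq> V \<inter> W"
        using m_closed[OF a(1) b(1)] by blast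
    qed
  next
    case (UN K)
    show ?case
    proof
      fix P assume "P \<in> \<Union>K"
      then obtain k where k: "k \<in> K" "P \<in> k" by blast
      then obtain a where "a \<in> carrier A" "P \<in> basic_open A a" "basic_open A a \<subseteq> k"
        using UN.IH by blast
      then show "\<exists>a\<in>carrier A. P \<in> basic_open A a \<and> basic_open A a \<subseteq> \<Union>K"
        using k by blast
    qed
  next
    case (Basis V)
    then show ?case by (auto simp: basic_open_def)
  qed simp
  then obtain a where "a \<in> carrier A" "P \<in> basic_open A a" "basic_open A a \<subseteq> U"
    using P by (elim ballE[of _ _ P] bexE conjE) simp_all
  then show ?thesis by (rule that)
qed

lemma openin_zariskiI:
  assumes "\<And>P. P \<in> U \<Longrightarrow> \<exists>a\<in>carrier A. P \<in> basic_open A a \<and> basic_open A a \<subseteq> U"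
  shows "openin (zariski A) U"
proof (subst openin_subopen, intro ballI)
  fix P assume "P \<in> U"
  then obtain a where "a \<in> carrier A" "P \<in> basic_open A a" "basic_open A a \<subseteq> U"
    using assms by blast
  then show "\<exists>W. openin (zariski A) W \<and> P \<in> W \<and> W \<subseteq> U"
    using openin_basic_open[of a A] by (intro exI[of _ "basic_open A a"]) simp
qed

lemma Spec_simps [simp]:
  "rtop (Spec A \<eta>) = zariski A" "rsec (Spec A \<eta>) = spec_sec A"
  "rres (Spec A \<eta>) = (\<lambda>U W s. restrict s W)"
  "rcst (Spec A \<eta>) = (\<lambda>U k. \<lambda>P\<in>U. lfrac A P (\<eta> k) \<one>\<^bsub>A\<^esub>)"
  by (simp_all add: Spec_def)

lemma spec_sec_ops:
  "s \<otimes>\<^bsub>spec_sec A U\<^esub> t = (\<lambda>P\<in>U. s P \<otimes>\<^bsub>loc A P\<^esub> t P)"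
  "s \<oplus>\<^bsub>spec_sec A U\<^esub> t = (\<lambda>P\<in>U. s P \<oplus>\<^bsub>loc A P\<^esub> t P)"
  "\<one>\<^bsub>spec_sec A U\<^esub> = (\<lambda>P\<in>U. \<one>\<^bsub>loc A P\<^esub>)"
  "\<zero>\<^bsub>spec_sec A U\<^esub> = (\<lambda>P\<in>U. \<zero>\<^bsub>loc A P\<^esub>)"
  by (simp_all add: spec_sec_def)

text \<open>The local condition of \<open>spec_sec\<close> with numerator and denominator made
  explicit, so that operations on sections can be followed on fractions. \<open>W\<close> is an
  arbitrary set, which makes shrinking it immediate.\<close>

definition frac_on :: "('a, 'm) ring_scheme \<Rightarrow> 'a set set \<Rightarrow> ('a set \<Rightarrow> ('a \<times> 'a) set) \<Rightarrow> 'a \<Rightarrow> 'a \<Rightarrow> bool" where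
  "frac_on A W s a b \<longleftrightarrow> a \<in> carrier A \<and> b \<in> carrier A \<and> (\<forall>Q\<in>W. b \<notin> Q \<and> s Q = lfrac A Q a b)"

lemma frac_on_subset: "frac_on A W s a b \<Longrightarrow> W' \<subseteq> W \<Longrightarrow> frac_on A W' s a b"
  by (auto simp: frac_on_def)

lemma spec_sec_carrierE:
  assumes "s \<in> carrier (spec_sec A U)" "P \<in> U"
  obtains W a b where "openin (zariski A) W" "P \<in> W" "W \<subseteq> U" "frac_on A W s a b"
proof -
  have "\<exists>W a b. openin (zariski A) W \<and> P \<in> W \<and> W \<subseteq> U \<and> a \<in> carrier A \<and> b \<in> carrier A \<and>
       (\<forall>Q\<in>W. b \<notin> Q \<and> s Q = lfrac A Q a b)"
    using assms by (simp add: spec_sec_def)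
  then show ?thesis using that unfolding frac_on_def by blast
qed

text \<open>A local fraction already has its values in the local rings, so a locally fractional
  family is a section once it is extensional.\<close>

lemma spec_sec_carrierI:
  assumes "s \<in> extensional U" "\<And>P. P \<in> U \<Longrightarrow> primeideal P A"
    and "\<And>P. P \<in> U \<Longrightarrow> \<exists>W a b. openin (zariski A) W \<and> P \<in> W \<and> W \<subseteq> U \<and> frac_on A W s a b"
  shows "s \<in> carrier (spec_sec A U)"
proof -
  have "s P \<in> carrier (loc A P)" if P: "P \<in> U" for P
  proof -
    obtain W a b where W: "P \<in> W" "frac_on A W s a b" using assms(3)[OF P] by blast
    then show ?thesis
      using primeideal.lfrac_closed[OF assms(2)[OF P], of a b] by (auto simp: frac_on_def)
  qed
  then show ?thesis using assms by (auto simp: spec_sec_def frac_on_def PiE_def)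
qed

lemma spec_sec_extensional: "s \<in> carrier (spec_sec A U) \<Longrightarrow> s \<in> extensional U"
  by (auto simp: spec_sec_def PiE_def)

lemma spec_sec_eqI:
  assumes "s \<in> extensional U" "t \<in> extensional U" "\<And>P. P \<in> U \<Longrightarrow> s P = t P"
  shows "s = t"
  using assms extensionalityI by blast

lemma spec_sec_value: "s \<in> carrier (spec_sec A U) \<Longrightarrow> P \<in> U \<Longrightarrow> s P \<in> carrier (loc A P)"
  by (auto simp: spec_sec_def)

lemma frac_section:
  assumes "openin (zariski A) U" "a \<in> carrier A" "b \<in> carrier A" "\<And>P. P \<in> U \<Longrightarrow> b \<notin> P"
  shows "(\<lambda>P\<in>U. lfrac A P a b) \<in> carrier (spec_sec A U)"
  using assms openin_zariski_prime[OF assms(1)]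
  by (intro spec_sec_carrierI exI[of _ U] exI[of _ a] exI[of _ b]) (simp_all add: frac_on_def)

lemma spec_sec_two:
  assumes "openin (zariski A) U" and s: "s \<in> carrier (spec_sec A U)" and t: "t \<in> carrier (spec_sec A U)" and P: "P \<in> U"
  obtains W a b c d where "openin (zariski A) W" "P \<in> W" "W \<subseteq> U" "frac_on A W s a b" "frac_on A W t c d"
proof -
  obtain V a b where V: "openin (zariski A) V" "P \<in> V" "V \<subseteq> U" "frac_on A V s a b"
    using s P by (elim spec_sec_carrierE)
  obtain W c d where W: "openin (zariski A) W" "P \<in> W" "W \<subseteq> U" "frac_on A W t c d"
    using t P by (elim spec_sec_carrierE)
  show ?thesis
    using V W by (intro that[of "V \<inter> W" a b c d]) (auto intro: frac_on_subset)
qed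

lemma frac_on_mult:
  assumes "cring A" "openin (zariski A) W" "W \<subseteq> U" "frac_on A W s a b" "frac_on A W t c d"
  shows "frac_on A W (s \<otimes>\<^bsub>spec_sec A U\<^esub> t) (a \<otimes>\<^bsub>A\<^esub> c) (b \<otimes>\<^bsub>A\<^esub> d)"
proof -
  interpret cring A by fact
  have "b \<otimes>\<^bsub>A\<^esub> d \<notin> Q \<and> (s \<otimes>\<^bsub>spec_sec A U\<^esub> t) Q = lfrac A Q (a \<otimes>\<^bsub>A\<^esub> c) (b \<otimes>\<^bsub>A\<^esub> d)" if Q: "Q \<in> W" for Q
  proof -
    interpret Q: primeideal Q A using openin_zariski_prime[OF assms(2) Q] .
    show ?thesis
      using assms(3-5) Q Q.compl_mult[of b d] Q.loc_mult[of a b c d] by (auto simp: frac_on_def spec_sec_ops)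
  qed
  then show ?thesis using assms(4,5) by (simp add: frac_on_def)
qed

lemma frac_on_add:
  assumes "cring A" "openin (zariski A) W" "W \<subseteq> U" "frac_on A W s a b" "frac_on A W t c d"
  shows "frac_on A W (s \<oplus>\<^bsub>spec_sec A U\<^esub> t) (d \<otimes>\<^bsub>A\<^esub> a \<oplus>\<^bsub>A\<^esub> b \<otimes>\<^bsub>A\<^esub> c) (b \<otimes>\<^bsub>A\<^esub> d)"
proof -
  interpret cring A by fact
  have "b \<otimes>\<^bsub>A\<^esub> d \<notin> Q \<and> (s \<oplus>\<^bsub>spec_sec A U\<^esub> t) Q = lfrac A Q (d \<otimes>\<^bsub>A\<^esub> a \<oplus>\<^bsub>A\<^esub> b \<otimes>\<^bsub>A\<^esub> c) (b \<otimes>\<^bsub>A\<^esub> d)"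
    if Q: "Q \<in> W" for Q
  proof -
    interpret Q: primeideal Q A using openin_zariski_prime[OF assms(2) Q] .
    show ?thesis
      using assms(3-5) Q Q.compl_mult[of b d] Q.loc_add[of a b c d] by (auto simp: frac_on_def spec_sec_ops)
  qed
  then show ?thesis using assms(4,5) by (simp add: frac_on_def)
qed

lemma spec_sec_closed:
  assumes A: "cring A" and U: "openin (zariski A) U"
    and s: "s \<in> carrier (spec_sec A U)" and t: "t \<in> carrier (spec_sec A U)"
  shows "s \<otimes>\<^bsub>spec_sec A U\<^esub> t \<in> carrier (spec_sec A U)" "s \<oplus>\<^bsub>spec_sec A U\<^esub> t \<in> carrier (spec_sec A U)"
proof -
  show "s \<otimes>\<^bsub>spec_sec A U\<^esub> t \<in> carrier (spec_sec A U)"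
  proof (rule spec_sec_carrierI)
    fix P assume "P \<in> U"
    with U s t obtain W a b c d where W: "openin (zariski A) W" "P \<in> W" "W \<subseteq> U" "frac_on A W s a b" "frac_on A W t c d"
      by (rule spec_sec_two)
    then show "\<exists>W a b. openin (zariski A) W \<and> P \<in> W \<and> W \<subseteq> U \<and> frac_on A W (s \<otimes>\<^bsub>spec_sec A U\<^esub> t) a b"
      using frac_on_mult[OF A W(1,3-5)] by blast
  qed (use openin_zariski_prime[OF U] in \<open>simp_all add: spec_sec_ops\<close>)
  show "s \<oplus>\<^bsub>spec_sec A U\<^esub> t \<in> carrier (spec_sec A U)"
  proof (rule spec_sec_carrierI)
    fix P assume "P \<in> U"
    with U s t obtain W a b c d where W: "openin (zariski A) W" "P \<in> W" "W \<subseteq> U" "frac_on A W s a b" "frac_on A W t c d"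
      by (rule spec_sec_two)
    then show "\<exists>W a b. openin (zariski A) W \<and> P \<in> W \<and> W \<subseteq> U \<and> frac_on A W (s \<oplus>\<^bsub>spec_sec A U\<^esub> t) a b"
      using frac_on_add[OF A W(1,3-5)] by blast
  qed (use openin_zariski_prime[OF U] in \<open>simp_all add: spec_sec_ops\<close>)
qed

lemma spec_sec_const:
  assumes A: "cring A" and U: "openin (zariski A) U"
  shows "\<one>\<^bsub>spec_sec A U\<^esub> = (\<lambda>P\<in>U. lfrac A P \<one>\<^bsub>A\<^esub> \<one>\<^bsub>A\<^esub>)" "\<zero>\<^bsub>spec_sec A U\<^esub> = (\<lambda>P\<in>U. lfrac A P \<zero>\<^bsub>A\<^esub> \<one>\<^bsub>A\<^esub>)"
  by (simp_all add: spec_sec_def loc_def)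

lemma one_notin_prime: "primeideal P A \<Longrightarrow> \<one>\<^bsub>A\<^esub> \<notin> P"
  using primeideal.compl_one by blast

lemma const_section:
  assumes A: "cring A" and U: "openin (zariski A) U" and a: "a \<in> carrier A"
  shows "(\<lambda>P\<in>U. lfrac A P a \<one>\<^bsub>A\<^esub>) \<in> carrier (spec_sec A U)"
proof -
  interpret cring A by fact
  show ?thesis
    using openin_zariski_prime[OF U] one_notin_prime a by (intro frac_section U) auto
qed

text \<open>The ring laws are inherited pointwise from the local rings. Closure is the genuine
  condition: sums, products and negatives of local fractions are again local fractions.\<close>

lemma cring_spec_sec:
  assumes A: "cring A" and U: "openin (zariski A) U"
  shows "cring (spec_sec A U)"
proof -
  interpret A: cring A by fact
  note closed = spec_sec_closed[OF A U]
  have L: "cring (loc A P)" if "P \<in> U" for P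
    using primeideal.cring_loc[OF openin_zariski_prime[OF U that]] .
  note v = spec_sec_value[of _ A U]
  have zero: "\<zero>\<^bsub>spec_sec A U\<^esub> \<in> carrier (spec_sec A U)" and one: "\<one>\<^bsub>spec_sec A U\<^esub> \<in> carrier (spec_sec A U)"
    unfolding spec_sec_const[OF A U] by (rule const_section[OF A U]; simp)+
  show ?thesis
  proof (rule cringI)
    show "abelian_group (spec_sec A U)"
    proof (rule abelian_groupI)
      fix x y assume xy: "x \<in> carrier (spec_sec A U)" "y \<in> carrier (spec_sec A U)"
      show "x \<oplus>\<^bsub>spec_sec A U\<^esub> y \<in> carrier (spec_sec A U)" by (rule closed(2)[OF xy])
      show "x \<oplus>\<^bsub>spec_sec A U\<^esub> y = y \<oplus>\<^bsub>spec_sec A U\<^esub> x"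
        unfolding spec_sec_ops
      proof (rule restrict_ext)
        fix P assume P: "P \<in> U"
        interpret cring "loc A P" by (rule L[OF P])
        show "x P \<oplus>\<^bsub>loc A P\<^esub> y P = y P \<oplus>\<^bsub>loc A P\<^esub> x P" by (intro a_comm v xy P)
      qed
      fix z assume z: "z \<in> carrier (spec_sec A U)"
      show "x \<oplus>\<^bsub>spec_sec A U\<^esub> y \<oplus>\<^bsub>spec_sec A U\<^esub> z = x \<oplus>\<^bsub>spec_sec A U\<^esub> (y \<oplus>\<^bsub>spec_sec A U\<^esub> z)"
        unfolding spec_sec_ops
      proof (rule restrict_ext)
        fix P assume P: "P \<in> U"
        interpret cring "loc A P" by (rule L[OF P])
        have "x P \<oplus>\<^bsub>loc A P\<^esub> y P \<oplus>\<^bsub>loc A P\<^esub> z P = x P \<oplus>\<^bsub>loc A P\<^esub> (y P \<oplus>\<^bsub>loc A P\<^esub> z P)"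
          by (intro a_assoc v xy z P)
        then show "(\<lambda>P\<in>U. x P \<oplus>\<^bsub>loc A P\<^esub> y P) P \<oplus>\<^bsub>loc A P\<^esub> z P = x P \<oplus>\<^bsub>loc A P\<^esub> (\<lambda>P\<in>U. y P \<oplus>\<^bsub>loc A P\<^esub> z P) P"
          using P by simp
      qed
    next
      show "\<zero>\<^bsub>spec_sec A U\<^esub> \<in> carrier (spec_sec A U)" by (rule zero)
    next
      fix x assume x: "x \<in> carrier (spec_sec A U)"
      show "\<zero>\<^bsub>spec_sec A U\<^esub> \<oplus>\<^bsub>spec_sec A U\<^esub> x = x"
      proof (rule spec_sec_eqI)
        fix P assume P: "P \<in> U"
        interpret cring "loc A P" by (rule L[OF P])
        show "(\<zero>\<^bsub>spec_sec A U\<^esub> \<oplus>\<^bsub>spec_sec A U\<^esub> x) P = x P"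
          using P v[OF x P] by (simp add: spec_sec_ops)
      qed (simp_all add: spec_sec_ops spec_sec_extensional[OF x])
      let ?y = "\<lambda>P\<in>U. \<ominus>\<^bsub>loc A P\<^esub> x P"
      have "?y \<in> carrier (spec_sec A U)"
      proof (rule spec_sec_carrierI)
        fix P assume "P \<in> U"
        with x obtain W a b where W: "openin (zariski A) W" "P \<in> W" "W \<subseteq> U" "frac_on A W x a b"
          by (rule spec_sec_carrierE)
        have "frac_on A W ?y (\<ominus>\<^bsub>A\<^esub> a) b"
          unfolding frac_on_def
        proof (intro conjI ballI)
          fix Q assume Q: "Q \<in> W"
          then have QU: "Q \<in> U" using W(3) by blast
          interpret Q: primeideal Q A using openin_zariski_prime[OF W(1) Q] .
          interpret L: cring "loc A Q" by (rule Q.cring_loc)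
          have ab: "a \<in> carrier A" "b \<in> carrier A - Q" "x Q = lfrac A Q a b"
            using W(4) Q by (simp_all add: frac_on_def)
          then show "b \<notin> Q" by simp
          have "\<ominus>\<^bsub>loc A Q\<^esub> lfrac A Q a b = lfrac A Q (\<ominus>\<^bsub>A\<^esub> a) b"
            by (rule L.minus_equality[OF Q.loc_l_neg[OF ab(1,2)]]) (simp_all add: ab(1) Q.lfrac_closed[OF _ ab(2)])
          then show "?y Q = lfrac A Q (\<ominus>\<^bsub>A\<^esub> a) b" using QU ab(3) by simp
        qed (use W(4) in \<open>simp_all add: frac_on_def\<close>)
        then show "\<exists>W a b. openin (zariski A) W \<and> P \<in> W \<and> W \<subseteq> U \<and> frac_on A W ?y a b"
          using W(1-3) by blast
      qed (use openin_zariski_prime[OF U] in simp_all)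
      moreover have "?y \<oplus>\<^bsub>spec_sec A U\<^esub> x = \<zero>\<^bsub>spec_sec A U\<^esub>"
        unfolding spec_sec_ops
      proof (rule restrict_ext)
        fix P assume P: "P \<in> U"
        interpret cring "loc A P" by (rule L[OF P])
        show "?y P \<oplus>\<^bsub>loc A P\<^esub> x P = \<zero>\<^bsub>loc A P\<^esub>" using P l_neg[OF v[OF x P]] by simp
      qed
      ultimately show "\<exists>y\<in>carrier (spec_sec A U). y \<oplus>\<^bsub>spec_sec A U\<^esub> x = \<zero>\<^bsub>spec_sec A U\<^esub>"
        by blast
    qed
    show "comm_monoid (spec_sec A U)"
    proof (rule comm_monoidI)
      fix x y assume xy: "x \<in> carrier (spec_sec A U)" "y \<in> carrier (spec_sec A U)"
      show "x \<otimes>\<^bsub>spec_sec A U\<^esub> y \<in> carrier (spec_sec A U)" by (rule closed(1)[OF xy])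
      show "x \<otimes>\<^bsub>spec_sec A U\<^esub> y = y \<otimes>\<^bsub>spec_sec A U\<^esub> x"
        unfolding spec_sec_ops
      proof (rule restrict_ext)
        fix P assume P: "P \<in> U"
        interpret cring "loc A P" by (rule L[OF P])
        show "x P \<otimes>\<^bsub>loc A P\<^esub> y P = y P \<otimes>\<^bsub>loc A P\<^esub> x P" by (intro m_comm v xy P)
      qed
      fix z assume z: "z \<in> carrier (spec_sec A U)"
      show "x \<otimes>\<^bsub>spec_sec A U\<^esub> y \<otimes>\<^bsub>spec_sec A U\<^esub> z = x \<otimes>\<^bsub>spec_sec A U\<^esub> (y \<otimes>\<^bsub>spec_sec A U\<^esub> z)"
        unfolding spec_sec_ops
      proof (rule restrict_ext)
        fix P assume P: "P \<in> U"
        interpret cring "loc A P" by (rule L[OF P])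
        have "x P \<otimes>\<^bsub>loc A P\<^esub> y P \<otimes>\<^bsub>loc A P\<^esub> z P = x P \<otimes>\<^bsub>loc A P\<^esub> (y P \<otimes>\<^bsub>loc A P\<^esub> z P)"
          by (intro m_assoc v xy z P)
        then show "(\<lambda>P\<in>U. x P \<otimes>\<^bsub>loc A P\<^esub> y P) P \<otimes>\<^bsub>loc A P\<^esub> z P = x P \<otimes>\<^bsub>loc A P\<^esub> (\<lambda>P\<in>U. y P \<otimes>\<^bsub>loc A P\<^esub> z P) P"
          using P by simp
      qed
    next
      show "\<one>\<^bsub>spec_sec A U\<^esub> \<in> carrier (spec_sec A U)" by (rule one)
    next
      fix x assume x: "x \<in> carrier (spec_sec A U)"
      show "\<one>\<^bsub>spec_sec A U\<^esub> \<otimes>\<^bsub>spec_sec A U\<^esub> x = x"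
      proof (rule spec_sec_eqI)
        fix P assume P: "P \<in> U"
        interpret cring "loc A P" by (rule L[OF P])
        show "(\<one>\<^bsub>spec_sec A U\<^esub> \<otimes>\<^bsub>spec_sec A U\<^esub> x) P = x P"
          using P v[OF x P] by (simp add: spec_sec_ops)
      qed (simp_all add: spec_sec_ops spec_sec_extensional[OF x])
    qed
    fix x y z assume xyz: "x \<in> carrier (spec_sec A U)" "y \<in> carrier (spec_sec A U)" "z \<in> carrier (spec_sec A U)"
    show "(x \<oplus>\<^bsub>spec_sec A U\<^esub> y) \<otimes>\<^bsub>spec_sec A U\<^esub> z = x \<otimes>\<^bsub>spec_sec A U\<^esub> z \<oplus>\<^bsub>spec_sec A U\<^esub> y \<otimes>\<^bsub>spec_sec A U\<^esub> z"
      unfolding spec_sec_ops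
    proof (rule restrict_ext)
      fix P assume P: "P \<in> U"
      interpret cring "loc A P" by (rule L[OF P])
      have "(x P \<oplus>\<^bsub>loc A P\<^esub> y P) \<otimes>\<^bsub>loc A P\<^esub> z P = x P \<otimes>\<^bsub>loc A P\<^esub> z P \<oplus>\<^bsub>loc A P\<^esub> y P \<otimes>\<^bsub>loc A P\<^esub> z P"
        by (intro l_distr v xyz P)
      then show "(\<lambda>P\<in>U. x P \<oplus>\<^bsub>loc A P\<^esub> y P) P \<otimes>\<^bsub>loc A P\<^esub> z P =
          (\<lambda>P\<in>U. x P \<otimes>\<^bsub>loc A P\<^esub> z P) P \<oplus>\<^bsub>loc A P\<^esub> (\<lambda>P\<in>U. y P \<otimes>\<^bsub>loc A P\<^esub> z P) P"
        using P by simp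
    qed
  qed
qed

lemma restrict_section:
  assumes "openin (zariski A) W" "W \<subseteq> U" and s: "s \<in> carrier (spec_sec A U)"
  shows "restrict s W \<in> carrier (spec_sec A W)"
proof (rule spec_sec_carrierI)
  fix P assume P: "P \<in> W"
  then have "P \<in> U" using assms(2) by blast
  with s obtain V a b where V: "openin (zariski A) V" "P \<in> V" "V \<subseteq> U" "frac_on A V s a b"
    by (rule spec_sec_carrierE)
  have "frac_on A (V \<inter> W) (restrict s W) a b" using V(4) by (simp add: frac_on_def)
  then show "\<exists>V a b. openin (zariski A) V \<and> P \<in> V \<and> V \<subseteq> W \<and> frac_on A V (restrict s W) a b"
    using V assms(1) P by (intro exI[of _ "V \<inter> W"] exI[of _ a] exI[of _ b]) auto
qed (use openin_zariski_prime[OF assms(1)] in simp_all)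

lemma presheaf_Spec:
  assumes A: "cring A" and \<eta>: "\<And>k. \<eta> k \<in> carrier A"
  shows "presheaf (Spec A \<eta>)"
proof (rule presheaf.intro)
  fix U W assume U: "openin (rtop (Spec A \<eta>)) U"
  show "ring (rsec (Spec A \<eta>) U)" using cring.axioms(1)[OF cring_spec_sec[OF A]] U by simp
  show "rcst (Spec A \<eta>) U k \<in> carrier (rsec (Spec A \<eta>) U)" for k
    using const_section[OF A _ \<eta>] U by simp
  assume W: "openin (rtop (Spec A \<eta>)) W" "W \<subseteq> U"
  show "rres (Spec A \<eta>) U W (rcst (Spec A \<eta>) U k) = rcst (Spec A \<eta>) W k" for k
    using W(2) by (auto simp: restrict_def fun_eq_iff)
  show "rres (Spec A \<eta>) U W \<in> ring_hom (rsec (Spec A \<eta>) U) (rsec (Spec A \<eta>) W)"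
    using W restrict_section[of A W U] subsetD[OF W(2)]
    by (intro ring_hom_memI) (auto simp: spec_sec_ops restrict_def fun_eq_iff)
qed (auto simp: restrict_def fun_eq_iff)

text \<open>Evaluation at a point serves as the map to the stalk: units are pushed forward and
  ideals pulled back along it.\<close>

lemma eval_hom: "P \<in> U \<Longrightarrow> (\<lambda>s. s P) \<in> ring_hom (spec_sec A U) (loc A P)"
  by (rule ring_hom_memI) (simp_all add: spec_sec_ops spec_sec_value)

text \<open>A unit at the single point \<open>P\<close> spreads to a neighbourhood: if the section
  is \<open>a/b\<close> near \<open>P\<close>, then \<open>a\<close> is outside \<open>P\<close>,
  and \<open>b/a\<close> is an inverse on the part of that neighbourhood inside
  \<open>basic_open A a\<close>.\<close>

lemma germ_unit_Spec_iff:
  assumes A: "cring A" and U: "openin (zariski A) U" and s: "s \<in> carrier (spec_sec A U)" and P: "P \<in> U"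
  shows "germ_unit (Spec A \<eta>) U s P \<longleftrightarrow> s P \<in> Units (loc A P)"
proof
  assume "germ_unit (Spec A \<eta>) U s P"
  then obtain W where W: "openin (zariski A) W" "P \<in> W" "W \<subseteq> U" "restrict s W \<in> Units (spec_sec A W)"
    by (auto simp: germ_unit_def)
  show "s P \<in> Units (loc A P)"
    using ring_hom_Units[OF eval_hom[OF W(2)] W(4)] W(2) by simp
next
  assume unit: "s P \<in> Units (loc A P)"
  interpret A: cring A by fact
  obtain V a b where V: "openin (zariski A) V" "P \<in> V" "V \<subseteq> U" "frac_on A V s a b"
    using s P by (rule spec_sec_carrierE)
  have ab: "a \<in> carrier A" "b \<in> carrier A" using V(4) by (simp_all add: frac_on_def)
  define W where "W = V \<inter> basic_open A a"
  have W: "openin (zariski A) W" "W \<subseteq> U" "W \<subseteq> V"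
    using V openin_basic_open[OF ab(1)] by (auto simp: W_def)
  have "primeideal P A" by (rule openin_zariski_prime[OF U P])
  moreover from this have "a \<notin> P"
    using primeideal.lfrac_Units_iff[of P A a b] unit V(2,4) by (simp add: frac_on_def)
  ultimately have PW: "P \<in> W" using V(2) by (simp add: W_def basic_open_def)
  let ?t = "\<lambda>Q\<in>W. lfrac A Q b a"
  have t: "?t \<in> carrier (spec_sec A W)"
    using W(1) ab by (intro frac_section) (auto simp: W_def basic_open_def)
  have "lfrac A Q a b \<otimes>\<^bsub>loc A Q\<^esub> lfrac A Q b a = \<one>\<^bsub>loc A Q\<^esub> \<and> lfrac A Q b a \<otimes>\<^bsub>loc A Q\<^esub> lfrac A Q a b = \<one>\<^bsub>loc A Q\<^esub> \<and> s Q = lfrac A Q a b"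
    if Q: "Q \<in> W" for Q
  proof -
    interpret Q: primeideal Q A by (rule openin_zariski_prime[OF W(1) Q])
    have q: "a \<in> carrier A - Q" "b \<in> carrier A - Q" "s Q = lfrac A Q a b"
      using Q ab V(4) by (simp_all add: W_def basic_open_def frac_on_def)
    then show ?thesis
      using Q.compl_mult[OF q(1,2)] Q.lfrac_one[of "a \<otimes>\<^bsub>A\<^esub> b"] ab by (simp add: Q.loc_mult A.m_comm)
  qed
  note inv = this
  have "restrict s W \<otimes>\<^bsub>spec_sec A W\<^esub> ?t = \<one>\<^bsub>spec_sec A W\<^esub>" "?t \<otimes>\<^bsub>spec_sec A W\<^esub> restrict s W = \<one>\<^bsub>spec_sec A W\<^esub>"
    unfolding spec_sec_ops by (rule restrict_ext; simp add: inv)+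
  then have "restrict s W \<in> Units (spec_sec A W)"
    using t restrict_section[OF W(1,2) s] unfolding Units_def by blast
  then show "germ_unit (Spec A \<eta>) U s P"
    using W PW unfolding germ_unit_def by auto
qed

section \<open>Morphisms of spectra\<close>

lemma rpre_spec_map:
  "cring B \<Longrightarrow> rpre (Spec B \<eta>) (spec_map A B \<theta>) V = {Q. primeideal Q B \<and> spec_pt A B \<theta> Q \<in> V}"
  by (auto simp: rpre_def spec_map_def topspace_zariski)

lemma fst_spec_map: "primeideal Q B \<Longrightarrow> fst (spec_map A B \<theta>) Q = spec_pt A B \<theta> Q"
  by (simp add: spec_map_def)

lemma snd_spec_map:
  "openin (zariski A) V \<Longrightarrow> s \<in> carrier (spec_sec A V) \<Longrightarrow> snd (spec_map A B \<theta>) V s =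
    (\<lambda>Q\<in>{Q. primeideal Q B \<and> spec_pt A B \<theta> Q \<in> V}. loc_map B \<theta> Q (s (spec_pt A B \<theta> Q)))"
  by (simp add: spec_map_def)

text \<open>The preimage of \<open>basic_open A a\<close> is
  \<open>basic_open B (\<theta> a)\<close>.\<close>

lemma spec_pt_preimage_open:
  assumes A: "cring A" and B: "cring B" and h: "\<theta> \<in> ring_hom A B" and V: "openin (zariski A) V"
  shows "openin (zariski B) {Q. primeideal Q B \<and> spec_pt A B \<theta> Q \<in> V}"
proof (rule openin_zariskiI)
  fix Q assume "Q \<in> {Q. primeideal Q B \<and> spec_pt A B \<theta> Q \<in> V}"
  then have Q: "primeideal Q B" "spec_pt A B \<theta> Q \<in> V" by auto
  obtain a where a: "a \<in> carrier A" "spec_pt A B \<theta> Q \<in> basic_open A a" "basic_open A a \<subseteq> V"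
    using A V Q(2) by (rule openin_zariskiE)
  have "spec_pt A B \<theta> R \<in> V" if "R \<in> basic_open B (\<theta> a)" for R
  proof -
    have "spec_pt A B \<theta> R \<in> basic_open A a"
      using that spec_pt_prime[OF A B h] by (simp add: basic_open_def spec_pt_def)
    then show ?thesis using a(3) by blast
  qed
  moreover have "Q \<in> basic_open B (\<theta> a)"
    using a(1,2) Q(1) by (simp add: basic_open_def spec_pt_def)
  ultimately show "\<exists>b\<in>carrier B. Q \<in> basic_open B b \<and> basic_open B b \<subseteq> {Q. primeideal Q B \<and> spec_pt A B \<theta> Q \<in> V}"
    using ring_hom_closed[OF h a(1)] by (intro bexI[of _ "\<theta> a"]) (auto simp: basic_open_def)
qed

lemma spec_map_section:
  assumes A: "cring A" and B: "cring B" and h: "\<theta> \<in> ring_hom A B" and V: "openin (zariski A) V"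
    and s: "s \<in> carrier (spec_sec A V)"
  shows "snd (spec_map A B \<theta>) V s \<in> carrier (spec_sec B {Q. primeideal Q B \<and> spec_pt A B \<theta> Q \<in> V})"
  unfolding snd_spec_map[OF V s]
proof (rule spec_sec_carrierI)
  let ?pre = "\<lambda>V. {Q. primeideal Q B \<and> spec_pt A B \<theta> Q \<in> V}"
  let ?t = "\<lambda>Q\<in>?pre V. loc_map B \<theta> Q (s (spec_pt A B \<theta> Q))"
  fix Q assume Q: "Q \<in> ?pre V"
  then have "spec_pt A B \<theta> Q \<in> V" by simp
  with s obtain W a b where W: "openin (zariski A) W" "spec_pt A B \<theta> Q \<in> W" "W \<subseteq> V" "frac_on A W s a b"
    by (rule spec_sec_carrierE)
  have ab: "a \<in> carrier A" "b \<in> carrier A" using W(4) by (simp_all add: frac_on_def)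
  have "frac_on B (?pre W) ?t (\<theta> a) (\<theta> b)"
    unfolding frac_on_def
  proof (intro conjI ballI)
    fix R assume R: "R \<in> ?pre W"
    then have b: "b \<in> carrier A - spec_pt A B \<theta> R" "s (spec_pt A B \<theta> R) = lfrac A (spec_pt A B \<theta> R) a b"
      using W(4) ab(2) by (simp_all add: frac_on_def)
    show "\<theta> b \<notin> R" using spec_pt_compl[OF h b(1)] by simp
    have "loc_map B \<theta> R (lfrac A (spec_pt A B \<theta> R) a b) = lfrac B R (\<theta> a) (\<theta> b)"
      using R by (intro loc_map_lfrac[OF A B h _ ab(1) b(1)]) simp
    then show "?t R = lfrac B R (\<theta> a) (\<theta> b)" using R W(3) b(2) by auto
  qed (simp_all add: ring_hom_closed[OF h] ab)
  moreover have "Q \<in> ?pre W" "?pre W \<subseteq> ?pre V" using Q W(2,3) by auto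
  ultimately show "\<exists>W a b. openin (zariski B) W \<and> Q \<in> W \<and> W \<subseteq> ?pre V \<and> frac_on B W ?t a b"
    using spec_pt_preimage_open[OF A B h W(1)] by blast
qed simp_all

lemma spec_map_rmor:
  assumes A: "cring A" and B: "cring B" and h: "\<theta> \<in> ring_hom A B"
    and \<eta>: "\<And>k. \<eta> k \<in> carrier A" and \<eta>': "\<And>k. \<eta>' k = \<theta> (\<eta> k)"
  shows "spec_map A B \<theta> \<in> rmor (Spec B \<eta>') (Spec A \<eta>)"
  unfolding rmor_def mem_Collect_eq
proof (intro conjI allI impI; (elim conjE)?)
  let ?F = "spec_map A B \<theta>" and ?S = "Spec B \<eta>'" and ?T = "Spec A \<eta>"
  let ?pre = "\<lambda>V. {Q. primeideal Q B \<and> spec_pt A B \<theta> Q \<in> V}"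
  note pre = rpre_spec_map[OF B, of \<eta>' A \<theta>]
  show "fst ?F \<in> extensional (topspace (rtop ?S))"
    by (simp add: spec_map_def topspace_zariski[OF B])
  show "continuous_map (rtop ?S) (rtop ?T) (fst ?F)"
    unfolding continuous_map_def
  proof (intro conjI allI impI)
    show "fst ?F \<in> topspace (rtop ?S) \<rightarrow> topspace (rtop ?T)"
      using spec_pt_prime[OF A B h] by (auto simp: topspace_zariski A B fst_spec_map)
    fix V assume V: "openin (rtop ?T) V"
    have "{Q \<in> topspace (rtop ?S). fst ?F Q \<in> V} = ?pre V"
      by (auto simp: topspace_zariski B fst_spec_map)
    then show "openin (rtop ?S) {Q \<in> topspace (rtop ?S). fst ?F Q \<in> V}"
      using spec_pt_preimage_open[OF A B h, of V] V by simp
  qed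
  show "snd ?F \<in> extensional {V. openin (rtop ?T) V}"
    by (simp add: spec_map_def)
  fix V assume V: "openin (rtop ?T) V"
  then have oV: "openin (zariski A) V" by simp
  show "snd ?F V \<in> extensional (carrier (rsec ?T V))"
    using V by (simp add: spec_map_def)
  show "snd ?F V \<in> ring_hom (rsec ?T V) (rsec ?S (rpre ?S ?F V))"
    unfolding pre Spec_simps
  proof (rule ring_hom_memI)
    fix s assume s: "s \<in> carrier (spec_sec A V)"
    show "snd ?F V s \<in> carrier (spec_sec B (?pre V))" by (rule spec_map_section[OF A B h oV s])
    fix t assume t: "t \<in> carrier (spec_sec A V)"
    show "snd ?F V (s \<otimes>\<^bsub>spec_sec A V\<^esub> t) = snd ?F V s \<otimes>\<^bsub>spec_sec B (?pre V)\<^esub> snd ?F V t"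
      unfolding snd_spec_map[OF oV spec_sec_closed(1)[OF A oV s t]]
      unfolding snd_spec_map[OF oV s] snd_spec_map[OF oV t] spec_sec_ops
      by (rule restrict_ext) (simp add: ring_hom_mult[OF loc_map_hom[OF A B h]] spec_sec_value[OF s] spec_sec_value[OF t])
    show "snd ?F V (s \<oplus>\<^bsub>spec_sec A V\<^esub> t) = snd ?F V s \<oplus>\<^bsub>spec_sec B (?pre V)\<^esub> snd ?F V t"
      unfolding snd_spec_map[OF oV spec_sec_closed(2)[OF A oV s t]]
      unfolding snd_spec_map[OF oV s] snd_spec_map[OF oV t] spec_sec_ops
      by (rule restrict_ext) (simp add: ring_hom_add[OF loc_map_hom[OF A B h]] spec_sec_value[OF s] spec_sec_value[OF t])
  next
    have one: "\<one>\<^bsub>spec_sec A V\<^esub> \<in> carrier (spec_sec A V)"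
      using cring.axioms(1)[OF cring_spec_sec[OF A oV]] by (rule ring.ring_simprules(6))
    show "snd ?F V \<one>\<^bsub>spec_sec A V\<^esub> = \<one>\<^bsub>spec_sec B (?pre V)\<^esub>"
      unfolding snd_spec_map[OF oV one] unfolding spec_sec_ops
      by (rule restrict_ext) (simp add: ring_hom_one[OF loc_map_hom[OF A B h]])
  qed
  show "snd ?F V (rcst ?T V k) = rcst ?S (rpre ?S ?F V) k" for k
    unfolding pre Spec_simps snd_spec_map[OF oV const_section[OF A oV \<eta>]]
  proof (rule restrict_ext)
    fix Q assume Q: "Q \<in> ?pre V"
    interpret P: primeideal "spec_pt A B \<theta> Q" A using spec_pt_prime[OF A B h] Q by simp
    show "loc_map B \<theta> Q ((\<lambda>P\<in>V. lfrac A P (\<eta> k) \<one>\<^bsub>A\<^esub>) (spec_pt A B \<theta> Q)) = lfrac B Q (\<eta>' k) \<one>\<^bsub>B\<^esub>"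
      using Q loc_map_lfrac[OF A B h _ \<eta> P.compl_one] by (simp add: ring_hom_one[OF h] \<eta>')
  qed
  fix W s assume W: "openin (rtop ?T) W" "W \<subseteq> V" and s: "s \<in> carrier (rsec ?T V)"
  have sW: "restrict s W \<in> carrier (spec_sec A W)" using restrict_section W s by simp
  show "snd ?F W (rres ?T V W s) = rres ?S (rpre ?S ?F V) (rpre ?S ?F W) (snd ?F V s)"
    using W sW s oV subsetD[OF W(2)]
    by (simp add: pre snd_spec_map restrict_def fun_eq_iff)
next
  let ?F = "spec_map A B \<theta>" and ?S = "Spec B \<eta>'" and ?T = "Spec A \<eta>"
  note pre = rpre_spec_map[OF B, of \<eta>' A \<theta>]
  fix Q V s assume Q: "Q \<in> topspace (rtop ?S)" and V: "openin (rtop ?T) V" and QV: "fst ?F Q \<in> V"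
    and s: "s \<in> carrier (rsec ?T V)" and u: "germ_unit ?S (rpre ?S ?F V) (snd ?F V s) Q"
  have Qp: "primeideal Q B" using Q by (simp add: topspace_zariski[OF B])
  then have PV: "spec_pt A B \<theta> Q \<in> V" using QV by (simp add: fst_spec_map)
  have oV: "openin (zariski A) V" and s': "s \<in> carrier (spec_sec A V)" using V s by simp_all
  have "snd ?F V s Q \<in> Units (loc B Q)"
    using u germ_unit_Spec_iff[OF B spec_pt_preimage_open[OF A B h oV] spec_map_section[OF A B h oV s'], of Q] Qp PV
    by (simp add: pre)
  then have unit: "loc_map B \<theta> Q (s (spec_pt A B \<theta> Q)) \<in> Units (loc B Q)"
    using Qp PV by (simp add: snd_spec_map[OF oV s'])
  interpret P: primeideal "spec_pt A B \<theta> Q" A by (rule spec_pt_prime[OF A B h Qp])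
  obtain a b where ab: "s (spec_pt A B \<theta> Q) = lfrac A (spec_pt A B \<theta> Q) a b" "a \<in> carrier A" "b \<in> carrier A - spec_pt A B \<theta> Q"
    using spec_sec_value[OF s' PV] by (rule P.loc_carrierE)
  \<comment> \<open>Locality of the map of local rings: a unit forces \<open>\<theta> a\<close>
    outside \<open>Q\<close>, which means \<open>a\<close> outside the contracted prime.\<close>
  have "lfrac B Q (\<theta> a) (\<theta> b) \<in> Units (loc B Q)"
    using unit loc_map_lfrac[OF A B h Qp ab(2,3)] ab(1) by simp
  then have "\<theta> a \<notin> Q"
    using primeideal.lfrac_Units_iff[OF Qp ring_hom_closed[OF h ab(2)] spec_pt_compl[OF h ab(3)]] by simp
  then have "a \<notin> spec_pt A B \<theta> Q" unfolding spec_pt_def by blast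
  then have "s (spec_pt A B \<theta> Q) \<in> Units (loc A (spec_pt A B \<theta> Q))"
    using P.lfrac_Units_iff[OF ab(2,3)] ab(1) by simp
  then show "germ_unit ?T V s (fst ?F Q)"
    using germ_unit_Spec_iff[OF A oV s' PV] fst_spec_map[OF Qp, of A \<theta>] by simp
qed

lemma spec_pt_comp:
  "\<theta> \<in> ring_hom A B \<Longrightarrow> spec_pt A B \<theta> (spec_pt B C \<chi> Q) = spec_pt A C (\<chi> \<circ> \<theta>) Q"
  using ring_hom_closed by (fastforce simp: spec_pt_def)

lemma loc_map_comp:
  assumes A: "cring A" and B: "cring B" and C: "cring C" and h: "\<theta> \<in> ring_hom A B" and g: "\<chi> \<in> ring_hom B C"
    and Q: "primeideal Q C" and x: "x \<in> carrier (loc A (spec_pt A B \<theta> (spec_pt B C \<chi> Q)))"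
  shows "loc_map C \<chi> Q (loc_map B \<theta> (spec_pt B C \<chi> Q) x) = loc_map C (\<chi> \<circ> \<theta>) Q x"
proof -
  have R: "primeideal (spec_pt B C \<chi> Q) B" by (rule spec_pt_prime[OF B C g Q])
  interpret P: primeideal "spec_pt A B \<theta> (spec_pt B C \<chi> Q)" A by (rule spec_pt_prime[OF A B h R])
  obtain a s where as: "x = lfrac A (spec_pt A B \<theta> (spec_pt B C \<chi> Q)) a s" "a \<in> carrier A"
    "s \<in> carrier A - spec_pt A B \<theta> (spec_pt B C \<chi> Q)"
    using x by (rule P.loc_carrierE)
  have pt: "spec_pt A B \<theta> (spec_pt B C \<chi> Q) = spec_pt A C (\<chi> \<circ> \<theta>) Q"
    by (rule spec_pt_comp[OF h])
  have "loc_map B \<theta> (spec_pt B C \<chi> Q) x = lfrac B (spec_pt B C \<chi> Q) (\<theta> a) (\<theta> s)"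
    unfolding as(1) by (rule loc_map_lfrac[OF A B h R as(2,3)])
  moreover have "loc_map C \<chi> Q (lfrac B (spec_pt B C \<chi> Q) (\<theta> a) (\<theta> s)) = lfrac C Q (\<chi> (\<theta> a)) (\<chi> (\<theta> s))"
    by (rule loc_map_lfrac[OF B C g Q ring_hom_closed[OF h as(2)] spec_pt_compl[OF h as(3)]])
  moreover have "loc_map C (\<chi> \<circ> \<theta>) Q x = lfrac C Q ((\<chi> \<circ> \<theta>) a) ((\<chi> \<circ> \<theta>) s)"
    using loc_map_lfrac[OF A C ring_hom_trans[OF h g] Q as(2)] as(1,3) pt by simp
  ultimately show ?thesis by simp
qed

text \<open>Contraction of primes and the maps of localizations are both functorial, and the
  preimage of \<open>V\<close> taken in two steps is the one taken in a single step.\<close>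

lemma spec_map_comp:
  assumes A: "cring A" and B: "cring B" and C: "cring C" and h: "\<theta> \<in> ring_hom A B" and g: "\<chi> \<in> ring_hom B C"
  shows "rcomp (Spec C \<eta>'') (Spec B \<eta>') (Spec A \<eta>) (spec_map A B \<theta>) (spec_map B C \<chi>) = spec_map A C (\<chi> \<circ> \<theta>)"
    (is "?L = ?R")
proof (rule prod_eqI)
  have pt: "spec_pt A B \<theta> (spec_pt B C \<chi> Q) = spec_pt A C (\<chi> \<circ> \<theta>) Q" for Q
    by (rule spec_pt_comp[OF h])
  show "fst ?L = fst ?R"
    using spec_pt_prime[OF B C g]
    by (auto simp: rcomp_def spec_map_def topspace_zariski C pt restrict_def fun_eq_iff)
  show "snd ?L = snd ?R"
  proof (rule extensionalityI[of _ "{V. openin (zariski A) V}"])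
    fix V assume "V \<in> {V. openin (zariski A) V}"
    then have V: "openin (zariski A) V" by simp
    let ?pB = "{Q. primeideal Q B \<and> spec_pt A B \<theta> Q \<in> V}"
    have oB: "openin (zariski B) ?pB" by (rule spec_pt_preimage_open[OF A B h V])
    have eq: "{Q. primeideal Q C \<and> spec_pt B C \<chi> Q \<in> ?pB} = {Q. primeideal Q C \<and> spec_pt A C (\<chi> \<circ> \<theta>) Q \<in> V}"
      using spec_pt_prime[OF B C g] pt by auto
    show "snd ?L V = snd ?R V"
    proof (rule extensionalityI[of _ "carrier (spec_sec A V)"])
      fix s assume s: "s \<in> carrier (spec_sec A V)"
      have "snd ?L V s = snd (spec_map B C \<chi>) ?pB (snd (spec_map A B \<theta>) V s)"
        using V s by (simp add: snd_rcomp rpre_spec_map[OF B])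
      also have "\<dots> = snd ?R V s"
        unfolding snd_spec_map[OF oB spec_map_section[OF A B h V s]] unfolding snd_spec_map[OF V s] eq
      proof (rule restrict_ext)
        fix Q assume Q: "Q \<in> {Q. primeideal Q C \<and> spec_pt A C (\<chi> \<circ> \<theta>) Q \<in> V}"
        then have Qp: "primeideal Q C" "spec_pt A C (\<chi> \<circ> \<theta>) Q \<in> V" by auto
        have "loc_map C \<chi> Q (loc_map B \<theta> (spec_pt B C \<chi> Q) (s (spec_pt A C (\<chi> \<circ> \<theta>) Q))) =
            loc_map C (\<chi> \<circ> \<theta>) Q (s (spec_pt A C (\<chi> \<circ> \<theta>) Q))"
          using loc_map_comp[OF A B C h g Qp(1)] spec_sec_value[OF s Qp(2)] pt by simp
        then show "loc_map C \<chi> Q ((\<lambda>Q\<in>?pB. loc_map B \<theta> Q (s (spec_pt A B \<theta> Q))) (spec_pt B C \<chi> Q)) =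
            loc_map C (\<chi> \<circ> \<theta>) Q (s (spec_pt A C (\<chi> \<circ> \<theta>) Q))"
          using spec_pt_prime[OF B C g Qp(1)] Qp(2) by (simp add: pt)
      qed
      finally show "snd ?L V s = snd ?R V s" .
    qed (use V in \<open>simp_all add: rcomp_def spec_map_def\<close>)
  qed (simp_all add: rcomp_def spec_map_def)
qed

text \<open>Agreement on the carrier is all that automorphisms provide: the composite of one with
  its inverse is the identity there but may be a different function elsewhere.\<close>

lemma spec_map_cong:
  assumes A: "cring A" and B: "cring B" and h: "\<theta> \<in> ring_hom A B" and eq: "\<And>a. a \<in> carrier A \<Longrightarrow> \<theta> a = \<theta>' a"
  shows "spec_map A B \<theta> = spec_map A B \<theta>'"
proof -
  have h': "\<theta>' \<in> ring_hom A B"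
    using ring_hom_cong[OF cring.axioms(1)[OF A] h] eq by simp
  have pt: "spec_pt A B \<theta> Q = spec_pt A B \<theta>' Q" for Q using eq by (auto simp: spec_pt_def)
  have loc: "loc_map B \<theta> Q x = loc_map B \<theta>' Q x" if Q: "primeideal Q B" and x: "x \<in> carrier (loc A (spec_pt A B \<theta> Q))" for Q x
  proof -
    obtain a s where as: "x = lfrac A (spec_pt A B \<theta> Q) a s" "a \<in> carrier A" "s \<in> carrier A - spec_pt A B \<theta> Q"
      using x by (rule primeideal.loc_carrierE[OF spec_pt_prime[OF A B h Q]])
    show ?thesis
      using loc_map_lfrac[OF A B h Q as(2,3)] loc_map_lfrac[OF A B h' Q as(2)] as eq pt by simp
  qed
  show ?thesis
    unfolding spec_map_def pt
    by (intro arg_cong2[of _ _ _ _ Pair] restrict_ext) (auto simp: loc[unfolded pt] spec_sec_value)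
qed

lemma spec_map_id:
  assumes A: "cring A" shows "spec_map A A (\<lambda>a. a) = rid (Spec A \<eta>)"
proof (rule prod_eqI)
  have pt: "spec_pt A A (\<lambda>a. a) Q = Q" if "primeideal Q A" for Q
  proof -
    have "Q \<subseteq> carrier A" using that by (rule additive_subgroup.a_subset[OF ideal.axioms(1)[OF primeideal.axioms(1)]])
    then show ?thesis by (auto simp: spec_pt_def)
  qed
  have h: "(\<lambda>a. a) \<in> ring_hom A A" by (rule ring_hom_memI) simp_all
  have l: "loc_map A (\<lambda>a. a) Q x = x" if Q: "primeideal Q A" and x: "x \<in> carrier (loc A Q)" for Q x
  proof -
    obtain a s where as: "x = lfrac A Q a s" "a \<in> carrier A" "s \<in> carrier A - Q"
      using x by (rule primeideal.loc_carrierE[OF Q])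
    then show ?thesis using loc_map_lfrac[OF A A h Q as(2)] pt[OF Q] by simp
  qed
  show "fst (spec_map A A (\<lambda>a. a)) = fst (rid (Spec A \<eta>))"
    by (auto simp: spec_map_def rid_def topspace_zariski A pt restrict_def fun_eq_iff)
  have "snd (spec_map A A (\<lambda>a. a)) V s = s" if V: "openin (zariski A) V" and s: "s \<in> carrier (spec_sec A V)" for V s
  proof -
    have "{Q. primeideal Q A \<and> spec_pt A A (\<lambda>a. a) Q \<in> V} = V"
      using openin_zariski_prime[OF V] pt by auto
    then have "snd (spec_map A A (\<lambda>a. a)) V s = (\<lambda>Q\<in>V. loc_map A (\<lambda>a. a) Q (s (spec_pt A A (\<lambda>a. a) Q)))"
      by (simp only: snd_spec_map[OF V s])
    also have "\<dots> = (\<lambda>Q\<in>V. s Q)"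
      using openin_zariski_prime[OF V] by (intro restrict_ext) (simp add: pt l spec_sec_value[OF s])
    also have "\<dots> = s" using spec_sec_extensional[OF s] by (simp add: extensional_restrict)
    finally show ?thesis .
  qed
  then show "snd (spec_map A A (\<lambda>a. a)) = snd (rid (Spec A \<eta>))"
    by (simp add: spec_map_def rid_def restrict_def fun_eq_iff)
qed

section \<open>Recovering a morphism into a spectrum from global sections\<close>

lemma rmor_germ_unit:
  assumes F: "F \<in> rmor S T" and V: "openin (rtop T) V" and x: "x \<in> topspace (rtop S)"
    and s: "s \<in> carrier (rsec T V)" and u: "germ_unit T V s (fst F x)"
  shows "germ_unit S (rpre S F V) (snd F V s) x"
proof -
  obtain W where W: "openin (rtop T) W" "fst F x \<in> W" "W \<subseteq> V" "rres T V W s \<in> Units (rsec T W)"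
    using u unfolding germ_unit_def by (elim exE conjE)
  have "rres S (rpre S F V) (rpre S F W) (snd F V s) \<in> Units (rsec S (rpre S F W))"
    using ring_hom_Units[OF rmor_hom[OF F W(1)] W(4)] rmor_restrict[OF F V W(1,3) s] by simp
  moreover have "x \<in> rpre S F W" using x W(2) by (simp add: rpre_def)
  ultimately show ?thesis
    unfolding germ_unit_def using rpre_open[OF F W(1)] rpre_mono[OF W(3)] by (intro exI conjI)
qed

text \<open>The image of \<open>a\<close> under the canonical map from the ring to the global
  sections of its structure sheaf.\<close>

definition const_sec :: "('a, 'm) ring_scheme \<Rightarrow> 'a \<Rightarrow> 'a set \<Rightarrow> ('a \<times> 'a) set" where
  "const_sec A a = (\<lambda>P\<in>{P. primeideal P A}. lfrac A P a \<one>\<^bsub>A\<^esub>)"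

lemma openin_Collect_prime: "cring A \<Longrightarrow> openin (zariski A) {P. primeideal P A}"
  using openin_topspace[of "zariski A"] by (simp add: topspace_zariski)

lemma const_sec_closed:
  "cring A \<Longrightarrow> a \<in> carrier A \<Longrightarrow> const_sec A a \<in> carrier (spec_sec A {P. primeideal P A})"
  unfolding const_sec_def by (rule const_section[OF _ openin_Collect_prime])

text \<open>Only the global sections of the form \<open>a/1\<close> are prescribed, so the
  hypothesis can be checked without knowing whether there are others.\<close>

lemma spec_map_unique:
  assumes A: "cring A" and B: "cring B" and h: "\<theta> \<in> ring_hom A B"
    and \<eta>: "\<And>k. \<eta> k \<in> carrier A" and \<eta>': "\<And>k. \<eta>' k = \<theta> (\<eta> k)"
    and F: "F \<in> rmor (Spec B \<eta>') (Spec A \<eta>)"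
    and glob: "\<And>a. a \<in> carrier A \<Longrightarrow> snd F {P. primeideal P A} (const_sec A a) = const_sec B (\<theta> a)"
  shows "F = spec_map A B \<theta>"
proof (rule rmor_eqI[OF F spec_map_rmor[OF A B h \<eta> \<eta>']])
  let ?S = "Spec B \<eta>'" and ?T = "Spec A \<eta>" and ?X = "{P. primeideal P A}" and ?Y = "{Q. primeideal Q B}"
  interpret A: cring A by fact
  interpret B: cring B by fact
  have oX: "openin (zariski A) ?X" and oY: "openin (zariski B) ?Y" using openin_Collect_prime A B by auto
  have FX: "primeideal (fst F Q) A" if "primeideal Q B" for Q
    using rmor_point[OF F, of Q] that by (simp add: topspace_zariski A B)
  have preX: "rpre ?S F ?X = ?Y" using FX by (auto simp: rpre_def topspace_zariski B)
  have pt: "fst F Q = spec_pt A B \<theta> Q" if Q: "primeideal Q B" for Q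
  proof -
    have "a \<notin> fst F Q \<longleftrightarrow> \<theta> a \<notin> Q" if a: "a \<in> carrier A" for a
    proof -
      note c = const_sec_closed[OF A a] and c' = const_sec_closed[OF B ring_hom_closed[OF h a]]
      \<comment> \<open>\<open>rmor_germ_unit\<close> gives one direction and
        \<open>rmor_local\<close> the other. Each side then expresses that a prime avoids an
        element.\<close>
      have "germ_unit ?T ?X (const_sec A a) (fst F Q) \<longleftrightarrow> germ_unit ?S (rpre ?S F ?X) (snd F ?X (const_sec A a)) Q"
        using rmor_germ_unit[OF F _ _ _, of ?X Q "const_sec A a"] rmor_local[OF F, of Q ?X "const_sec A a"] Q FX[OF Q] oX c
        by (auto simp: topspace_zariski A B)
      then have "const_sec A a (fst F Q) \<in> Units (loc A (fst F Q)) \<longleftrightarrow> const_sec B (\<theta> a) Q \<in> Units (loc B Q)"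
        using germ_unit_Spec_iff[OF A oX c, of "fst F Q" \<eta>] germ_unit_Spec_iff[OF B oY c', of Q \<eta>'] FX[OF Q] Q
        by (simp add: preX glob[OF a])
      then show ?thesis
        using primeideal.lfrac_Units_iff[OF FX[OF Q] a primeideal.compl_one[OF FX[OF Q]]]
          primeideal.lfrac_Units_iff[OF Q ring_hom_closed[OF h a] primeideal.compl_one[OF Q]] FX[OF Q] Q
        by (simp add: const_sec_def)
    qed
    moreover have "fst F Q \<subseteq> carrier A"
      by (rule additive_subgroup.a_subset[OF ideal.axioms(1)[OF primeideal.axioms(1)[OF FX[OF Q]]]])
    ultimately show ?thesis by (auto simp: spec_pt_def)
  qed
  show "fst F Q = fst (spec_map A B \<theta>) Q" if "Q \<in> topspace (rtop ?S)" for Q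
    using that pt by (simp add: topspace_zariski B fst_spec_map)
  fix V s assume "openin (rtop ?T) V" "s \<in> carrier (rsec ?T V)"
  then have V: "openin (zariski A) V" and s: "s \<in> carrier (spec_sec A V)" by simp_all
  have preV: "rpre ?S F V = {Q. primeideal Q B \<and> spec_pt A B \<theta> Q \<in> V}"
    using pt by (auto simp: rpre_def topspace_zariski B)
  have cs: "snd F V s \<in> carrier (spec_sec B (rpre ?S F V))"
    using rmor_closed[OF F] V s by simp
  have "snd F V s Q = loc_map B \<theta> Q (s (spec_pt A B \<theta> Q))" if Q: "primeideal Q B" "spec_pt A B \<theta> Q \<in> V" for Q
  proof -
    interpret Q: primeideal Q B by fact
    interpret L: cring "loc B Q" by (rule Q.cring_loc)
    obtain W a b where W: "openin (zariski A) W" "spec_pt A B \<theta> Q \<in> W" "W \<subseteq> V" "frac_on A W s a b"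
      using s Q(2) by (rule spec_sec_carrierE)
    have ab: "a \<in> carrier A" "b \<in> carrier A" "b \<in> carrier A - spec_pt A B \<theta> Q"
      "s (spec_pt A B \<theta> Q) = lfrac A (spec_pt A B \<theta> Q) a b"
      using W(2,4) by (simp_all add: frac_on_def)
    have WX: "W \<subseteq> ?X" using openin_zariski_prime[OF W(1)] by blast
    have QW: "Q \<in> rpre ?S F W" using Q W(2) pt by (simp add: rpre_def topspace_zariski B)
    have c: "restrict (const_sec A r) W \<in> carrier (spec_sec A W)" if "r \<in> carrier A" for r
      by (rule restrict_section[OF W(1) WX const_sec_closed[OF A that]])
    have sW: "restrict s W \<in> carrier (spec_sec A W)" by (rule restrict_section[OF W(1,3) s])
    have Fc: "snd F W (restrict (const_sec A r) W) Q = lfrac B Q (\<theta> r) \<one>\<^bsub>B\<^esub>" if r: "r \<in> carrier A" for r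
    proof -
      have "snd F W (restrict (const_sec A r) W) = restrict (const_sec B (\<theta> r)) (rpre ?S F W)"
        using rmor_restrict[OF F, of ?X W "const_sec A r"] oX W(1) WX const_sec_closed[OF A r]
        by (simp add: glob[OF r])
      then show ?thesis using QW Q(1) by (simp add: const_sec_def)
    qed
    have Fs: "snd F W (restrict s W) Q = snd F V s Q"
      using rmor_restrict[OF F, of V W s] V W(1,3) s QW by simp
    \<comment> \<open>Near the point \<open>s\<close> is \<open>a/b\<close>. This is recorded as the
      equation \<open>s b = a\<close> between sections over \<open>W\<close>, a form that can be
      pushed through the homomorphism \<open>snd F W\<close>.\<close>
    have prod: "restrict s W \<otimes>\<^bsub>spec_sec A W\<^esub> restrict (const_sec A b) W = restrict (const_sec A a) W"
    proof (rule spec_sec_eqI[of _ W])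
      fix P assume P: "P \<in> W"
      interpret P: primeideal P A by (rule openin_zariski_prime[OF W(1) P])
      have b: "b \<in> carrier A - P" "s P = lfrac A P a b" using W(4) P by (simp_all add: frac_on_def)
      have "lfrac A P a b \<otimes>\<^bsub>loc A P\<^esub> lfrac A P b \<one>\<^bsub>A\<^esub> = lfrac A P (b \<otimes>\<^bsub>A\<^esub> a) (b \<otimes>\<^bsub>A\<^esub> \<one>\<^bsub>A\<^esub>)"
        using ab(1,2) P.compl_one by (simp add: P.loc_mult[OF ab(1) b(1)] A.m_comm)
      also have "\<dots> = lfrac A P a \<one>\<^bsub>A\<^esub>" by (rule P.lfrac_cancel[OF ab(1) P.compl_one b(1)])
      finally show "(restrict s W \<otimes>\<^bsub>spec_sec A W\<^esub> restrict (const_sec A b) W) P = restrict (const_sec A a) W P"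
        using P WX b(2) by (auto simp: spec_sec_ops const_sec_def)
    qed (simp_all add: spec_sec_ops)
    have homW: "snd F W \<in> ring_hom (spec_sec A W) (spec_sec B (rpre ?S F W))"
      using rmor_hom[OF F, of W] W(1) by simp
    have 1: "snd F V s Q \<otimes>\<^bsub>loc B Q\<^esub> lfrac B Q (\<theta> b) \<one>\<^bsub>B\<^esub> = lfrac B Q (\<theta> a) \<one>\<^bsub>B\<^esub>"
      using arg_cong[OF prod, of "\<lambda>t. snd F W t Q"] ring_hom_mult[OF homW sW c[OF ab(2)]] QW
      by (simp add: Fc ab(1,2) Fs) (simp add: spec_sec_ops Fs Fc ab(2))
    have \<theta>b: "\<theta> b \<in> carrier B - Q" by (rule spec_pt_compl[OF h ab(3)])
    have \<theta>a: "\<theta> a \<in> carrier B" by (rule ring_hom_closed[OF h ab(1)])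
    have "lfrac B Q (\<theta> a) (\<theta> b) \<otimes>\<^bsub>loc B Q\<^esub> lfrac B Q (\<theta> b) \<one>\<^bsub>B\<^esub> = lfrac B Q (\<theta> b \<otimes>\<^bsub>B\<^esub> \<theta> a) (\<theta> b \<otimes>\<^bsub>B\<^esub> \<one>\<^bsub>B\<^esub>)"
      using \<theta>a \<theta>b Q.compl_one by (simp add: Q.loc_mult[OF \<theta>a \<theta>b] B.m_comm)
    also have "\<dots> = lfrac B Q (\<theta> a) \<one>\<^bsub>B\<^esub>" by (rule Q.lfrac_cancel[OF \<theta>a Q.compl_one \<theta>b])
    finally have 2: "lfrac B Q (\<theta> a) (\<theta> b) \<otimes>\<^bsub>loc B Q\<^esub> lfrac B Q (\<theta> b) \<one>\<^bsub>B\<^esub> = lfrac B Q (\<theta> a) \<one>\<^bsub>B\<^esub>" .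
    \<comment> \<open>The denominator is invertible at \<open>Q\<close>, so the value of the image
      section and the expected fraction, which have the same product with it, agree.\<close>
    have unit: "lfrac B Q (\<theta> b) \<one>\<^bsub>B\<^esub> \<in> Units (loc B Q)"
      using Q.lfrac_Units_iff[OF _ Q.compl_one, of "\<theta> b"] \<theta>b by simp
    have cl: "snd F V s Q \<in> carrier (loc B Q)" "lfrac B Q (\<theta> a) (\<theta> b) \<in> carrier (loc B Q)"
      using spec_sec_value[OF cs, of Q] Q preV Q.lfrac_closed[OF \<theta>a \<theta>b] by auto
    have "lfrac B Q (\<theta> b) \<one>\<^bsub>B\<^esub> \<otimes>\<^bsub>loc B Q\<^esub> snd F V s Q = lfrac B Q (\<theta> b) \<one>\<^bsub>B\<^esub> \<otimes>\<^bsub>loc B Q\<^esub> lfrac B Q (\<theta> a) (\<theta> b)"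
      using 1 2 L.m_comm[OF cl(1) L.Units_closed[OF unit]] L.m_comm[OF cl(2) L.Units_closed[OF unit]] by simp
    then have "snd F V s Q = lfrac B Q (\<theta> a) (\<theta> b)"
      using L.Units_l_cancel[OF unit] cl by simp
    also have "\<dots> = loc_map B \<theta> Q (s (spec_pt A B \<theta> Q))"
      using loc_map_lfrac[OF A B h Q(1) ab(1,3)] ab(4) by simp
    finally show ?thesis .
  qed
  then show "snd F V s = snd (spec_map A B \<theta>) V s"
    unfolding snd_spec_map[OF V s]
    by (intro spec_sec_eqI[of _ "rpre ?S F V"] spec_sec_extensional[OF cs]) (auto simp: preV)
qed

section \<open>Automorphisms and closed subschemes of spectra\<close>

lemma alg_aut_hom: "\<phi> \<in> alg_aut A \<eta> \<Longrightarrow> \<phi> \<in> ring_hom A A"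
  by (simp add: alg_aut_def ring_iso_def)

text \<open>The inverse function is cut down to the carrier, because membership in
  \<open>alg_aut\<close> demands extensionality.\<close>

lemma alg_aut_inverse:
  assumes "ring A" and \<phi>: "\<phi> \<in> alg_aut A \<eta>" and \<eta>: "\<And>k. \<eta> k \<in> carrier A"
  obtains \<psi> where "\<psi> \<in> alg_aut A \<eta>" "\<And>a. a \<in> carrier A \<Longrightarrow> \<psi> (\<phi> a) = a" "\<And>a. a \<in> carrier A \<Longrightarrow> \<phi> (\<psi> a) = a"
proof -
  let ?g = "inv_into (carrier A) \<phi>"
  have iso: "\<phi> \<in> ring_iso A A" using \<phi> by (simp add: alg_aut_def)
  then have bij: "bij_betw \<phi> (carrier A) (carrier A)" by (simp add: ring_iso_def)
  have g: "?g \<in> ring_iso A A" by (rule ring_iso_set_sym[OF assms(1) iso])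
  let ?\<psi> = "restrict ?g (carrier A)"
  have 1: "?\<psi> (\<phi> a) = a" if "a \<in> carrier A" for a
    using that bij by (simp add: bij_betw_inv_into_left bij_betwE)
  have 2: "\<phi> (?\<psi> a) = a" if "a \<in> carrier A" for a
    using that bij by (simp add: bij_betw_inv_into_right)
  have "?\<psi> \<in> ring_hom A A"
    using g ring_hom_cong[OF assms(1), of ?g A ?\<psi>] by (simp add: ring_iso_def)
  moreover have "bij_betw ?\<psi> (carrier A) (carrier A)"
  proof -
    have "bij_betw ?\<psi> (carrier A) (carrier A) \<longleftrightarrow> bij_betw ?g (carrier A) (carrier A)"
      by (rule bij_betw_cong) simp
    then show ?thesis using g by (simp add: ring_iso_def)
  qed
  moreover have "?\<psi> (\<eta> k) = \<eta> k" for k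
  proof -
    have "\<phi> (\<eta> k) = \<eta> k" using \<phi> by (simp add: alg_aut_def)
    then show ?thesis using 1[OF \<eta>[of k]] by simp
  qed
  ultimately have "?\<psi> \<in> alg_aut A \<eta>" by (simp add: alg_aut_def ring_iso_def)
  then show ?thesis using 1 2 by (rule that)
qed

lemma spec_map_rinverse:
  assumes A: "cring A" and \<eta>: "\<And>k. \<eta> k \<in> carrier A"
    and \<phi>: "\<phi> \<in> alg_aut A \<eta>" and \<psi>: "\<psi> \<in> alg_aut A \<eta>"
    and inv: "\<And>a. a \<in> carrier A \<Longrightarrow> \<psi> (\<phi> a) = a" "\<And>a. a \<in> carrier A \<Longrightarrow> \<phi> (\<psi> a) = a"
  shows "rinverse (Spec A \<eta>) (Spec A \<eta>) (spec_map A A \<phi>) (spec_map A A \<psi>)"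
proof -
  note h = alg_aut_hom[OF \<phi>] alg_aut_hom[OF \<psi>]
  have "spec_map A A (\<phi> \<circ> \<psi>) = spec_map A A (\<lambda>a. a)" "spec_map A A (\<psi> \<circ> \<phi>) = spec_map A A (\<lambda>a. a)"
    using inv by (intro spec_map_cong A ring_hom_trans[OF h(2,1)] ring_hom_trans[OF h]; simp)+
  moreover have "spec_map A A \<phi> \<in> rmor (Spec A \<eta>) (Spec A \<eta>)" "spec_map A A \<psi> \<in> rmor (Spec A \<eta>) (Spec A \<eta>)"
    using \<phi> \<psi> by (intro spec_map_rmor A h \<eta>; simp add: alg_aut_def)+
  ultimately show ?thesis
    by (simp add: rinverse_def spec_map_comp[OF A A A] h spec_map_id[OF A])
qed

section \<open>Supports of closed subschemes of spectra and of their inverse images\<close>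

lemma vanishing_subset: "vanishing A J U \<subseteq> carrier (spec_sec A U)"
  by (auto simp: vanishing_def)

text \<open>Numerators go from \<open>J\<close> to \<open>K\<close> under \<open>\<theta>\<close>.
  The case \<open>K = J\<close> serves automorphisms; the case where \<open>K\<close> is a prime of
  \<open>B\<close> serves the computation of the support of an inverse image.\<close>

lemma spec_map_vanishing:
  assumes A: "cring A" and B: "cring B" and h: "\<theta> \<in> ring_hom A B" and V: "openin (zariski A) V"
    and J: "J \<subseteq> carrier A" "\<theta> ` J \<subseteq> K"
  shows "snd (spec_map A B \<theta>) V ` vanishing A J V \<subseteq> vanishing B K {Q. primeideal Q B \<and> spec_pt A B \<theta> Q \<in> V}"
proof
  fix t assume "t \<in> snd (spec_map A B \<theta>) V ` vanishing A J V"
  then obtain s where s: "s \<in> vanishing A J V" "t = snd (spec_map A B \<theta>) V s" by (rule imageE)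
  have sc: "s \<in> carrier (spec_sec A V)" using s(1) by (simp add: vanishing_def)
  have "\<exists>a\<in>K. \<exists>b\<in>carrier B - Q. t Q = lfrac B Q a b" if Q: "primeideal Q B" "spec_pt A B \<theta> Q \<in> V" for Q
  proof -
    obtain a b where ab: "a \<in> J" "b \<in> carrier A - spec_pt A B \<theta> Q" "s (spec_pt A B \<theta> Q) = lfrac A (spec_pt A B \<theta> Q) a b"
      using s(1) Q(2) unfolding vanishing_def by auto
    have "t Q = lfrac B Q (\<theta> a) (\<theta> b)"
      using loc_map_lfrac[OF A B h Q(1) _ ab(2), of a] ab(1,3) J(1) Q by (auto simp: s(2) snd_spec_map[OF V sc])
    moreover have "\<theta> a \<in> K" using ab(1) J(2) by blast
    ultimately show ?thesis using spec_pt_compl[OF h ab(2)] by (intro bexI)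
  qed
  then show "t \<in> vanishing B K {Q. primeideal Q B \<and> spec_pt A B \<theta> Q \<in> V}"
    using spec_map_section[OF A B h V sc] s(2) by (simp add: vanishing_def)
qed

text \<open>This is the maximal ideal of the local ring. Being an ideal without units, it shows that
  sections with all values at a point inside it cannot generate an ideal containing 1.\<close>

lemma (in primeideal) loc_maximal_ideal:
  "ideal {lfrac R I a s | a s. a \<in> I \<and> s \<in> carrier R - I} (loc R I)" (is "ideal ?M _")
proof -
  interpret L: cring "loc R I" by (rule cring_loc)
  have MI: "lfrac R I a s \<in> ?M" if "a \<in> I" "s \<in> carrier R - I" for a s
    using that by blast
  have ME: "\<exists>a s. x = lfrac R I a s \<and> a \<in> I \<and> a \<in> carrier R \<and> s \<in> carrier R - I" if "x \<in> ?M" for x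
    using that Icarr by blast
  have sub: "?M \<subseteq> carrier (loc R I)"
  proof
    fix x assume "x \<in> ?M"
    from ME[OF this] obtain a s where "x = lfrac R I a s" "a \<in> carrier R" "s \<in> carrier R - I"
      by blast
    then show "x \<in> carrier (loc R I)" using lfrac_closed by simp
  qed
  note zI = additive_subgroup.zero_closed[OF additive_subgroup_axioms]
    and aI = additive_subgroup.a_closed[OF additive_subgroup_axioms]
  show ?thesis
  proof (rule idealI)
    show "ring (loc R I)" by (rule L.ring_axioms)
    show "subgroup ?M (add_monoid (loc R I))"
    proof (rule group.subgroupI[OF L.a_group])
      show "?M \<subseteq> carrier (add_monoid (loc R I))" using sub by simp
      show "?M \<noteq> {}" using MI[OF zI compl_one] by auto
    next
      fix x assume "x \<in> ?M"
      from ME[OF this] obtain a s where x: "x = lfrac R I a s" "a \<in> I" "a \<in> carrier R" "s \<in> carrier R - I"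
        by blast
      have na: "\<ominus> a \<in> carrier R" using x(3) by simp
      have "\<ominus>\<^bsub>loc R I\<^esub> x = lfrac R I (\<ominus> a) s"
        unfolding x(1)
        by (rule L.minus_equality[OF loc_l_neg[OF x(3,4)] lfrac_closed[OF x(3,4)] lfrac_closed[OF na x(4)]])
      moreover have "\<ominus> a \<in> I" by (rule additive_subgroup.a_inv_closed[OF additive_subgroup_axioms x(2)])
      ultimately have "\<ominus>\<^bsub>loc R I\<^esub> x \<in> ?M" using MI[OF _ x(4)] by simp
      then show "inv\<^bsub>add_monoid (loc R I)\<^esub> x \<in> ?M" unfolding a_inv_def .
    next
      fix x y assume xM: "x \<in> ?M" and yM: "y \<in> ?M"
      from ME[OF xM] obtain a s where x: "x = lfrac R I a s" "a \<in> I" "a \<in> carrier R" "s \<in> carrier R - I"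
        by blast
      from ME[OF yM] obtain b t where y: "y = lfrac R I b t" "b \<in> I" "b \<in> carrier R" "t \<in> carrier R - I"
        by blast
      have "x \<oplus>\<^bsub>loc R I\<^esub> y = lfrac R I (t \<otimes> a \<oplus> s \<otimes> b) (s \<otimes> t)"
        unfolding x(1) y(1) by (rule loc_add[OF x(3,4) y(3,4)])
      moreover have "t \<otimes> a \<in> I" "s \<otimes> b \<in> I"
        using I_l_closed[OF x(2)] I_l_closed[OF y(2)] x(4) y(4) by auto
      ultimately show "x \<otimes>\<^bsub>add_monoid (loc R I)\<^esub> y \<in> ?M"
        using MI[OF aI compl_mult[OF x(4) y(4)]] by simp
    qed
    fix x y assume xM: "x \<in> ?M" and y: "y \<in> carrier (loc R I)"
    from ME[OF xM] obtain a s where x: "x = lfrac R I a s" "a \<in> I" "a \<in> carrier R" "s \<in> carrier R - I"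
      by blast
    obtain b t where b: "y = lfrac R I b t" "b \<in> carrier R" "t \<in> carrier R - I" using y by (rule loc_carrierE)
    have "x \<otimes>\<^bsub>loc R I\<^esub> y = lfrac R I (a \<otimes> b) (s \<otimes> t)"
      unfolding x(1) b(1) by (rule loc_mult[OF x(3,4) b(2,3)])
    then show xy: "x \<otimes>\<^bsub>loc R I\<^esub> y \<in> ?M"
      using MI[OF I_r_closed[OF x(2) b(2)] compl_mult[OF x(4) b(3)]] by simp
    show "y \<otimes>\<^bsub>loc R I\<^esub> x \<in> ?M"
      using xy L.m_comm[OF lfrac_closed[OF x(3,4)] y] x(1) by simp
  qed
qed

text \<open>For \<open>a\<close> in \<open>J\<close> the section 1 over
  \<open>basic_open A a\<close> is the fraction \<open>a/a\<close>. Conversely, if 1 is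
  \<open>a/b\<close> at \<open>P\<close> with \<open>a\<close> in \<open>J\<close>, then
  \<open>a/b\<close> is a unit and \<open>a\<close> avoids \<open>P\<close>.\<close>

lemma compl_supp_vanishing:
  assumes A: "cring A" and J: "J \<subseteq> carrier A"
  shows "topspace (rtop (Spec A \<eta>)) - supp (Spec A \<eta>) (vanishing A J) = {P. primeideal P A \<and> \<not> J \<subseteq> P}"
proof -
  have "(\<exists>W. openin (zariski A) W \<and> P \<in> W \<and> \<one>\<^bsub>spec_sec A W\<^esub> \<in> vanishing A J W) \<longleftrightarrow> \<not> J \<subseteq> P" if P: "primeideal P A" for P
  proof
    assume "\<exists>W. openin (zariski A) W \<and> P \<in> W \<and> \<one>\<^bsub>spec_sec A W\<^esub> \<in> vanishing A J W"
    then obtain W where W: "openin (zariski A) W" "P \<in> W" "\<one>\<^bsub>spec_sec A W\<^esub> \<in> vanishing A J W" by (elim exE conjE)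
    interpret P: primeideal P A by fact
    interpret L: cring "loc A P" by (rule P.cring_loc)
    obtain a b where ab: "a \<in> J" "b \<in> carrier A - P" "\<one>\<^bsub>loc A P\<^esub> = lfrac A P a b"
      using W(2,3) unfolding vanishing_def spec_sec_ops by auto
    have "a \<notin> P"
      using P.lfrac_Units_iff[of a b] ab J L.Units_one_closed by auto
    then show "\<not> J \<subseteq> P" using ab(1) by blast
  next
    assume "\<not> J \<subseteq> P"
    then obtain a where a: "a \<in> J" "a \<notin> P" by blast
    then have aA: "a \<in> carrier A" using J by blast
    have one: "\<one>\<^bsub>spec_sec A (basic_open A a)\<^esub> \<in> carrier (spec_sec A (basic_open A a))"
      using cring.axioms(1)[OF cring_spec_sec[OF A openin_basic_open[OF aA]]] by (rule ring.ring_simprules(6))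
    have "\<exists>c\<in>J. \<exists>b\<in>carrier A - Q. \<one>\<^bsub>spec_sec A (basic_open A a)\<^esub> Q = lfrac A Q c b" if Q: "Q \<in> basic_open A a" for Q
    proof (intro bexI[of _ a])
      have "primeideal Q A" "a \<notin> Q" using Q by (simp_all add: basic_open_def)
      then show "\<one>\<^bsub>spec_sec A (basic_open A a)\<^esub> Q = lfrac A Q a a" "a \<in> carrier A - Q"
        using primeideal.lfrac_one[of Q A a] aA Q by (simp_all add: spec_sec_ops)
    qed (rule a(1))
    then have "\<one>\<^bsub>spec_sec A (basic_open A a)\<^esub> \<in> vanishing A J (basic_open A a)"
      using one by (simp add: vanishing_def)
    then show "\<exists>W. openin (zariski A) W \<and> P \<in> W \<and> \<one>\<^bsub>spec_sec A W\<^esub> \<in> vanishing A J W"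
      using openin_basic_open[OF aA] P a(2) by (intro exI[of _ "basic_open A a"]) (simp add: basic_open_def)
  qed
  then show ?thesis by (auto simp: supp_def topspace_zariski A)
qed

text \<open>The ideal is only generated by pulled back sections, so it is tested by evaluation at
  \<open>Q\<close>. When \<open>Q\<close> contains the image of \<open>J\<close>, the generators and
  hence the whole ideal take values in the maximal ideal. Otherwise some \<open>\<theta> a\<close>
  is outside \<open>Q\<close> and becomes invertible on
  \<open>basic_open B (\<theta> a)\<close>.\<close>

lemma compl_supp_inv_img:
  assumes A: "cring A" and B: "cring B" and h: "\<theta> \<in> ring_hom A B" and J: "J \<subseteq> carrier A"
    and \<eta>: "\<And>k. \<eta> k \<in> carrier A" and \<eta>': "\<And>k. \<eta>' k = \<theta> (\<eta> k)"
  shows "topspace (rtop (Spec B \<eta>')) -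
      supp (Spec B \<eta>') (inv_img (Spec B \<eta>') (Spec A \<eta>) (spec_map A B \<theta>) (vanishing A J)) =
    {Q. primeideal Q B \<and> \<not> \<theta> ` J \<subseteq> Q}"
proof -
  let ?S = "Spec B \<eta>'" and ?T = "Spec A \<eta>" and ?\<sigma> = "spec_map A B \<theta>" and ?X = "{P. primeideal P A}"
  interpret B: cring B by fact
  interpret S: presheaf ?S using ring_hom_closed[OF h \<eta>] \<eta>' by (intro presheaf_Spec B) simp
  have \<sigma>: "?\<sigma> \<in> rmor ?S ?T" by (rule spec_map_rmor[OF A B h \<eta> \<eta>'])
  note pre = rpre_spec_map[OF B, of \<eta>' A \<theta>]
  let ?gen = "\<lambda>W V. (\<lambda>j. restrict (snd ?\<sigma> V j) W) ` vanishing A J V"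
  have gen: "?gen W V \<subseteq> carrier (spec_sec B W)"
    if "openin (zariski B) W" "openin (zariski A) V" "W \<subseteq> rpre ?S ?\<sigma> V" for W V
  proof (rule image_subsetI)
    fix j assume "j \<in> vanishing A J V"
    then have "j \<in> carrier (spec_sec A V)" by (rule subsetD[OF vanishing_subset])
    then show "restrict (snd ?\<sigma> V j) W \<in> carrier (spec_sec B W)"
      by (rule restrict_section[OF that(1) that(3)[unfolded pre] spec_map_section[OF A B h that(2)]])
  qed
  have "(\<exists>W. openin (zariski B) W \<and> Q \<in> W \<and> \<one>\<^bsub>spec_sec B W\<^esub> \<in> inv_img ?S ?T ?\<sigma> (vanishing A J) W) \<longleftrightarrow> \<not> \<theta> ` J \<subseteq> Q"
    if Q: "primeideal Q B" for Q
  proof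
    assume "\<exists>W. openin (zariski B) W \<and> Q \<in> W \<and> \<one>\<^bsub>spec_sec B W\<^esub> \<in> inv_img ?S ?T ?\<sigma> (vanishing A J) W"
    then obtain W' where W': "Q \<in> W'" "\<one>\<^bsub>spec_sec B W'\<^esub> \<in> inv_img ?S ?T ?\<sigma> (vanishing A J) W'" by (elim exE conjE)
    then obtain W V where W: "openin (zariski B) W" "Q \<in> W" "W \<subseteq> W'" "openin (zariski A) V" "W \<subseteq> rpre ?S ?\<sigma> V"
      and "restrict \<one>\<^bsub>spec_sec B W'\<^esub> W \<in> Idl\<^bsub>spec_sec B W\<^esub> (?gen W V)"
      unfolding inv_img_def by auto
    moreover have "restrict \<one>\<^bsub>spec_sec B W'\<^esub> W = \<one>\<^bsub>spec_sec B W\<^esub>"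
      using W(3) by (auto simp: spec_sec_ops restrict_def fun_eq_iff)
    ultimately have one: "\<one>\<^bsub>spec_sec B W\<^esub> \<in> Idl\<^bsub>spec_sec B W\<^esub> (?gen W V)" by simp
    interpret Q: primeideal Q B by fact
    interpret L: cring "loc B Q" by (rule Q.cring_loc)
    let ?M = "{lfrac B Q a s | a s. a \<in> Q \<and> s \<in> carrier B - Q}"
    note G = cring.axioms(1)[OF cring_spec_sec[OF B W(1)]]
    show "\<not> \<theta> ` J \<subseteq> Q"
    proof
      assume JQ: "\<theta> ` J \<subseteq> Q"
      have "ideal {s \<in> carrier (spec_sec B W). s Q \<in> ?M} (spec_sec B W)"
        using ring_hom_ring.ideal_vimage[OF ring_hom_ringI2[OF G L.ring_axioms eval_hom[OF W(2)]] Q.loc_maximal_ideal] .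
      moreover have "?gen W V \<subseteq> {s \<in> carrier (spec_sec B W). s Q \<in> ?M}"
      proof clarify
        fix j assume j: "j \<in> vanishing A J V"
        have "snd ?\<sigma> V j \<in> vanishing B Q {Q. primeideal Q B \<and> spec_pt A B \<theta> Q \<in> V}"
          using spec_map_vanishing[OF A B h W(4) J JQ] j by blast
        then have "snd ?\<sigma> V j Q \<in> ?M"
          using subsetD[OF W(5) W(2)] unfolding vanishing_def pre by blast
        then show "restrict (snd ?\<sigma> V j) W \<in> carrier (spec_sec B W) \<and> restrict (snd ?\<sigma> V j) W Q \<in> ?M"
          using gen[OF W(1,4,5)] j W(2) by auto
      qed
      ultimately have "Idl\<^bsub>spec_sec B W\<^esub> (?gen W V) \<subseteq> {s \<in> carrier (spec_sec B W). s Q \<in> ?M}"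
        by (rule ring.genideal_minimal[OF G])
      then have "\<one>\<^bsub>spec_sec B W\<^esub> Q \<in> ?M" using one by blast
      then obtain a s where as: "\<one>\<^bsub>loc B Q\<^esub> = lfrac B Q a s" "a \<in> Q" "s \<in> carrier B - Q"
        using W(2) by (auto simp: spec_sec_ops)
      then show False using Q.lfrac_Units_iff[OF Q.Icarr[OF as(2)] as(3)] L.Units_one_closed by simp
    qed
  next
    assume "\<not> \<theta> ` J \<subseteq> Q"
    then obtain a where a: "a \<in> J" "\<theta> a \<notin> Q" by blast
    then have aA: "a \<in> carrier A" using J by blast
    have \<theta>a: "\<theta> a \<in> carrier B" by (rule ring_hom_closed[OF h aA])
    define W where "W = basic_open B (\<theta> a)"
    have W: "openin (zariski B) W" "Q \<in> W" using openin_basic_open[OF \<theta>a] Q a(2) by (simp_all add: W_def basic_open_def)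
    note G = cring.axioms(1)[OF cring_spec_sec[OF B W(1)]]
    have WX: "W \<subseteq> rpre ?S ?\<sigma> ?X"
      unfolding pre W_def using spec_pt_prime[OF A B h] by (auto simp: basic_open_def)
    let ?j = "const_sec A a"
    have "\<exists>c\<in>J. \<exists>b\<in>carrier A - P. ?j P = lfrac A P c b" if "primeideal P A" for P
      using a(1) that primeideal.compl_one[OF that] by (intro bexI[of _ a] bexI[of _ "\<one>\<^bsub>A\<^esub>"]) (simp_all add: const_sec_def)
    then have j: "?j \<in> vanishing A J ?X" using const_sec_closed[OF A aA] by (simp add: vanishing_def)
    have idl: "ideal (Idl\<^bsub>spec_sec B W\<^esub> (?gen W ?X)) (spec_sec B W)"
      by (rule ring.genideal_ideal[OF G gen[OF W(1) openin_Collect_prime[OF A] WX]])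
    have "restrict (snd ?\<sigma> ?X ?j) W \<in> Idl\<^bsub>spec_sec B W\<^esub> (?gen W ?X)"
      using ring.genideal_self[OF G gen[OF W(1) openin_Collect_prime[OF A] WX]] j by blast
    moreover have "(\<lambda>Q\<in>W. lfrac B Q \<one>\<^bsub>B\<^esub> (\<theta> a)) \<in> carrier (spec_sec B W)"
      using \<theta>a by (intro frac_section W(1)) (auto simp: W_def basic_open_def)
    \<comment> \<open>The section \<open>a/1\<close> pulls back to \<open>\<theta> a/1\<close>,
      which the factor \<open>1/\<theta> a\<close> turns into 1.\<close>
    ultimately have "(\<lambda>Q\<in>W. lfrac B Q \<one>\<^bsub>B\<^esub> (\<theta> a)) \<otimes>\<^bsub>spec_sec B W\<^esub> restrict (snd ?\<sigma> ?X ?j) W \<in> Idl\<^bsub>spec_sec B W\<^esub> (?gen W ?X)"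
      by (rule ideal.I_l_closed[OF idl])
    moreover have "(\<lambda>Q\<in>W. lfrac B Q \<one>\<^bsub>B\<^esub> (\<theta> a)) \<otimes>\<^bsub>spec_sec B W\<^esub> restrict (snd ?\<sigma> ?X ?j) W = \<one>\<^bsub>spec_sec B W\<^esub>"
      unfolding spec_sec_ops
    proof (rule restrict_ext)
      fix R assume R: "R \<in> W"
      then have Rp: "primeideal R B" and aR: "\<theta> a \<in> carrier B - R" using \<theta>a by (simp_all add: W_def basic_open_def)
      interpret R: primeideal R B by fact
      interpret P: primeideal "spec_pt A B \<theta> R" A by (rule spec_pt_prime[OF A B h Rp])
      have "snd ?\<sigma> ?X ?j R = lfrac B R (\<theta> a) \<one>\<^bsub>B\<^esub>"
      proof -
        have "snd ?\<sigma> ?X ?j R = loc_map B \<theta> R (?j (spec_pt A B \<theta> R))"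
          using Rp P.primeideal by (simp add: snd_spec_map[OF openin_Collect_prime[OF A] const_sec_closed[OF A aA]])
        also have "?j (spec_pt A B \<theta> R) = lfrac A (spec_pt A B \<theta> R) a \<one>\<^bsub>A\<^esub>"
          using P.primeideal by (simp add: const_sec_def)
        finally show ?thesis
          using loc_map_lfrac[OF A B h Rp aA P.compl_one] by (simp add: ring_hom_one[OF h])
      qed
      then have "lfrac B R \<one>\<^bsub>B\<^esub> (\<theta> a) \<otimes>\<^bsub>loc B R\<^esub> snd ?\<sigma> ?X ?j R = lfrac B R (\<theta> a) (\<theta> a)"
        using R.loc_mult[OF _ aR \<theta>a R.compl_one, of "\<one>\<^bsub>B\<^esub>"] \<theta>a by simp
      also have "\<dots> = \<one>\<^bsub>loc B R\<^esub>" by (rule R.lfrac_one[OF aR])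
      finally show "(\<lambda>Q\<in>W. lfrac B Q \<one>\<^bsub>B\<^esub> (\<theta> a)) R \<otimes>\<^bsub>loc B R\<^esub> restrict (snd ?\<sigma> ?X ?j) W R = \<one>\<^bsub>loc B R\<^esub>"
        using R by simp
    qed
    ultimately have one: "\<one>\<^bsub>spec_sec B W\<^esub> \<in> Idl\<^bsub>spec_sec B W\<^esub> (?gen W ?X)" by simp
    have res: "restrict \<one>\<^bsub>spec_sec B W\<^esub> W = \<one>\<^bsub>spec_sec B W\<^esub>" by (simp add: spec_sec_ops)
    have "\<one>\<^bsub>spec_sec B W\<^esub> \<in> inv_img ?S ?T ?\<sigma> (vanishing A J) W"
      unfolding inv_img_def mem_Collect_eq
    proof (intro conjI ballI)
      show "\<one>\<^bsub>spec_sec B W\<^esub> \<in> carrier (rsec ?S W)" using ring.ring_simprules(6)[OF G] by simp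
      fix R assume "R \<in> W"
      then show "\<exists>W' V. openin (rtop ?S) W' \<and> R \<in> W' \<and> W' \<subseteq> W \<and> openin (rtop ?T) V \<and> W' \<subseteq> rpre ?S ?\<sigma> V \<and>
          rres ?S W W' \<one>\<^bsub>spec_sec B W\<^esub> \<in> Idl\<^bsub>rsec ?S W'\<^esub> ((\<lambda>j. rres ?S (rpre ?S ?\<sigma> V) W' (snd ?\<sigma> V j)) ` vanishing A J V)"
        using W(1) openin_Collect_prime[OF A] WX one res by (intro exI[of _ W] exI[of _ ?X]) simp
    qed
    then show "\<exists>W. openin (zariski B) W \<and> Q \<in> W \<and> \<one>\<^bsub>spec_sec B W\<^esub> \<in> inv_img ?S ?T ?\<sigma> (vanishing A J) W"
      using W by (intro exI conjI)
  qed
  then show ?thesis by (auto simp: supp_def topspace_zariski B)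
qed

section \<open>The algebra of an affine modification\<close>

abbreviation ideal_pow :: "('a, 'm) ring_scheme \<Rightarrow> 'a set \<Rightarrow> nat \<Rightarrow> 'a set" where
  "ideal_pow A I n \<equiv> I [^]\<^bsub>ideals_set A\<^esub> n"

lemma ideal_pow_0: "ideal_pow A I 0 = carrier A"
  by (simp add: ideals_set_def)

lemma ideal_pow_Suc: "ideal_pow A I (Suc n) = ideal_prod A (ideal_pow A I n) I"
  by (simp add: ideals_set_def)

context cring
begin

lemma ideal_pow_ideal:
  assumes "ideal I R" shows "ideal (ideal_pow R I n) R"
proof (induction n)
  case 0
  show ?case unfolding ideal_pow_0 by (rule oneideal)
next
  case (Suc n)
  show ?case unfolding ideal_pow_Suc by (rule ideal_prod_is_ideal[OF Suc assms])
qed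

text \<open>Exponents add because ideals form a commutative monoid under the ideal product.\<close>

lemma ideal_pow_mult:
  assumes I: "ideal I R" and a: "a \<in> ideal_pow R I m" and b: "b \<in> ideal_pow R I n"
  shows "a \<otimes> b \<in> ideal_pow R I (m + n)"
proof -
  interpret M: comm_monoid "ideals_set R" by (rule ideals_set_is_comm_monoid)
  have "I \<in> carrier (ideals_set R)" using I by (simp add: ideals_set_def)
  then have "ideal_prod R (ideal_pow R I m) (ideal_pow R I n) = ideal_pow R I (m + n)"
    using M.nat_pow_mult[of I m n] by (simp add: ideals_set_def)
  then show ?thesis using ideal_prod.prod[OF a b, of R] by simp
qed

lemma ideal_pow_self:
  assumes I: "ideal I R" and f: "f \<in> I"
  shows "f [^] n \<in> ideal_pow R I n"
proof (induction n)
  case 0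
  show ?case unfolding ideal_pow_0 by simp
next
  case (Suc n)
  show ?case unfolding ideal_pow_Suc nat_pow_Suc by (rule ideal_prod.prod[OF Suc f])
qed

text \<open>Elements of a product of ideals are sums of products, and \<open>\<phi>\<close> respects
  both; hence an induction over \<open>ideal_prod\<close> inside the one over the exponent.\<close>

lemma ideal_pow_image:
  assumes I: "ideal I R" and h: "\<phi> \<in> ring_hom R R" and \<phi>I: "\<phi> ` I \<subseteq> I" and a: "a \<in> ideal_pow R I n"
  shows "\<phi> a \<in> ideal_pow R I n"
  using a
proof (induction n arbitrary: a)
  case 0
  then show ?case unfolding ideal_pow_0 by (rule ring_hom_closed[OF h])
next
  case (Suc n)
  note In = ideal_pow_ideal[OF I, of n]
  have c: "x \<in> carrier R" if "x \<in> ideal_prod R (ideal_pow R I n) I" for x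
    using ideal_prod_in_carrier[OF In I] that by blast
  have "a \<in> ideal_prod R (ideal_pow R I n) I" using Suc.prems unfolding ideal_pow_Suc .
  then have "\<phi> a \<in> ideal_prod R (ideal_pow R I n) I"
  proof (induction rule: ideal_prod.induct)
    case (prod i j)
    have "\<phi> i \<in> ideal_pow R I n" "\<phi> j \<in> I" using Suc.IH[OF prod(1)] prod(2) \<phi>I by auto
    moreover have "\<phi> (i \<otimes> j) = \<phi> i \<otimes> \<phi> j"
      using ideal.Icarr[OF In prod(1)] ideal.Icarr[OF I prod(2)] by (rule ring_hom_mult[OF h])
    ultimately show ?case using ideal_prod.prod by simp
  next
    case (sum s1 s2)
    have "\<phi> (s1 \<oplus> s2) = \<phi> s1 \<oplus> \<phi> s2"
      using c[OF sum.hyps(1)] c[OF sum.hyps(2)] by (rule ring_hom_add[OF h])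
    then show ?case using ideal_prod.sum[OF sum.IH] by simp
  qed
  then show ?case unfolding ideal_pow_Suc .
qed

lemma ideal_finsum_closed:
  assumes "ideal I R" "finite N" "\<And>i. i \<in> N \<Longrightarrow> g i \<in> I"
  shows "(\<Oplus>i\<in>N. g i) \<in> I"
  using assms(2,3)
proof (induction N)
  case empty
  then show ?case using additive_subgroup.zero_closed[OF ideal.axioms(1)[OF assms(1)]] by simp
next
  case (insert x N)
  have "g x \<in> carrier R" "g \<in> N \<rightarrow> carrier R"
    using insert.prems ideal.Icarr[OF assms(1)] by auto
  then show ?case
    using insert additive_subgroup.a_closed[OF ideal.axioms(1)[OF assms(1)]] by simp
qed

end

section \<open>Coefficients of multiples of \<open>1 - at\<close>\<close>

context UP_cring
begin

lemma coeff_mult_monom_1: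
  assumes q: "q \<in> carrier P" and a: "a \<in> carrier R"
  shows "up_ring.coeff P (q \<otimes>\<^bsub>P\<^esub> up_ring.monom P a 1) 0 = \<zero>"
    and "up_ring.coeff P (q \<otimes>\<^bsub>P\<^esub> up_ring.monom P a 1) (Suc n) = up_ring.coeff P q n \<otimes> a"
proof -
  show "up_ring.coeff P (q \<otimes>\<^bsub>P\<^esub> up_ring.monom P a 1) 0 = \<zero>"
    using q a by (simp del: monom_mult)
  have "up_ring.coeff P (q \<otimes>\<^bsub>P\<^esub> up_ring.monom P a 1) (Suc n) = (\<Oplus>i\<in>{..Suc n}. if n = i then up_ring.coeff P q i \<otimes> a else \<zero>)"
    unfolding coeff_mult[OF q monom_closed[OF a]]
    by (rule R.finsum_cong') (use q a in auto)
  also have "\<dots> = up_ring.coeff P q n \<otimes> a"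
    using q a by (intro R.finsum_singleton) auto
  finally show "up_ring.coeff P (q \<otimes>\<^bsub>P\<^esub> up_ring.monom P a 1) (Suc n) = up_ring.coeff P q n \<otimes> a" .
qed

text \<open>On coefficients, multiplication by \<open>1 - at\<close> is a first-order recursion, so
  equations modulo \<open>1 - at\<close> can be solved degree by degree.\<close>

lemma coeff_mult_one_minus_monom:
  assumes q: "q \<in> carrier P" and a: "a \<in> carrier R"
  shows "up_ring.coeff P (q \<otimes>\<^bsub>P\<^esub> (\<one>\<^bsub>P\<^esub> \<ominus>\<^bsub>P\<^esub> up_ring.monom P a 1)) 0 = up_ring.coeff P q 0"
    and "up_ring.coeff P (q \<otimes>\<^bsub>P\<^esub> (\<one>\<^bsub>P\<^esub> \<ominus>\<^bsub>P\<^esub> up_ring.monom P a 1)) (Suc n) = up_ring.coeff P q (Suc n) \<ominus> up_ring.coeff P q n \<otimes> a"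
proof -
  have m: "up_ring.monom P a 1 \<in> carrier P" using a by simp
  have "q \<otimes>\<^bsub>P\<^esub> (\<one>\<^bsub>P\<^esub> \<ominus>\<^bsub>P\<^esub> up_ring.monom P a 1) = q \<ominus>\<^bsub>P\<^esub> q \<otimes>\<^bsub>P\<^esub> up_ring.monom P a 1"
    using q m by (simp add: a_minus_def P.r_distr P.r_minus)
  moreover have "up_ring.coeff P (q \<ominus>\<^bsub>P\<^esub> r) k = up_ring.coeff P q k \<ominus> up_ring.coeff P r k" if "r \<in> carrier P" for r k
    using q that by (simp add: a_minus_def)
  moreover have "q \<otimes>\<^bsub>P\<^esub> up_ring.monom P a 1 \<in> carrier P" using q m by simp
  ultimately have e: "up_ring.coeff P (q \<otimes>\<^bsub>P\<^esub> (\<one>\<^bsub>P\<^esub> \<ominus>\<^bsub>P\<^esub> up_ring.monom P a 1)) k = up_ring.coeff P q k \<ominus> up_ring.coeff P (q \<otimes>\<^bsub>P\<^esub> up_ring.monom P a 1) k" for k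
    by simp
  show "up_ring.coeff P (q \<otimes>\<^bsub>P\<^esub> (\<one>\<^bsub>P\<^esub> \<ominus>\<^bsub>P\<^esub> up_ring.monom P a 1)) 0 = up_ring.coeff P q 0"
    unfolding e coeff_mult_monom_1(1)[OF q a] using coeff_closed[OF q, of 0] by (simp add: a_minus_def)
  show "up_ring.coeff P (q \<otimes>\<^bsub>P\<^esub> (\<one>\<^bsub>P\<^esub> \<ominus>\<^bsub>P\<^esub> up_ring.monom P a 1)) (Suc n) = up_ring.coeff P q (Suc n) \<ominus> up_ring.coeff P q n \<otimes> a"
    unfolding e coeff_mult_monom_1(2)[OF q a] ..
qed

end

section \<open>The Rees algebra and its quotient by \<open>1 - ft\<close>\<close>

locale modification_data = UP_domain R P for R (structure) and P (structure) +
  fixes I f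
  assumes I: "ideal I R" and f: "f \<in> I" "f \<noteq> \<zero>"
begin

abbreviation "S \<equiv> rees R I"
abbreviation "N \<equiv> modif_ideal R I f"
abbreviation "g \<equiv> \<one>\<^bsub>P\<^esub> \<ominus>\<^bsub>P\<^esub> up_ring.monom P f 1"

lemma f_closed: "f \<in> carrier R"
  by (rule ideal.Icarr[OF I f(1)])

lemma mem_rees: "p \<in> carrier S \<longleftrightarrow> p \<in> carrier P \<and> (\<forall>n. up_ring.coeff P p n \<in> ideal_pow R I n)"
  by (simp add: rees_def P_def)

lemma rees_carrier: "p \<in> carrier S \<Longrightarrow> p \<in> carrier P"
  by (simp add: mem_rees)

lemma pow_carrier: "a \<in> ideal_pow R I n \<Longrightarrow> a \<in> carrier R"
  by (rule ideal.Icarr[OF R.ideal_pow_ideal[OF I]])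

lemma pow_zero: "\<zero> \<in> ideal_pow R I n"
  by (rule additive_subgroup.zero_closed[OF ideal.axioms(1)[OF R.ideal_pow_ideal[OF I]]])

lemma pow_one: "\<one> \<in> ideal_pow R I 0"
  unfolding ideal_pow_0 by (rule R.one_closed)

lemma rees_ops:
  "p \<otimes>\<^bsub>S\<^esub> q = p \<otimes>\<^bsub>P\<^esub> q" "p \<oplus>\<^bsub>S\<^esub> q = p \<oplus>\<^bsub>P\<^esub> q" "\<one>\<^bsub>S\<^esub> = \<one>\<^bsub>P\<^esub>" "\<zero>\<^bsub>S\<^esub> = \<zero>\<^bsub>P\<^esub>"
  by (simp_all add: rees_def P_def)

lemma monom_rees: "a \<in> ideal_pow R I n \<Longrightarrow> up_ring.monom P a n \<in> carrier S"
  using pow_carrier[of a n] pow_zero by (simp add: mem_rees)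

lemma cring_rees: "cring S"
proof -
  let ?H = "{p \<in> carrier P. \<forall>n. up_ring.coeff P p n \<in> ideal_pow R I n}"
  have "subring ?H P"
  proof (rule P.subringI)
    show "?H \<subseteq> carrier P" by blast
    show "\<one>\<^bsub>P\<^esub> \<in> ?H" using monom_rees[OF pow_one] unfolding mem_rees monom_one by blast
    fix p q assume p: "p \<in> ?H" and q: "q \<in> ?H"
    show "\<ominus>\<^bsub>P\<^esub> p \<in> ?H"
      using p additive_subgroup.a_inv_closed[OF ideal.axioms(1)[OF R.ideal_pow_ideal[OF I]]] by simp
    show "p \<oplus>\<^bsub>P\<^esub> q \<in> ?H"
      using p q additive_subgroup.a_closed[OF ideal.axioms(1)[OF R.ideal_pow_ideal[OF I]]] by simp
    \<comment> \<open>The summand with index \<open>i\<close> lies in \<open>I^i I^(n-i)\<close>,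
      which is \<open>I^n\<close>.\<close>
    have "(\<Oplus>i\<in>{..n}. up_ring.coeff P p i \<otimes> up_ring.coeff P q (n - i)) \<in> ideal_pow R I n" for n
    proof (rule R.ideal_finsum_closed[OF R.ideal_pow_ideal[OF I]])
      fix i assume "i \<in> {..n}"
      then have "i + (n - i) = n" by simp
      then show "up_ring.coeff P p i \<otimes> up_ring.coeff P q (n - i) \<in> ideal_pow R I n"
        using R.ideal_pow_mult[OF I, of "up_ring.coeff P p i" i "up_ring.coeff P q (n - i)" "n - i"] p q by simp
    qed simp
    then show "p \<otimes>\<^bsub>P\<^esub> q \<in> ?H" using p q by simp
  qed
  then have "subcring ?H P" by (rule P.subcringI')
  then show ?thesis using P.subcring_iff[of ?H] by (auto simp: rees_def P_def)
qed

lemma g_rees: "g \<in> carrier S"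
proof -
  have fP: "up_ring.monom P f 1 \<in> carrier S"
    using monom_rees[of f 1] R.ideal_pow_self[OF I f(1), of 1] f_closed by simp
  have "up_ring.coeff P g n \<in> ideal_pow R I n" for n
    using additive_subgroup.a_closed[OF ideal.axioms(1)[OF R.ideal_pow_ideal[OF I]], of _ n]
      additive_subgroup.a_inv_closed[OF ideal.axioms(1)[OF R.ideal_pow_ideal[OF I]], of _ n]
      cring.cring_simprules(6)[OF cring_rees] fP f_closed
    by (simp add: a_minus_def mem_rees rees_ops)
  then show ?thesis using f_closed by (simp add: mem_rees)
qed

lemma ideal_N: "ideal N S"
  unfolding modif_ideal_def P_def[symmetric] by (rule cring.cgenideal_ideal[OF cring_rees g_rees])

lemma mem_N: "p \<in> N \<longleftrightarrow> (\<exists>q\<in>carrier S. p = q \<otimes>\<^bsub>P\<^esub> g)"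
  unfolding modif_ideal_def P_def[symmetric] cgenideal_def rees_ops by blast

definition proj where "proj p = N +>\<^bsub>S\<^esub> p"

lemma cring_modif: "cring (modif R I f)"
  unfolding modif_def by (rule ideal.quotient_is_cring[OF ideal_N cring_rees])

lemma proj_hom: "proj \<in> ring_hom S (modif R I f)"
  unfolding modif_def proj_def[abs_def] by (rule ideal.rcos_ring_hom[OF ideal_N])

lemma proj_surj:
  assumes "x \<in> carrier (modif R I f)" obtains p where "p \<in> carrier S" "x = proj p"
proof -
  have "\<exists>p\<in>carrier S. x = N +>\<^bsub>S\<^esub> p"
    using assms by (simp add: modif_def FactRing_def A_RCOSETS_def')
  then show ?thesis using that unfolding proj_def by blast
qed

lemma proj_eq_zero_iff:
  assumes p: "p \<in> carrier S" shows "proj p = \<zero>\<^bsub>modif R I f\<^esub> \<longleftrightarrow> p \<in> N"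
proof -
  interpret S: cring S by (rule cring_rees)
  interpret N: ideal N S by (rule ideal_N)
  show ?thesis
    using N.a_rcos_const[of p] N.a_rcos_self[OF p] by (auto simp: modif_def FactRing_def proj_def)
qed

lemma emb_eq: "modif_emb R I f a = proj (up_ring.monom P a 0)"
  by (simp add: modif_emb_def proj_def P_def)

lemma const_rees: "a \<in> carrier R \<Longrightarrow> up_ring.monom P a 0 \<in> carrier S"
  by (rule monom_rees) (simp only: ideal_pow_0)

lemma emb_hom: "modif_emb R I f \<in> ring_hom R (modif R I f)"
proof (rule ring_hom_memI)
  fix a assume a: "a \<in> carrier R"
  show "modif_emb R I f a \<in> carrier (modif R I f)"
    unfolding emb_eq by (rule ring_hom_closed[OF proj_hom const_rees[OF a]])
  fix b assume b: "b \<in> carrier R"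
  have "up_ring.monom P (a \<otimes> b) 0 = up_ring.monom P a 0 \<otimes>\<^bsub>S\<^esub> up_ring.monom P b 0"
    using monom_mult[OF a b, of 0 0] by (simp add: rees_ops)
  then show "modif_emb R I f (a \<otimes> b) = modif_emb R I f a \<otimes>\<^bsub>modif R I f\<^esub> modif_emb R I f b"
    unfolding emb_eq using ring_hom_mult[OF proj_hom const_rees[OF a] const_rees[OF b]] by simp
  have "up_ring.monom P (a \<oplus> b) 0 = up_ring.monom P a 0 \<oplus>\<^bsub>S\<^esub> up_ring.monom P b 0"
    using monom_add[OF a b, of 0] by (simp add: rees_ops)
  then show "modif_emb R I f (a \<oplus> b) = modif_emb R I f a \<oplus>\<^bsub>modif R I f\<^esub> modif_emb R I f b"
    unfolding emb_eq using ring_hom_add[OF proj_hom const_rees[OF a] const_rees[OF b]] by simp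
next
  show "modif_emb R I f \<one> = \<one>\<^bsub>modif R I f\<^esub>"
    unfolding emb_eq using ring_hom_one[OF proj_hom] by (simp add: rees_ops)
qed

lemma UP_bounded:
  assumes "p \<in> carrier P" obtains d where "\<And>n. d \<le> n \<Longrightarrow> up_ring.coeff P p n = \<zero>"
  using deg_aboveD[OF _ assms] that by (meson Suc_le_eq)

text \<open>In \<open>UP\<close> a polynomial is its coefficient function, so a sequence in the ring
  that is eventually zero is itself the polynomial.\<close>

lemma UP_of_coeff:
  assumes "\<And>n. c n \<in> carrier R" "\<And>n. d \<le> n \<Longrightarrow> c n = \<zero>"
  shows "c \<in> carrier P" "up_ring.coeff P c n = c n"
proof -
  have "c \<in> up R"
  proof (rule mem_upI)
    have "bound \<zero> d c" using assms(2) by (intro bound.intro) simp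
    then show "\<exists>n. bound \<zero> n c" by (rule exI)
  qed (rule assms(1))
  then show "c \<in> carrier P" "up_ring.coeff P c n = c n"
    unfolding P_def UP_def by simp_all
qed

text \<open>A constant in the ideal generated by \<open>1 - ft\<close> is \<open>q (1 - ft)\<close> with \<open>q\<^sub>n = f\<^sup>n q\<^sub>0\<close>, a
  polynomial only if it vanishes.\<close>

lemma emb_eq_zero:
  assumes a: "a \<in> carrier R" and z: "modif_emb R I f a = \<zero>\<^bsub>modif R I f\<^esub>"
  shows "a = \<zero>"
proof -
  have "up_ring.monom P a 0 \<in> N"
    using z proj_eq_zero_iff[OF const_rees[OF a]] by (simp add: emb_eq)
  then obtain q where q: "q \<in> carrier S" "up_ring.monom P a 0 = q \<otimes>\<^bsub>P\<^esub> g"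
    using mem_N by blast
  have qP: "q \<in> carrier P" by (rule rees_carrier[OF q(1)])
  let ?q = "up_ring.coeff P q"
  have c: "?q n \<in> carrier R" for n by (rule coeff_closed[OF qP])
  have 0: "?q 0 = a"
    using coeff_mult_one_minus_monom(1)[OF qP f_closed, folded q(2)] a by simp
  have Suc: "?q (Suc n) = ?q n \<otimes> f" for n
  proof -
    have "?q (Suc n) \<ominus> ?q n \<otimes> f = \<zero>"
      using coeff_mult_one_minus_monom(2)[OF qP f_closed, of n, folded q(2)] a by simp
    then show ?thesis using c f_closed R.r_right_minus_eq by simp
  qed
  have eq: "?q n = a \<otimes> f [^] n" for n
    by (induction n) (simp_all add: 0 Suc a f_closed R.m_assoc)
  obtain d where "?q d = \<zero>" using UP_bounded[OF qP] by (metis order_refl)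
  then have "a \<otimes> f [^] d = \<zero>" using eq by simp
  moreover have "f [^] d \<noteq> \<zero>"
  proof (induction d)
    case (Suc d)
    then show ?case using f(2) f_closed R.integral[of "f [^] d" f] by auto
  qed simp
  ultimately show ?thesis using R.integral[OF _ a, of "f [^] d"] f_closed by auto
qed

lemma inj_emb: "inj_on (modif_emb R I f) (carrier R)"
proof -
  interpret M: cring "modif R I f" by (rule cring_modif)
  interpret h: ring_hom_cring R "modif R I f" "modif_emb R I f" by unfold_locales (rule emb_hom)
  show ?thesis
  proof (rule inj_onI)
    fix a b assume ab: "a \<in> carrier R" "b \<in> carrier R" "modif_emb R I f a = modif_emb R I f b"
    then have "modif_emb R I f (a \<ominus> b) = \<zero>\<^bsub>modif R I f\<^esub>"
      using M.r_neg[OF h.hom_closed[OF ab(2)]] by (simp add: a_minus_def)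
    then have "a \<ominus> b = \<zero>" using ab by (intro emb_eq_zero) simp_all
    then show "a = b" using ab R.r_right_minus_eq by simp
  qed
qed

text \<open>If \<open>f p = q (1 - ft)\<close>, then degree by degree \<open>q = f c\<close>, where
  \<open>c\<close> is the power series \<open>p/(1 - ft)\<close>. As \<open>q\<close> is a
  polynomial and \<open>f\<close> is nonzero in a domain, \<open>c\<close> is a polynomial too. Its
  coefficients lie in the powers of \<open>I\<close>, so \<open>p = c (1 - ft)\<close> holds in the
  Rees algebra and the class of \<open>p\<close> is zero.\<close>

lemma emb_f_cancel:
  assumes x: "x \<in> carrier (modif R I f)" and z: "modif_emb R I f f \<otimes>\<^bsub>modif R I f\<^esub> x = \<zero>\<^bsub>modif R I f\<^esub>"
  shows "x = \<zero>\<^bsub>modif R I f\<^esub>"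
proof -
  obtain p where p: "p \<in> carrier S" "x = proj p" using x by (rule proj_surj)
  have pP: "p \<in> carrier P" by (rule rees_carrier[OF p(1)])
  let ?m = "up_ring.monom P f 0"
  have m: "?m \<in> carrier S" by (rule const_rees[OF f_closed])
  have "proj (?m \<otimes>\<^bsub>S\<^esub> p) = \<zero>\<^bsub>modif R I f\<^esub>"
    using z by (simp add: emb_eq p(2) ring_hom_mult[OF proj_hom m p(1)])
  moreover have "?m \<otimes>\<^bsub>S\<^esub> p \<in> carrier S"
    using cring.cring_simprules(5)[OF cring_rees m p(1)] .
  ultimately have "?m \<otimes>\<^bsub>P\<^esub> p \<in> N" using proj_eq_zero_iff rees_ops(1) by simp
  then obtain q where q: "q \<in> carrier S" "?m \<otimes>\<^bsub>P\<^esub> p = q \<otimes>\<^bsub>P\<^esub> g" using mem_N by blast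
  have qP: "q \<in> carrier P" by (rule rees_carrier[OF q(1)])
  let ?q = "up_ring.coeff P q" and ?p = "up_ring.coeff P p"
  have cq: "?q n \<in> carrier R" and cp: "?p n \<in> carrier R" for n
    by (rule coeff_closed[OF qP], rule coeff_closed[OF pP])
  have fp: "up_ring.coeff P (q \<otimes>\<^bsub>P\<^esub> g) n = f \<otimes> ?p n" for n
    unfolding q(2)[symmetric] using f_closed pP by (simp add: monom_mult_is_smult)
  have q0: "?q 0 = f \<otimes> ?p 0"
    using coeff_mult_one_minus_monom(1)[OF qP f_closed] fp by simp
  have qS: "?q (Suc n) = f \<otimes> ?p (Suc n) \<oplus> f \<otimes> ?q n" for n
  proof -
    have "?q (Suc n) \<ominus> ?q n \<otimes> f = f \<otimes> ?p (Suc n)"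
      using coeff_mult_one_minus_monom(2)[OF qP f_closed, of n] fp[of "Suc n"] by simp
    moreover have "?q (Suc n) = (?q (Suc n) \<ominus> ?q n \<otimes> f) \<oplus> ?q n \<otimes> f"
      using cq[of "Suc n"] cq[of n] f_closed by (simp add: a_minus_def R.a_assoc R.l_neg)
    ultimately show ?thesis using cq[of n] f_closed by (simp add: R.m_comm)
  qed
  \<comment> \<open>The coefficients of \<open>p/(1 - ft)\<close>, read off from the recursion that
    \<open>p = c (1 - ft)\<close> imposes.\<close>
  define c where "c = rec_nat (?p 0) (\<lambda>n x. ?p (Suc n) \<oplus> f \<otimes> x)"
  have c0: "c 0 = ?p 0" and cS: "c (Suc n) = ?p (Suc n) \<oplus> f \<otimes> c n" for n
    by (simp_all add: c_def)
  have cI: "c n \<in> ideal_pow R I n" for n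
  proof (induction n)
    case 0
    show ?case using p(1) unfolding c0 mem_rees by blast
  next
    case (Suc n)
    \<comment> \<open>The factor \<open>f\<close> from \<open>I\<close> makes up for the shift by
      one degree.\<close>
    have "f \<in> ideal_pow R I 1" using R.ideal_pow_self[OF I f(1), of 1] f_closed by simp
    then have "f \<otimes> c n \<in> ideal_pow R I (Suc n)"
      using R.ideal_pow_mult[OF I _ Suc, of f 1] by simp
    moreover have "?p (Suc n) \<in> ideal_pow R I (Suc n)" using p(1) unfolding mem_rees by blast
    ultimately show ?case
      unfolding cS using additive_subgroup.a_closed[OF ideal.axioms(1)[OF R.ideal_pow_ideal[OF I]]] by blast
  qed
  have cR: "c n \<in> carrier R" for n by (rule pow_carrier[OF cI])
  have qc: "?q n = f \<otimes> c n" for n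
  proof (induction n)
    case 0
    show ?case by (simp add: q0 c0)
  next
    case (Suc n)
    show ?case unfolding qS cS Suc using cR[of n] cp[of "Suc n"] f_closed by (simp add: R.r_distr)
  qed
  obtain d where d: "\<And>n. d \<le> n \<Longrightarrow> ?q n = \<zero>" using UP_bounded[OF qP] by blast
  have c_zero: "c n = \<zero>" if "d \<le> n" for n
    using d[OF that] qc[of n] R.integral[OF _ f_closed cR[of n]] f(2) by auto
  have cP: "c \<in> carrier P" and cc: "up_ring.coeff P c n = c n" for n
    using UP_of_coeff[of c d] cR c_zero by auto
  have "p = c \<otimes>\<^bsub>P\<^esub> g"
  proof (rule up_eqI[OF _ pP UP_mult_closed[OF cP rees_carrier[OF g_rees]]])
    fix n show "?p n = up_ring.coeff P (c \<otimes>\<^bsub>P\<^esub> g) n"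
    proof (cases n)
      case 0
      then show ?thesis using coeff_mult_one_minus_monom(1)[OF cP f_closed] by (simp add: cc c0)
    next
      case (Suc m)
      have "(?p (Suc m) \<oplus> f \<otimes> c m) \<ominus> c m \<otimes> f = ?p (Suc m)"
        using cp[of "Suc m"] cR[of m] f_closed by (simp add: a_minus_def R.a_assoc R.m_comm[of "c m" f] R.r_neg)
      then show ?thesis
        using coeff_mult_one_minus_monom(2)[OF cP f_closed, of m] Suc by (simp add: cc cS)
    qed
  qed
  moreover have "c \<in> carrier S" using cP cI by (simp only: mem_rees cc) simp
  ultimately have "p \<in> N" using mem_N by blast
  then show ?thesis using proj_eq_zero_iff[OF p(1)] p(2) by simp
qed

text \<open>Since \<open>1 - ft\<close> is zero in the quotient, \<open>ft\<close> is 1 there, and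
  so is each of its powers \<open>f^n t^n\<close>.\<close>

lemma proj_monom_f: "proj (up_ring.monom P (f [^] n) n) = \<one>\<^bsub>modif R I f\<^esub>"
proof (induction n)
  case 0
  show ?case using ring_hom_one[OF proj_hom] by (simp add: rees_ops)
next
  case (Suc n)
  interpret M: cring "modif R I f" by (rule cring_modif)
  have fn: "up_ring.monom P (f [^] n) n \<in> carrier S" for n
    by (rule monom_rees[OF R.ideal_pow_self[OF I f(1)]])
  have m: "up_ring.monom P f 1 \<in> carrier S" using fn[of 1] f_closed by simp
  have "g \<in> N" using mem_N g_rees cring.cring_simprules(6)[OF cring_rees] rees_carrier[OF g_rees]
    by (auto simp: rees_ops intro!: bexI[of _ "\<one>\<^bsub>P\<^esub>"])
  then have "proj g = \<zero>\<^bsub>modif R I f\<^esub>" using proj_eq_zero_iff[OF g_rees] by simp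
  moreover have "g \<oplus>\<^bsub>S\<^esub> up_ring.monom P f 1 = \<one>\<^bsub>S\<^esub>"
    using rees_carrier[OF m] by (simp add: rees_ops a_minus_def P.a_assoc P.l_neg)
  ultimately have 1: "proj (up_ring.monom P f 1) = \<one>\<^bsub>modif R I f\<^esub>"
    using ring_hom_add[OF proj_hom g_rees m] ring_hom_one[OF proj_hom] ring_hom_closed[OF proj_hom m] by simp
  have "up_ring.monom P (f [^] Suc n) (Suc n) = up_ring.monom P (f [^] n) n \<otimes>\<^bsub>S\<^esub> up_ring.monom P f 1"
    using monom_mult[of "f [^] n" f n 1] f_closed by (simp add: rees_ops)
  then show ?case using ring_hom_mult[OF proj_hom fn m] Suc 1 by simp
qed

text \<open>The class of \<open>a t^n\<close> is the fraction \<open>a/f^n\<close>: its product with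
  \<open>f^n\<close> is \<open>a\<close> times \<open>f^n t^n\<close>, and the latter is 1 in the
  quotient.\<close>

lemma emb_div:
  assumes a: "a \<in> ideal_pow R I n"
  shows "modif_emb R I f (f [^] n) \<otimes>\<^bsub>modif R I f\<^esub> proj (up_ring.monom P a n) = modif_emb R I f a"
proof -
  interpret M: cring "modif R I f" by (rule cring_modif)
  have aR: "a \<in> carrier R" by (rule pow_carrier[OF a])
  have fn: "f [^] n \<in> carrier R" using f_closed by simp
  have fm: "up_ring.monom P (f [^] n) n \<in> carrier S"
    by (rule monom_rees[OF R.ideal_pow_self[OF I f(1)]])
  have "up_ring.monom P (f [^] n) 0 \<otimes>\<^bsub>S\<^esub> up_ring.monom P a n = up_ring.monom P a 0 \<otimes>\<^bsub>S\<^esub> up_ring.monom P (f [^] n) n"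
    using monom_mult[OF fn aR, of 0 n] monom_mult[OF aR fn, of 0 n] R.m_comm[OF aR fn] by (simp add: rees_ops)
  then have "modif_emb R I f (f [^] n) \<otimes>\<^bsub>modif R I f\<^esub> proj (up_ring.monom P a n) =
      modif_emb R I f a \<otimes>\<^bsub>modif R I f\<^esub> proj (up_ring.monom P (f [^] n) n)"
    unfolding emb_eq
    using ring_hom_mult[OF proj_hom const_rees[OF fn] monom_rees[OF a]] ring_hom_mult[OF proj_hom const_rees[OF aR] fm] by simp
  then show ?thesis using ring_hom_closed[OF emb_hom aR] by (simp add: proj_monom_f)
qed

text \<open>Induction on a strict bound for the degree, splitting off the top term. If
  \<open>f^k\<close> clears the lower part and \<open>f^d\<close> the top term, then
  \<open>f^(k+d)\<close> clears both, and the common numerator \<open>f^d a + f^k p_d\<close> lies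
  in \<open>I^(k+d)\<close>.\<close>

lemma emb_frac_truncated:
  assumes "p \<in> carrier S" "\<And>n. d \<le> n \<Longrightarrow> up_ring.coeff P p n = \<zero>"
  shows "\<exists>k. \<exists>a\<in>ideal_pow R I k. modif_emb R I f (f [^] k) \<otimes>\<^bsub>modif R I f\<^esub> proj p = modif_emb R I f a"
  using assms
proof (induction d arbitrary: p)
  case 0
  interpret M: cring "modif R I f" by (rule cring_modif)
  have "p = \<zero>\<^bsub>P\<^esub>" using 0 rees_carrier by (intro up_eqI) simp_all
  then have "p = up_ring.monom P \<zero> 0" by simp
  then have "proj p = modif_emb R I f \<zero>" by (simp add: emb_eq)
  then have "modif_emb R I f (f [^] (0::nat)) \<otimes>\<^bsub>modif R I f\<^esub> proj p = modif_emb R I f \<zero>"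
    using ring_hom_one[OF emb_hom] ring_hom_closed[OF emb_hom R.zero_closed] by simp
  then show ?case using pow_zero by blast
next
  case (Suc d)
  interpret M: cring "modif R I f" by (rule cring_modif)
  have pP: "p \<in> carrier P" by (rule rees_carrier[OF Suc.prems(1)])
  \<comment> \<open>The truncation below degree \<open>d\<close> stays in the Rees algebra because 0
    lies in every power of \<open>I\<close>.\<close>
  let ?c = "\<lambda>n. if n < d then up_ring.coeff P p n else \<zero>"
  have c: "?c \<in> carrier P" "up_ring.coeff P ?c n = ?c n" for n
    using UP_of_coeff[of ?c d] coeff_closed[OF pP] by auto
  have cS: "?c \<in> carrier S"
    using c(1) Suc.prems(1) pow_zero by (simp only: mem_rees c(2)) simp
  have pd: "up_ring.coeff P p d \<in> ideal_pow R I d" using Suc.prems(1) unfolding mem_rees by blast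
  let ?m = "up_ring.monom P (up_ring.coeff P p d) d"
  have mS: "?m \<in> carrier S" by (rule monom_rees[OF pd])
  have "p = ?c \<oplus>\<^bsub>P\<^esub> ?m"
  proof (rule up_eqI[OF _ pP UP_a_closed[OF c(1) rees_carrier[OF mS]]])
    fix n show "up_ring.coeff P p n = up_ring.coeff P (?c \<oplus>\<^bsub>P\<^esub> ?m) n"
      using coeff_add[OF c(1) rees_carrier[OF mS], of n] coeff_closed[OF pP] Suc.prems(2)[of n]
      by (cases "n < d"; cases "n = d") (simp_all add: c(2))
  qed
  then have pS: "proj p = proj ?c \<oplus>\<^bsub>modif R I f\<^esub> proj ?m"
    using ring_hom_add[OF proj_hom cS mS] by (simp add: rees_ops)
  obtain k a where ka: "a \<in> ideal_pow R I k" "modif_emb R I f (f [^] k) \<otimes>\<^bsub>modif R I f\<^esub> proj ?c = modif_emb R I f a"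
    using Suc.IH[OF cS] c(2) by auto
  have cl: "modif_emb R I f b \<in> carrier (modif R I f)" if "b \<in> carrier R" for b
    using ring_hom_closed[OF emb_hom that] .
  have pc: "proj ?c \<in> carrier (modif R I f)" "proj ?m \<in> carrier (modif R I f)"
    using ring_hom_closed[OF proj_hom] cS mS by auto
  have fk: "f [^] k \<in> carrier R" "f [^] d \<in> carrier R" using f_closed by auto
  let ?e = "modif_emb R I f"
  have aR: "a \<in> carrier R" "up_ring.coeff P p d \<in> carrier R" using pow_carrier[OF ka(1)] pow_carrier[OF pd] by auto
  have "?e (f [^] (k + d)) \<otimes>\<^bsub>modif R I f\<^esub> proj p =
      ?e (f [^] d) \<otimes>\<^bsub>modif R I f\<^esub> (?e (f [^] k) \<otimes>\<^bsub>modif R I f\<^esub> proj ?c) \<oplus>\<^bsub>modif R I f\<^esub>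
      ?e (f [^] k) \<otimes>\<^bsub>modif R I f\<^esub> (?e (f [^] d) \<otimes>\<^bsub>modif R I f\<^esub> proj ?m)"
    using pc cl[OF fk(1)] cl[OF fk(2)] f_closed
    by (simp add: pS R.nat_pow_mult[symmetric] ring_hom_mult[OF emb_hom] M.r_distr M.m_ac)
  also have "\<dots> = ?e (f [^] d \<otimes> a \<oplus> f [^] k \<otimes> up_ring.coeff P p d)"
    using aR fk by (simp add: ka(2) emb_div[OF pd] ring_hom_mult[OF emb_hom] ring_hom_add[OF emb_hom])
  finally have "?e (f [^] (k + d)) \<otimes>\<^bsub>modif R I f\<^esub> proj p = ?e (f [^] d \<otimes> a \<oplus> f [^] k \<otimes> up_ring.coeff P p d)" .
  moreover have "f [^] d \<otimes> a \<in> ideal_pow R I (k + d)" "f [^] k \<otimes> up_ring.coeff P p d \<in> ideal_pow R I (k + d)"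
    using R.ideal_pow_mult[OF I R.ideal_pow_self[OF I f(1), of d] ka(1)] R.ideal_pow_mult[OF I R.ideal_pow_self[OF I f(1), of k] pd]
    by (simp_all add: add.commute)
  ultimately show ?case
    using additive_subgroup.a_closed[OF ideal.axioms(1)[OF R.ideal_pow_ideal[OF I]]] by blast
qed

end

section \<open>Extension of automorphisms\<close>

text \<open>The abstract form of \<open>A[I/f]\<close>: \<open>frac\<close> says that every element
  of \<open>B\<close> is a fraction \<open>a/f^k\<close> with \<open>a\<close> in
  \<open>I^k\<close>, \<open>div\<close> that all such fractions occur, and \<open>f_cancel\<close>
  that they are determined by numerator and exponent. Once \<open>modif\<close> is shown to be an
  instance, polynomials no longer appear.\<close>

locale affine_modification = A: domain A + B: cring B
  for A :: "('a, 'm) ring_scheme" and B :: "('b, 'n) ring_scheme" +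
  fixes \<iota> :: "'a \<Rightarrow> 'b" and I :: "'a set" and f :: 'a
  assumes hom: "\<iota> \<in> ring_hom A B" and inj: "inj_on \<iota> (carrier A)"
    and I: "ideal I A" and f: "f \<in> I" "f \<noteq> \<zero>\<^bsub>A\<^esub>"
    and f_cancel: "x \<in> carrier B \<Longrightarrow> \<iota> f \<otimes>\<^bsub>B\<^esub> x = \<zero>\<^bsub>B\<^esub> \<Longrightarrow> x = \<zero>\<^bsub>B\<^esub>"
    and frac: "x \<in> carrier B \<Longrightarrow> \<exists>k. \<exists>a\<in>ideal_pow A I k. \<iota> (f [^]\<^bsub>A\<^esub> k) \<otimes>\<^bsub>B\<^esub> x = \<iota> a"
    and div: "a \<in> ideal_pow A I k \<Longrightarrow> \<exists>x\<in>carrier B. \<iota> (f [^]\<^bsub>A\<^esub> k) \<otimes>\<^bsub>B\<^esub> x = \<iota> a"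

lemma affine_modification_modif:
  assumes "domain A" "ideal I A" "f \<in> I" "f \<noteq> \<zero>\<^bsub>A\<^esub>"
  shows "affine_modification A (modif A I f) (modif_emb A I f) I f"
proof -
  interpret A: domain A by fact
  interpret M: modification_data A "UP A" I f
    by (intro modification_data.intro UP_domain.intro modification_data_axioms.intro assms) simp
  interpret B: cring "modif A I f" by (rule M.cring_modif)
  show ?thesis
  proof (intro affine_modification.intro affine_modification_axioms.intro assms A.domain_axioms M.cring_modif M.emb_hom M.inj_emb)
    fix x assume x: "x \<in> carrier (modif A I f)"
    show "modif_emb A I f f \<otimes>\<^bsub>modif A I f\<^esub> x = \<zero>\<^bsub>modif A I f\<^esub> \<Longrightarrow> x = \<zero>\<^bsub>modif A I f\<^esub>"
      by (rule M.emb_f_cancel[OF x])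
    obtain p where p: "p \<in> carrier (rees A I)" "x = M.proj p" using x by (rule M.proj_surj)
    obtain d where d: "\<And>n. d \<le> n \<Longrightarrow> up_ring.coeff (UP A) p n = \<zero>\<^bsub>A\<^esub>"
      using M.UP_bounded[OF M.rees_carrier[OF p(1)]] by blast
    show "\<exists>k. \<exists>a\<in>ideal_pow A I k. modif_emb A I f (f [^]\<^bsub>A\<^esub> k) \<otimes>\<^bsub>modif A I f\<^esub> x = modif_emb A I f a"
      unfolding p(2) by (rule M.emb_frac_truncated[OF p(1) d])
  next
    fix a k assume a: "a \<in> ideal_pow A I k"
    show "\<exists>x\<in>carrier (modif A I f). modif_emb A I f (f [^]\<^bsub>A\<^esub> k) \<otimes>\<^bsub>modif A I f\<^esub> x = modif_emb A I f a"
      using M.emb_div[OF a] ring_hom_closed[OF M.proj_hom M.monom_rees[OF a]] by (rule bexI)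
  qed
qed

section \<open>Arithmetic of fractions and extension of endomorphisms\<close>

context affine_modification
begin

lemma f_closed: "f \<in> carrier A"
  by (rule ideal.Icarr[OF I f(1)])

lemma pow_closed: "f [^]\<^bsub>A\<^esub> (n::nat) \<in> carrier A"
  using f_closed by simp

lemma pow_nonzero: "c \<in> carrier A \<Longrightarrow> c \<noteq> \<zero>\<^bsub>A\<^esub> \<Longrightarrow> c [^]\<^bsub>A\<^esub> (n::nat) \<noteq> \<zero>\<^bsub>A\<^esub>"
proof (induction n)
  case (Suc n)
  then show ?case using A.integral[of "c [^]\<^bsub>A\<^esub> n" c] by auto
qed simp

lemma pow_carrier: "a \<in> ideal_pow A I n \<Longrightarrow> a \<in> carrier A"
  by (rule ideal.Icarr[OF A.ideal_pow_ideal[OF I]])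

lemmas \<iota>_closed = ring_hom_closed[OF hom]
  and \<iota>_mult = ring_hom_mult[OF hom]
  and \<iota>_add = ring_hom_add[OF hom]
  and \<iota>_one = ring_hom_one[OF hom]
  and \<iota>_zero = ring_hom_zero[OF hom A.ring_axioms B.ring_axioms]

lemma \<iota>_eq: "a \<in> carrier A \<Longrightarrow> b \<in> carrier A \<Longrightarrow> \<iota> a = \<iota> b \<Longrightarrow> a = b"
  using inj by (simp add: inj_on_def)

lemma frac_carrier:
  assumes "x \<in> carrier B"
  obtains k a where "a \<in> ideal_pow A I k" "a \<in> carrier A" "\<iota> (f [^]\<^bsub>A\<^esub> k) \<otimes>\<^bsub>B\<^esub> x = \<iota> a"
proof -
  obtain k a where "a \<in> ideal_pow A I k" "\<iota> (f [^]\<^bsub>A\<^esub> k) \<otimes>\<^bsub>B\<^esub> x = \<iota> a"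
    using frac[OF assms] by (elim exE bexE)
  then show ?thesis using that pow_carrier by simp
qed

lemma pow_f_cancel:
  assumes "x \<in> carrier B" "\<iota> (f [^]\<^bsub>A\<^esub> (k::nat)) \<otimes>\<^bsub>B\<^esub> x = \<zero>\<^bsub>B\<^esub>"
  shows "x = \<zero>\<^bsub>B\<^esub>"
  using assms
proof (induction k arbitrary: x)
  case 0
  then show ?case by (simp add: \<iota>_one)
next
  case (Suc k)
  have c: "\<iota> f \<in> carrier B" "\<iota> (f [^]\<^bsub>A\<^esub> k) \<in> carrier B" using \<iota>_closed f_closed by simp_all
  have "\<iota> (f [^]\<^bsub>A\<^esub> k) \<otimes>\<^bsub>B\<^esub> (\<iota> f \<otimes>\<^bsub>B\<^esub> x) = \<zero>\<^bsub>B\<^esub>"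
    using Suc.prems c f_closed by (simp add: \<iota>_mult B.m_assoc)
  then have "\<iota> f \<otimes>\<^bsub>B\<^esub> x = \<zero>\<^bsub>B\<^esub>" using Suc.IH c(1) Suc.prems(1) by simp
  then show ?case by (rule f_cancel[OF Suc.prems(1)])
qed

text \<open>The multipliers \<open>u\<close> and \<open>v\<close> are arbitrary because they are
  taken to be powers of \<open>f\<close> in some places and powers of \<open>\<phi> f\<close> in the
  construction of an extension.\<close>

lemma frac_mult:
  assumes "x \<in> carrier B" "y \<in> carrier B" "a \<in> carrier A" "b \<in> carrier A"
    and "u \<in> carrier A" "v \<in> carrier A"
    and "\<iota> u \<otimes>\<^bsub>B\<^esub> x = \<iota> a" "\<iota> v \<otimes>\<^bsub>B\<^esub> y = \<iota> b"
  shows "\<iota> (u \<otimes>\<^bsub>A\<^esub> v) \<otimes>\<^bsub>B\<^esub> (x \<otimes>\<^bsub>B\<^esub> y) = \<iota> (a \<otimes>\<^bsub>A\<^esub> b)"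
proof -
  have "\<iota> (u \<otimes>\<^bsub>A\<^esub> v) \<otimes>\<^bsub>B\<^esub> (x \<otimes>\<^bsub>B\<^esub> y) = (\<iota> u \<otimes>\<^bsub>B\<^esub> x) \<otimes>\<^bsub>B\<^esub> (\<iota> v \<otimes>\<^bsub>B\<^esub> y)"
    using assms(1-6) by (simp add: \<iota>_mult \<iota>_closed B.m_ac)
  then show ?thesis using assms by (simp add: \<iota>_mult)
qed

lemma frac_add:
  assumes "x \<in> carrier B" "y \<in> carrier B" "a \<in> carrier A" "b \<in> carrier A"
    and "u \<in> carrier A" "v \<in> carrier A"
    and "\<iota> u \<otimes>\<^bsub>B\<^esub> x = \<iota> a" "\<iota> v \<otimes>\<^bsub>B\<^esub> y = \<iota> b"
  shows "\<iota> (u \<otimes>\<^bsub>A\<^esub> v) \<otimes>\<^bsub>B\<^esub> (x \<oplus>\<^bsub>B\<^esub> y) = \<iota> (v \<otimes>\<^bsub>A\<^esub> a \<oplus>\<^bsub>A\<^esub> u \<otimes>\<^bsub>A\<^esub> b)"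
proof -
  have "\<iota> (u \<otimes>\<^bsub>A\<^esub> v) \<otimes>\<^bsub>B\<^esub> (x \<oplus>\<^bsub>B\<^esub> y) = \<iota> v \<otimes>\<^bsub>B\<^esub> (\<iota> u \<otimes>\<^bsub>B\<^esub> x) \<oplus>\<^bsub>B\<^esub> \<iota> u \<otimes>\<^bsub>B\<^esub> (\<iota> v \<otimes>\<^bsub>B\<^esub> y)"
    using assms(1-6) by (simp add: \<iota>_mult \<iota>_closed B.m_ac B.r_distr)
  then show ?thesis using assms by (simp add: \<iota>_mult \<iota>_add)
qed

lemma frac_eq_zero:
  assumes x: "x \<in> carrier B" and a: "\<iota> (f [^]\<^bsub>A\<^esub> (k::nat)) \<otimes>\<^bsub>B\<^esub> x = \<iota> \<zero>\<^bsub>A\<^esub>"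
  shows "x = \<zero>\<^bsub>B\<^esub>"
  using pow_f_cancel[OF x] a \<iota>_zero by simp

text \<open>Clearing denominators turns a product \<open>x y = 0\<close> into \<open>a b = 0\<close>
  in the domain \<open>A\<close>, and an element of \<open>B\<close> with numerator 0 is 0.\<close>

lemma domain_B: "domain B"
proof (rule domain.intro[OF B.cring_axioms domain_axioms.intro])
  show "\<one>\<^bsub>B\<^esub> \<noteq> \<zero>\<^bsub>B\<^esub>"
    using \<iota>_eq[of "\<one>\<^bsub>A\<^esub>" "\<zero>\<^bsub>A\<^esub>"] A.one_not_zero by (auto simp: \<iota>_one \<iota>_zero)
  fix x y assume xy: "x \<otimes>\<^bsub>B\<^esub> y = \<zero>\<^bsub>B\<^esub>" and x: "x \<in> carrier B" and y: "y \<in> carrier B"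
  obtain k a where a: "a \<in> ideal_pow A I k" "a \<in> carrier A" "\<iota> (f [^]\<^bsub>A\<^esub> k) \<otimes>\<^bsub>B\<^esub> x = \<iota> a"
    using x by (rule frac_carrier)
  obtain m b where b: "b \<in> ideal_pow A I m" "b \<in> carrier A" "\<iota> (f [^]\<^bsub>A\<^esub> m) \<otimes>\<^bsub>B\<^esub> y = \<iota> b"
    using y by (rule frac_carrier)
  have "\<iota> (a \<otimes>\<^bsub>A\<^esub> b) = \<iota> \<zero>\<^bsub>A\<^esub>"
    using frac_mult[OF x y a(2) b(2) pow_closed pow_closed a(3) b(3)] xy
      \<iota>_closed[OF A.m_closed[OF pow_closed[of k] pow_closed[of m]]] by (simp add: \<iota>_zero)
  then have "a \<otimes>\<^bsub>A\<^esub> b = \<zero>\<^bsub>A\<^esub>" using a(2) b(2) by (intro \<iota>_eq) simp_all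
  then have "a = \<zero>\<^bsub>A\<^esub> \<or> b = \<zero>\<^bsub>A\<^esub>" using A.integral a(2) b(2) by blast
  then show "x = \<zero>\<^bsub>B\<^esub> \<or> y = \<zero>\<^bsub>B\<^esub>"
    using frac_eq_zero[OF x, of k] frac_eq_zero[OF y, of m] a(3) b(3) by auto
qed

sublocale B: domain B by (rule domain_B)

lemma \<iota>_cancel:
  assumes "c \<in> carrier A" "c \<noteq> \<zero>\<^bsub>A\<^esub>" "x \<in> carrier B" "y \<in> carrier B" "\<iota> c \<otimes>\<^bsub>B\<^esub> x = \<iota> c \<otimes>\<^bsub>B\<^esub> y"
  shows "x = y"
proof -
  have "\<iota> c \<noteq> \<zero>\<^bsub>B\<^esub>" using assms(1,2) \<iota>_eq[of c "\<zero>\<^bsub>A\<^esub>"] \<iota>_zero by auto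
  then show ?thesis using B.m_lcancel[of "\<iota> c" x y] \<iota>_closed assms by simp
qed

lemma hom_pow_nonzero:
  assumes \<phi>: "\<phi> \<in> ring_hom A A" and \<phi>f: "\<phi> f \<noteq> \<zero>\<^bsub>A\<^esub>"
  shows "\<phi> (f [^]\<^bsub>A\<^esub> (k::nat)) \<noteq> \<zero>\<^bsub>A\<^esub>"
proof -
  interpret h: ring_hom_cring A A \<phi> by unfold_locales (rule \<phi>)
  have "\<phi> (f [^]\<^bsub>A\<^esub> k) = \<phi> f [^]\<^bsub>A\<^esub> k" using f_closed by (induction k) simp_all
  then show ?thesis using pow_nonzero[OF ring_hom_closed[OF \<phi> f_closed] \<phi>f] by simp
qed

text \<open>Stated for homomorphisms, so that it also identifies the composite of two extensions
  with the identity, by taking \<open>\<phi>\<close> to be \<open>id\<close>.\<close>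

lemma ext_unique:
  assumes \<theta>: "\<theta> \<in> ring_hom B B" and \<theta>': "\<theta>' \<in> ring_hom B B" and \<phi>: "\<phi> \<in> ring_hom A A"
    and \<phi>f: "\<phi> f \<noteq> \<zero>\<^bsub>A\<^esub>"
    and e: "\<And>a. a \<in> carrier A \<Longrightarrow> \<theta> (\<iota> a) = \<iota> (\<phi> a)" and e': "\<And>a. a \<in> carrier A \<Longrightarrow> \<theta>' (\<iota> a) = \<iota> (\<phi> a)"
    and x: "x \<in> carrier B"
  shows "\<theta> x = \<theta>' x"
proof -
  obtain k a where a: "a \<in> ideal_pow A I k" "a \<in> carrier A" "\<iota> (f [^]\<^bsub>A\<^esub> k) \<otimes>\<^bsub>B\<^esub> x = \<iota> a"
    using x by (rule frac_carrier)
  have "\<iota> (\<phi> (f [^]\<^bsub>A\<^esub> k)) \<otimes>\<^bsub>B\<^esub> \<theta> x = \<theta> (\<iota> (f [^]\<^bsub>A\<^esub> k) \<otimes>\<^bsub>B\<^esub> x)"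
    using ring_hom_mult[OF \<theta> \<iota>_closed[OF pow_closed] x] e[OF pow_closed] by simp
  moreover have "\<iota> (\<phi> (f [^]\<^bsub>A\<^esub> k)) \<otimes>\<^bsub>B\<^esub> \<theta>' x = \<theta>' (\<iota> (f [^]\<^bsub>A\<^esub> k) \<otimes>\<^bsub>B\<^esub> x)"
    using ring_hom_mult[OF \<theta>' \<iota>_closed[OF pow_closed] x] e'[OF pow_closed] by simp
  ultimately have "\<iota> (\<phi> (f [^]\<^bsub>A\<^esub> k)) \<otimes>\<^bsub>B\<^esub> \<theta> x = \<iota> (\<phi> (f [^]\<^bsub>A\<^esub> k)) \<otimes>\<^bsub>B\<^esub> \<theta>' x"
    using e[OF a(2)] e'[OF a(2)] a(3) by simp
  moreover have "\<phi> (f [^]\<^bsub>A\<^esub> k) \<noteq> \<zero>\<^bsub>A\<^esub>" by (rule hom_pow_nonzero[OF \<phi> \<phi>f])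
  ultimately show ?thesis
    using \<iota>_cancel[OF ring_hom_closed[OF \<phi> pow_closed] _ ring_hom_closed[OF \<theta> x] ring_hom_closed[OF \<theta>' x]] by blast
qed

text \<open>An element of \<open>B\<close> has many numerators and exponents, so the extension is
  introduced as a relation that is shown to be total, single valued and compatible with the
  operations.\<close>

lemma ext_exists:
  assumes \<phi>: "\<phi> \<in> ring_hom A A" and \<phi>I: "\<phi> ` I \<subseteq> I" and \<alpha>: "\<alpha> \<in> Units A" and \<phi>f: "\<phi> f = \<alpha> \<otimes>\<^bsub>A\<^esub> f"
  obtains \<theta> where "\<theta> \<in> ring_hom B B" "\<And>a. a \<in> carrier A \<Longrightarrow> \<theta> (\<iota> a) = \<iota> (\<phi> a)"
proof -
  interpret h: ring_hom_cring A A \<phi> by unfold_locales (rule \<phi>)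
  have \<alpha>c: "\<alpha> \<in> carrier A" by (rule A.Units_closed[OF \<alpha>])
  have hpow: "\<phi> (f [^]\<^bsub>A\<^esub> k) = \<phi> f [^]\<^bsub>A\<^esub> k" for k :: nat using f_closed by (induction k) simp_all
  have \<phi>fc: "\<phi> f \<in> carrier A" using f_closed by simp
  have nz: "\<phi> f \<noteq> \<zero>\<^bsub>A\<^esub>"
  proof
    assume "\<phi> f = \<zero>\<^bsub>A\<^esub>"
    then have "inv\<^bsub>A\<^esub> \<alpha> \<otimes>\<^bsub>A\<^esub> (\<alpha> \<otimes>\<^bsub>A\<^esub> f) = \<zero>\<^bsub>A\<^esub>" using \<alpha> \<phi>f by simp
    then show False using f(2) f_closed \<alpha> \<alpha>c by (simp add: A.m_assoc[symmetric])
  qed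
  \<comment> \<open>\<open>rel x y\<close> says that \<open>y\<close> is
    \<open>\<phi>(a)/\<phi>(f)^k\<close> for some representation of \<open>x\<close> as
    \<open>a/f^k\<close>. Here \<open>a\<close> ranges over all of \<open>A\<close>, so that
    representations can be added and multiplied without tracking powers of \<open>I\<close>.\<close>
  define rel where "rel x y \<longleftrightarrow> x \<in> carrier B \<and> y \<in> carrier B \<and>
    (\<exists>k. \<exists>a\<in>carrier A. \<iota> (f [^]\<^bsub>A\<^esub> (k::nat)) \<otimes>\<^bsub>B\<^esub> x = \<iota> a \<and> \<iota> (\<phi> f [^]\<^bsub>A\<^esub> k) \<otimes>\<^bsub>B\<^esub> y = \<iota> (\<phi> a))" for x y
  have pc: "f [^]\<^bsub>A\<^esub> (k::nat) \<in> carrier A" "\<phi> f [^]\<^bsub>A\<^esub> (k::nat) \<in> carrier A" for k using f_closed by simp_all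
  have relI: "rel x y" if "x \<in> carrier B" "y \<in> carrier B" "a \<in> carrier A"
    "\<iota> (f [^]\<^bsub>A\<^esub> (k::nat)) \<otimes>\<^bsub>B\<^esub> x = \<iota> a" "\<iota> (\<phi> f [^]\<^bsub>A\<^esub> k) \<otimes>\<^bsub>B\<^esub> y = \<iota> (\<phi> a)" for x y a k
    using that unfolding rel_def by blast
  have relE: "\<exists>k a. x \<in> carrier B \<and> y \<in> carrier B \<and> a \<in> carrier A \<and>
    \<iota> (f [^]\<^bsub>A\<^esub> (k::nat)) \<otimes>\<^bsub>B\<^esub> x = \<iota> a \<and> \<iota> (\<phi> f [^]\<^bsub>A\<^esub> k) \<otimes>\<^bsub>B\<^esub> y = \<iota> (\<phi> a)" if "rel x y" for x y
    using that unfolding rel_def by blast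
  have ex: "\<exists>y. rel x y" if x: "x \<in> carrier B" for x
  proof -
    obtain k a where a: "a \<in> ideal_pow A I k" "a \<in> carrier A" "\<iota> (f [^]\<^bsub>A\<^esub> k) \<otimes>\<^bsub>B\<^esub> x = \<iota> a"
      using x by (rule frac_carrier)
    \<comment> \<open>Since \<open>\<phi>(f)^k = \<alpha>^k f^k\<close>, the wanted element is
      \<open>\<alpha>^(-k) \<phi>(a)/f^k\<close>. Its numerator lies in \<open>I^k\<close>, so
      \<open>div\<close> provides it.\<close>
    let ?b = "inv\<^bsub>A\<^esub> \<alpha> [^]\<^bsub>A\<^esub> k \<otimes>\<^bsub>A\<^esub> \<phi> a"
    have ic: "inv\<^bsub>A\<^esub> \<alpha> [^]\<^bsub>A\<^esub> k \<in> carrier A" "\<alpha> [^]\<^bsub>A\<^esub> k \<in> carrier A" using \<alpha>c A.Units_inv_closed[OF \<alpha>] by simp_all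
    have "\<phi> a \<in> ideal_pow A I k" by (rule A.ideal_pow_image[OF I \<phi> \<phi>I a(1)])
    then have "?b \<in> ideal_pow A I k" by (rule ideal.I_l_closed[OF A.ideal_pow_ideal[OF I] _ ic(1)])
    then obtain y where y: "y \<in> carrier B" "\<iota> (f [^]\<^bsub>A\<^esub> k) \<otimes>\<^bsub>B\<^esub> y = \<iota> ?b" using div by blast
    have "\<alpha> [^]\<^bsub>A\<^esub> k \<otimes>\<^bsub>A\<^esub> inv\<^bsub>A\<^esub> \<alpha> [^]\<^bsub>A\<^esub> k = \<one>\<^bsub>A\<^esub>"
      using \<alpha>c A.Units_inv_closed[OF \<alpha>] A.Units_r_inv[OF \<alpha>] by (simp add: A.nat_pow_distrib[symmetric])
    then have b: "\<alpha> [^]\<^bsub>A\<^esub> k \<otimes>\<^bsub>A\<^esub> ?b = \<phi> a" using ic a(2) by (simp add: A.m_assoc[symmetric])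
    have "\<iota> (\<phi> f [^]\<^bsub>A\<^esub> k) \<otimes>\<^bsub>B\<^esub> y = \<iota> (\<alpha> [^]\<^bsub>A\<^esub> k) \<otimes>\<^bsub>B\<^esub> (\<iota> (f [^]\<^bsub>A\<^esub> k) \<otimes>\<^bsub>B\<^esub> y)"
      using \<alpha>c f_closed y(1) ic by (simp add: \<phi>f A.nat_pow_distrib \<iota>_mult \<iota>_closed B.m_assoc)
    also have "\<dots> = \<iota> (\<alpha> [^]\<^bsub>A\<^esub> k \<otimes>\<^bsub>A\<^esub> ?b)" using y(2) ic a(2) by (simp add: \<iota>_mult)
    finally have "\<iota> (\<phi> f [^]\<^bsub>A\<^esub> k) \<otimes>\<^bsub>B\<^esub> y = \<iota> (\<phi> a)" unfolding b .
    then show ?thesis using relI[OF x y(1) a(2,3)] by blast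
  qed
  have unique: "y = z" if y: "rel x y" and z: "rel x z" for x y z
  proof -
    obtain k a where a: "x \<in> carrier B" "y \<in> carrier B" "a \<in> carrier A"
      "\<iota> (f [^]\<^bsub>A\<^esub> (k::nat)) \<otimes>\<^bsub>B\<^esub> x = \<iota> a" "\<iota> (\<phi> f [^]\<^bsub>A\<^esub> k) \<otimes>\<^bsub>B\<^esub> y = \<iota> (\<phi> a)" using relE[OF y] by blast
    obtain m b where b: "z \<in> carrier B" "b \<in> carrier A"
      "\<iota> (f [^]\<^bsub>A\<^esub> (m::nat)) \<otimes>\<^bsub>B\<^esub> x = \<iota> b" "\<iota> (\<phi> f [^]\<^bsub>A\<^esub> m) \<otimes>\<^bsub>B\<^esub> z = \<iota> (\<phi> b)" using relE[OF z] by blast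
    have "\<iota> (f [^]\<^bsub>A\<^esub> m \<otimes>\<^bsub>A\<^esub> a) = \<iota> (f [^]\<^bsub>A\<^esub> m) \<otimes>\<^bsub>B\<^esub> (\<iota> (f [^]\<^bsub>A\<^esub> k) \<otimes>\<^bsub>B\<^esub> x)"
      using a(3,4) pc by (simp add: \<iota>_mult)
    also have "\<dots> = \<iota> (f [^]\<^bsub>A\<^esub> k) \<otimes>\<^bsub>B\<^esub> (\<iota> (f [^]\<^bsub>A\<^esub> m) \<otimes>\<^bsub>B\<^esub> x)"
      by (intro B.m_lcomm \<iota>_closed pc a(1))
    also have "\<dots> = \<iota> (f [^]\<^bsub>A\<^esub> k \<otimes>\<^bsub>A\<^esub> b)" using b(2,3) pc by (simp add: \<iota>_mult)
    finally have "f [^]\<^bsub>A\<^esub> m \<otimes>\<^bsub>A\<^esub> a = f [^]\<^bsub>A\<^esub> k \<otimes>\<^bsub>A\<^esub> b"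
      by (rule \<iota>_eq[rotated 2]) (simp_all add: pc a(3) b(2))
    then have "\<phi> (f [^]\<^bsub>A\<^esub> m \<otimes>\<^bsub>A\<^esub> a) = \<phi> (f [^]\<^bsub>A\<^esub> k \<otimes>\<^bsub>A\<^esub> b)" by simp
    then have e: "\<phi> f [^]\<^bsub>A\<^esub> m \<otimes>\<^bsub>A\<^esub> \<phi> a = \<phi> f [^]\<^bsub>A\<^esub> k \<otimes>\<^bsub>A\<^esub> \<phi> b"
      using a(3) b(2) pc by (simp add: hpow)
    \<comment> \<open>Both candidates are multiplied by \<open>\<phi>(f)^(m+k)\<close>, which is
      nonzero and can be cancelled.\<close>
    have "\<iota> (\<phi> f [^]\<^bsub>A\<^esub> m \<otimes>\<^bsub>A\<^esub> \<phi> f [^]\<^bsub>A\<^esub> k) \<otimes>\<^bsub>B\<^esub> y = \<iota> (\<phi> f [^]\<^bsub>A\<^esub> m \<otimes>\<^bsub>A\<^esub> \<phi> a)"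
      using a(2,3,5) pc by (simp add: \<iota>_mult \<iota>_closed B.m_assoc)
    also have "\<dots> = \<iota> (\<phi> f [^]\<^bsub>A\<^esub> k) \<otimes>\<^bsub>B\<^esub> (\<iota> (\<phi> f [^]\<^bsub>A\<^esub> m) \<otimes>\<^bsub>B\<^esub> z)"
      using b(2,4) pc by (simp add: e \<iota>_mult)
    also have "\<dots> = \<iota> (\<phi> f [^]\<^bsub>A\<^esub> m \<otimes>\<^bsub>A\<^esub> \<phi> f [^]\<^bsub>A\<^esub> k) \<otimes>\<^bsub>B\<^esub> z"
      using b(1) pc by (simp add: \<iota>_mult \<iota>_closed B.m_ac)
    finally show "y = z"
      using \<iota>_cancel[OF A.m_closed[OF pc(2) pc(2)] _ a(2) b(1)] A.integral[OF _ pc(2) pc(2)] pow_nonzero[OF \<phi>fc nz]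
      by blast
  qed
  define \<theta> where "\<theta> x = (SOME y. rel x y)" for x
  have \<theta>: "rel x (\<theta> x)" if "x \<in> carrier B" for x
    unfolding \<theta>_def using ex[OF that] by (rule someI_ex)
  have \<theta>I: "\<theta> x = y" if "rel x y" for x y
  proof -
    have "x \<in> carrier B" using that by (simp add: rel_def)
    then show ?thesis using unique[OF \<theta> that] by blast
  qed
  \<comment> \<open>Exponent 0 represents \<open>\<iota> a\<close> by \<open>a\<close>
    itself.\<close>
  have emb: "\<theta> (\<iota> a) = \<iota> (\<phi> a)" if a: "a \<in> carrier A" for a
    using a by (intro \<theta>I relI[of _ _ a 0]) (simp_all add: \<iota>_closed \<iota>_one)
  have "\<theta> \<in> ring_hom B B"
  proof (rule ring_hom_memI)
    fix x assume x: "x \<in> carrier B"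
    show "\<theta> x \<in> carrier B" using \<theta>[OF x] by (simp add: rel_def)
    fix y assume y: "y \<in> carrier B"
    obtain k a where a: "\<theta> x \<in> carrier B" "a \<in> carrier A"
      "\<iota> (f [^]\<^bsub>A\<^esub> (k::nat)) \<otimes>\<^bsub>B\<^esub> x = \<iota> a" "\<iota> (\<phi> f [^]\<^bsub>A\<^esub> k) \<otimes>\<^bsub>B\<^esub> \<theta> x = \<iota> (\<phi> a)" using relE[OF \<theta>[OF x]] by blast
    obtain m b where b: "\<theta> y \<in> carrier B" "b \<in> carrier A"
      "\<iota> (f [^]\<^bsub>A\<^esub> (m::nat)) \<otimes>\<^bsub>B\<^esub> y = \<iota> b" "\<iota> (\<phi> f [^]\<^bsub>A\<^esub> m) \<otimes>\<^bsub>B\<^esub> \<theta> y = \<iota> (\<phi> b)" using relE[OF \<theta>[OF y]] by blast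
    have \<phi>ab: "\<phi> a \<in> carrier A" "\<phi> b \<in> carrier A" using a(2) b(2) by simp_all
    have p: "f [^]\<^bsub>A\<^esub> k \<otimes>\<^bsub>A\<^esub> f [^]\<^bsub>A\<^esub> m = f [^]\<^bsub>A\<^esub> (k + m)" "\<phi> f [^]\<^bsub>A\<^esub> k \<otimes>\<^bsub>A\<^esub> \<phi> f [^]\<^bsub>A\<^esub> m = \<phi> f [^]\<^bsub>A\<^esub> (k + m)"
      using f_closed by (simp_all add: A.nat_pow_mult)
    have "rel (x \<otimes>\<^bsub>B\<^esub> y) (\<theta> x \<otimes>\<^bsub>B\<^esub> \<theta> y)"
      using frac_mult[OF x y a(2) b(2) pc(1) pc(1) a(3) b(3)] frac_mult[OF a(1) b(1) \<phi>ab pc(2) pc(2) a(4) b(4)] x y a b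
      by (intro relI[of _ _ "a \<otimes>\<^bsub>A\<^esub> b" "k + m"]) (simp_all add: p)
    then show "\<theta> (x \<otimes>\<^bsub>B\<^esub> y) = \<theta> x \<otimes>\<^bsub>B\<^esub> \<theta> y" by (rule \<theta>I)
    have "rel (x \<oplus>\<^bsub>B\<^esub> y) (\<theta> x \<oplus>\<^bsub>B\<^esub> \<theta> y)"
      using frac_add[OF x y a(2) b(2) pc(1) pc(1) a(3) b(3)] frac_add[OF a(1) b(1) \<phi>ab pc(2) pc(2) a(4) b(4)] x y a b pc
      by (intro relI[of _ _ "f [^]\<^bsub>A\<^esub> m \<otimes>\<^bsub>A\<^esub> a \<oplus>\<^bsub>A\<^esub> f [^]\<^bsub>A\<^esub> k \<otimes>\<^bsub>A\<^esub> b" "k + m"]) (simp_all add: p hpow)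
    then show "\<theta> (x \<oplus>\<^bsub>B\<^esub> y) = \<theta> x \<oplus>\<^bsub>B\<^esub> \<theta> y" by (rule \<theta>I)
  next
    show "\<theta> \<one>\<^bsub>B\<^esub> = \<one>\<^bsub>B\<^esub>" using emb[of "\<one>\<^bsub>A\<^esub>"] by (simp add: \<iota>_one)
  qed
  then show ?thesis using emb by (rule that)
qed

text \<open>Applying \<open>\<psi>\<close> to \<open>\<phi>(f) = \<alpha> f\<close> gives
  \<open>f = \<psi>(\<alpha>) \<psi>(f)\<close>, so \<open>\<beta>\<close> is the inverse of
  \<open>\<psi>(\<alpha>)\<close>. Thus every construction made for \<open>\<phi>\<close> is
  available for its inverse.\<close>

lemma alg_aut_inverse_semi_invariant:
  assumes \<eta>: "\<And>k. \<eta> k \<in> carrier A" and \<phi>: "\<phi> \<in> alg_aut A \<eta>" and \<phi>I: "\<phi> ` I = I"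
    and \<alpha>: "\<alpha> \<in> Units A" and \<phi>f: "\<phi> f = \<alpha> \<otimes>\<^bsub>A\<^esub> f"
  obtains \<psi> \<beta> where "\<psi> \<in> alg_aut A \<eta>" "\<And>a. a \<in> carrier A \<Longrightarrow> \<psi> (\<phi> a) = a"
    "\<And>a. a \<in> carrier A \<Longrightarrow> \<phi> (\<psi> a) = a" "\<psi> ` I \<subseteq> I" "\<beta> \<in> Units A" "\<psi> f = \<beta> \<otimes>\<^bsub>A\<^esub> f" "\<phi> f \<noteq> \<zero>\<^bsub>A\<^esub>"
proof -
  obtain \<psi> where \<psi>: "\<psi> \<in> alg_aut A \<eta>" and \<psi>\<phi>: "\<And>a. a \<in> carrier A \<Longrightarrow> \<psi> (\<phi> a) = a"
    and \<phi>\<psi>: "\<And>a. a \<in> carrier A \<Longrightarrow> \<phi> (\<psi> a) = a"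
    using alg_aut_inverse[OF A.ring_axioms \<phi> \<eta>] by blast
  note k = alg_aut_hom[OF \<psi>]
  have nz: "\<phi> f \<noteq> \<zero>\<^bsub>A\<^esub>"
    using \<psi>\<phi>[OF f_closed] ring_hom_zero[OF k A.ring_axioms A.ring_axioms] f(2) by auto
  have \<psi>I: "\<psi> ` I \<subseteq> I"
  proof
    fix b assume "b \<in> \<psi> ` I"
    then obtain i where i: "i \<in> I" "b = \<psi> i" by (rule imageE)
    then obtain j where j: "j \<in> I" "i = \<phi> j" using \<phi>I by blast
    then show "b \<in> I" using i \<psi>\<phi>[OF ideal.Icarr[OF I j(1)]] by simp
  qed
  have \<psi>\<alpha>: "\<psi> \<alpha> \<in> Units A" by (rule ring_hom_Units[OF k \<alpha>])
  have \<alpha>c: "\<alpha> \<in> carrier A" by (rule A.Units_closed[OF \<alpha>])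
  have "f = \<psi> \<alpha> \<otimes>\<^bsub>A\<^esub> \<psi> f"
    using \<psi>\<phi>[OF f_closed] ring_hom_mult[OF k \<alpha>c f_closed] \<phi>f by simp
  then have "inv\<^bsub>A\<^esub> \<psi> \<alpha> \<otimes>\<^bsub>A\<^esub> f = inv\<^bsub>A\<^esub> \<psi> \<alpha> \<otimes>\<^bsub>A\<^esub> (\<psi> \<alpha> \<otimes>\<^bsub>A\<^esub> \<psi> f)" by simp
  also have "\<dots> = \<psi> f" using \<psi>\<alpha> ring_hom_closed[OF k f_closed] A.Units_closed[OF \<psi>\<alpha>] by (simp add: A.m_assoc[symmetric])
  finally have \<psi>f: "\<psi> f = inv\<^bsub>A\<^esub> \<psi> \<alpha> \<otimes>\<^bsub>A\<^esub> f" by simp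
  show ?thesis
    by (rule that[OF \<psi> \<psi>\<phi> \<phi>\<psi> \<psi>I A.Units_inv_Units[OF \<psi>\<alpha>] \<psi>f nz])
qed

text \<open>Both \<open>\<phi>\<close> and its inverse extend to \<open>B\<close>. The two
  composites of the extensions are endomorphisms over the identity of \<open>A\<close>, so
  \<open>ext_unique\<close> makes them the identity.\<close>

lemma alg_aut_extension:
  assumes \<eta>: "\<And>k. \<eta> k \<in> carrier A" and \<phi>: "\<phi> \<in> alg_aut A \<eta>" and \<phi>I: "\<phi> ` I = I"
    and \<alpha>: "\<alpha> \<in> Units A" and \<phi>f: "\<phi> f = \<alpha> \<otimes>\<^bsub>A\<^esub> f"
  shows "\<exists>!\<phi>'. \<phi>' \<in> alg_aut B (\<iota> \<circ> \<eta>) \<and> (\<forall>a\<in>carrier A. \<phi>' (\<iota> a) = \<iota> (\<phi> a))"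
proof -
  obtain \<psi> \<beta> where \<psi>: "\<psi> \<in> alg_aut A \<eta>" and \<psi>\<phi>: "\<And>a. a \<in> carrier A \<Longrightarrow> \<psi> (\<phi> a) = a"
    and \<phi>\<psi>: "\<And>a. a \<in> carrier A \<Longrightarrow> \<phi> (\<psi> a) = a" and \<psi>I: "\<psi> ` I \<subseteq> I"
    and \<beta>: "\<beta> \<in> Units A" and \<psi>f: "\<psi> f = \<beta> \<otimes>\<^bsub>A\<^esub> f" and nz: "\<phi> f \<noteq> \<zero>\<^bsub>A\<^esub>"
    using alg_aut_inverse_semi_invariant[OF assms] by blast
  note h = alg_aut_hom[OF \<phi>] and k = alg_aut_hom[OF \<psi>]
  obtain \<theta> where \<theta>: "\<theta> \<in> ring_hom B B" "\<And>a. a \<in> carrier A \<Longrightarrow> \<theta> (\<iota> a) = \<iota> (\<phi> a)"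
    using ext_exists[OF h _ \<alpha> \<phi>f] \<phi>I by blast
  obtain \<chi> where \<chi>: "\<chi> \<in> ring_hom B B" "\<And>a. a \<in> carrier A \<Longrightarrow> \<chi> (\<iota> a) = \<iota> (\<psi> a)"
    using ext_exists[OF k \<psi>I \<beta> \<psi>f] by blast
  have idA: "id \<in> ring_hom A A" and idB: "id \<in> ring_hom B B" by simp_all
  have idf: "id f \<noteq> \<zero>\<^bsub>A\<^esub>" using f(2) by simp
  have 1: "\<chi> (\<theta> x) = x" if x: "x \<in> carrier B" for x
    using ext_unique[OF ring_hom_trans[OF \<theta>(1) \<chi>(1)] idB idA idf _ _ x] \<theta>(2) \<chi>(2) ring_hom_closed[OF h] \<psi>\<phi> by simp
  have 2: "\<theta> (\<chi> x) = x" if x: "x \<in> carrier B" for x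
    using ext_unique[OF ring_hom_trans[OF \<chi>(1) \<theta>(1)] idB idA idf _ _ x] \<theta>(2) \<chi>(2) ring_hom_closed[OF k] \<phi>\<psi> by simp
  let ?\<phi>' = "restrict \<theta> (carrier B)"
  have hom': "?\<phi>' \<in> ring_hom B B"
    by (rule ring_hom_cong[OF B.ring_axioms \<theta>(1)]) simp
  have "bij_betw ?\<phi>' (carrier B) (carrier B)"
    by (rule bij_betw_byWitness[of _ \<chi>])
      (use 1 2 ring_hom_closed[OF \<theta>(1)] ring_hom_closed[OF \<chi>(1)] in auto)
  moreover have emb: "?\<phi>' (\<iota> a) = \<iota> (\<phi> a)" if "a \<in> carrier A" for a
    using \<theta>(2)[OF that] \<iota>_closed[OF that] by simp
  moreover have "\<phi> (\<eta> k) = \<eta> k" for k using \<phi> by (simp add: alg_aut_def)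
  ultimately have "?\<phi>' \<in> alg_aut B (\<iota> \<circ> \<eta>)"
    using hom' \<eta> by (simp add: alg_aut_def ring_iso_def)
  moreover have "\<theta>' = ?\<phi>'" if \<theta>': "\<theta>' \<in> alg_aut B (\<iota> \<circ> \<eta>)" "\<forall>a\<in>carrier A. \<theta>' (\<iota> a) = \<iota> (\<phi> a)" for \<theta>'
  proof (rule extensionalityI[of _ "carrier B"])
    show "\<theta>' \<in> extensional (carrier B)" using \<theta>'(1) by (simp add: alg_aut_def)
    fix x assume "x \<in> carrier B"
    then show "\<theta>' x = ?\<phi>' x"
      using \<theta>'(2) emb by (intro ext_unique[OF alg_aut_hom[OF \<theta>'(1)] hom' h nz]) blast+
  qed simp
  ultimately show ?thesis
    using emb by (intro ex1I[of _ ?\<phi>']) blast+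
qed

end

section \<open>The blowup morphism outside the exceptional divisor\<close>

text \<open>When \<open>u\<close> lies in \<open>P\<close>, the element \<open>u/1\<close> is not a
  unit of the local ring; it is still a nonzerodivisor, since \<open>u\<close> can be cancelled in
  the domain from the equation between numerators.\<close>

lemma (in domain) loc_cancel:
  assumes P: "primeideal P R" and u: "u \<in> carrier R" "u \<noteq> \<zero>"
    and y: "y \<in> carrier (loc R P)" and z: "z \<in> carrier (loc R P)"
    and e: "lfrac R P u \<one> \<otimes>\<^bsub>loc R P\<^esub> y = lfrac R P u \<one> \<otimes>\<^bsub>loc R P\<^esub> z"
  shows "y = z"
proof -
  interpret P: primeideal P R by fact
  obtain b t where b: "y = lfrac R P b t" "b \<in> carrier R" "t \<in> carrier R - P" using y by (rule P.loc_carrierE)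
  obtain c r where c: "z = lfrac R P c r" "c \<in> carrier R" "r \<in> carrier R - P" using z by (rule P.loc_carrierE)
  have tr: "t \<in> carrier R" "r \<in> carrier R" using b(3) c(3) by simp_all
  have "lfrac R P (u \<otimes> b) (\<one> \<otimes> t) = lfrac R P (u \<otimes> c) (\<one> \<otimes> r)"
    using e P.loc_mult[OF u(1) P.compl_one b(2,3)] P.loc_mult[OF u(1) P.compl_one c(2,3)] by (simp add: b(1) c(1))
  then have "lfrac R P (u \<otimes> b) t = lfrac R P (u \<otimes> c) r" using tr by simp
  then obtain v where v: "v \<in> carrier R - P" "v \<otimes> (r \<otimes> (u \<otimes> b)) = v \<otimes> (t \<otimes> (u \<otimes> c))"
    using P.lfrac_eq_iff[OF m_closed[OF u(1) b(2)] b(3) m_closed[OF u(1) c(2)] c(3)] by blast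
  have "u \<otimes> (v \<otimes> (r \<otimes> b)) = v \<otimes> (r \<otimes> (u \<otimes> b))" "u \<otimes> (v \<otimes> (t \<otimes> c)) = v \<otimes> (t \<otimes> (u \<otimes> c))"
    using u(1) v(1) b(2) c(2) tr by (simp_all add: m_ac)
  then have "u \<otimes> (v \<otimes> (r \<otimes> b)) = u \<otimes> (v \<otimes> (t \<otimes> c))" using v(2) by simp
  then have "v \<otimes> (r \<otimes> b) = v \<otimes> (t \<otimes> c)"
    using m_lcancel[of u] u v(1) b(2) c(2) tr by simp
  then show ?thesis
    unfolding b(1) c(1) using P.lfrac_eq_iff[OF b(2,3) c(2,3)] v(1) by blast
qed

text \<open>In a domain the nonzero multiplier \<open>v\<close> of an equality of fractions cancels,
  and the remaining equation comes back to \<open>A\<close> through the injective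
  \<open>\<theta>\<close>.\<close>

lemma loc_map_inj:
  assumes "domain A" "domain B" and h: "\<theta> \<in> ring_hom A B" and inj: "inj_on \<theta> (carrier A)" and Q: "primeideal Q B"
  shows "inj_on (loc_map B \<theta> Q) (carrier (loc A (spec_pt A B \<theta> Q)))"
proof (rule inj_onI)
  let ?P = "spec_pt A B \<theta> Q"
  interpret A: domain A by fact
  interpret B: domain B by fact
  interpret Q: primeideal Q B by fact
  interpret P: primeideal ?P A by (rule spec_pt_prime[OF A.cring_axioms B.cring_axioms h Q])
  note l = loc_map_lfrac[OF A.cring_axioms B.cring_axioms h Q]
  fix x y assume x: "x \<in> carrier (loc A ?P)" and y: "y \<in> carrier (loc A ?P)" and e: "loc_map B \<theta> Q x = loc_map B \<theta> Q y"
  obtain a s where a: "x = lfrac A ?P a s" "a \<in> carrier A" "s \<in> carrier A - ?P" using x by (rule P.loc_carrierE)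
  obtain b t where b: "y = lfrac A ?P b t" "b \<in> carrier A" "t \<in> carrier A - ?P" using y by (rule P.loc_carrierE)
  have st: "s \<in> carrier A" "t \<in> carrier A" using a(3) b(3) by simp_all
  note c = ring_hom_closed[OF h]
  have "lfrac B Q (\<theta> a) (\<theta> s) = lfrac B Q (\<theta> b) (\<theta> t)"
    using e l[OF a(2,3)] l[OF b(2,3)] by (simp add: a(1) b(1))
  then obtain v where v: "v \<in> carrier B - Q" "v \<otimes>\<^bsub>B\<^esub> (\<theta> t \<otimes>\<^bsub>B\<^esub> \<theta> a) = v \<otimes>\<^bsub>B\<^esub> (\<theta> s \<otimes>\<^bsub>B\<^esub> \<theta> b)"
    using Q.lfrac_eq_iff[OF c[OF a(2)] spec_pt_compl[OF h a(3)] c[OF b(2)] spec_pt_compl[OF h b(3)]] by blast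
  have "v \<noteq> \<zero>\<^bsub>B\<^esub>" using v(1) additive_subgroup.zero_closed[OF Q.additive_subgroup_axioms] by auto
  then have "\<theta> t \<otimes>\<^bsub>B\<^esub> \<theta> a = \<theta> s \<otimes>\<^bsub>B\<^esub> \<theta> b"
    using B.m_lcancel[of v] v c a(2) b(2) st by simp
  then have "\<theta> (t \<otimes>\<^bsub>A\<^esub> a) = \<theta> (s \<otimes>\<^bsub>A\<^esub> b)"
    using ring_hom_mult[OF h] a(2) b(2) st by simp
  then have "t \<otimes>\<^bsub>A\<^esub> a = s \<otimes>\<^bsub>A\<^esub> b"
    using inj_onD[OF inj] A.m_closed[OF st(2) a(2)] A.m_closed[OF st(1) b(2)] by blast
  then show "x = y" unfolding a(1) b(1) by (rule P.lfrac_eqI[OF a(2,3) b(2,3)])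
qed

text \<open>Naturality of the canonical map from a ring to its global sections.\<close>

lemma const_sec_spec_map:
  assumes A: "cring A" and B: "cring B" and h: "\<theta> \<in> ring_hom A B" and a: "a \<in> carrier A"
  shows "snd (spec_map A B \<theta>) {P. primeideal P A} (const_sec A a) = const_sec B (\<theta> a)"
proof -
  have pre: "{Q. primeideal Q B \<and> spec_pt A B \<theta> Q \<in> {P. primeideal P A}} = {Q. primeideal Q B}"
    using spec_pt_prime[OF A B h] by auto
  show ?thesis
    unfolding snd_spec_map[OF openin_Collect_prime[OF A] const_sec_closed[OF A a]] pre
    unfolding const_sec_def
  proof (rule restrict_ext)
    fix Q assume "Q \<in> {Q. primeideal Q B}"
    then have Q: "primeideal Q B" by simp
    have P: "primeideal (spec_pt A B \<theta> Q) A" by (rule spec_pt_prime[OF A B h Q])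
    show "loc_map B \<theta> Q ((\<lambda>P\<in>{P. primeideal P A}. lfrac A P a \<one>\<^bsub>A\<^esub>) (spec_pt A B \<theta> Q)) = lfrac B Q (\<theta> a) \<one>\<^bsub>B\<^esub>"
      using loc_map_lfrac[OF A B h Q a primeideal.compl_one[OF P]] P by (simp add: ring_hom_one[OF h])
  qed
qed

lemma const_sec_mult:
  assumes A: "cring A" and a: "a \<in> carrier A" and b: "b \<in> carrier A"
  shows "const_sec A (a \<otimes>\<^bsub>A\<^esub> b) = const_sec A a \<otimes>\<^bsub>spec_sec A {P. primeideal P A}\<^esub> const_sec A b"
  unfolding const_sec_def spec_sec_ops
proof (rule restrict_ext)
  interpret A: cring A by fact
  fix P assume P: "P \<in> {P. primeideal P A}"
  then interpret P: primeideal P A by simp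
  show "lfrac A P (a \<otimes>\<^bsub>A\<^esub> b) \<one>\<^bsub>A\<^esub> = (\<lambda>P\<in>{P. primeideal P A}. lfrac A P a \<one>\<^bsub>A\<^esub>) P \<otimes>\<^bsub>loc A P\<^esub>
      (\<lambda>P\<in>{P. primeideal P A}. lfrac A P b \<one>\<^bsub>A\<^esub>) P"
    using P P.loc_mult[OF a P.compl_one b P.compl_one] by simp
qed

context affine_modification
begin

text \<open>At a prime avoiding \<open>\<iota> f\<close>, multiplication by powers of
  \<open>f\<close> does not change membership, so membership of \<open>x\<close> can be read off
  from its numerator.\<close>

lemma mem_iff:
  assumes Q: "primeideal Q B" and fQ: "\<iota> f \<notin> Q" and x: "x \<in> carrier B" and a: "a \<in> carrier A"
    and e: "\<iota> (f [^]\<^bsub>A\<^esub> (k::nat)) \<otimes>\<^bsub>B\<^esub> x = \<iota> a"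
  shows "x \<in> Q \<longleftrightarrow> a \<in> spec_pt A B \<iota> Q"
proof -
  interpret Q: primeideal Q B by fact
  have n: "\<iota> (f [^]\<^bsub>A\<^esub> k) \<in> carrier B - Q" for k :: nat
  proof (induction k)
    case 0
    show ?case using Q.compl_one by (simp add: \<iota>_one)
  next
    case (Suc k)
    have "\<iota> f \<in> carrier B - Q" using fQ \<iota>_closed[OF f_closed] by simp
    then show ?case using Q.compl_mult[OF Suc] f_closed by (simp add: \<iota>_mult)
  qed
  have "x \<in> Q \<longleftrightarrow> \<iota> (f [^]\<^bsub>A\<^esub> k) \<otimes>\<^bsub>B\<^esub> x \<in> Q"
    using n[of k] x Q.I_prime[of "\<iota> (f [^]\<^bsub>A\<^esub> k)" x] Q.I_l_closed[of x "\<iota> (f [^]\<^bsub>A\<^esub> k)"] by blast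
  then show ?thesis using a e unfolding spec_pt_def by simp
qed

lemma f_notin_spec_pt: "f \<notin> spec_pt A B \<iota> Q \<longleftrightarrow> \<iota> f \<notin> Q"
  using f_closed by (simp add: spec_pt_def)

lemma spec_pt_inj:
  assumes Q: "primeideal Q B" "\<iota> f \<notin> Q" and R: "primeideal R B" "\<iota> f \<notin> R"
    and e: "spec_pt A B \<iota> Q = spec_pt A B \<iota> R"
  shows "Q = R"
proof -
  have "x \<in> Q \<longleftrightarrow> x \<in> R" if x: "x \<in> carrier B" for x
  proof -
    obtain k a where a: "a \<in> ideal_pow A I k" "a \<in> carrier A" "\<iota> (f [^]\<^bsub>A\<^esub> k) \<otimes>\<^bsub>B\<^esub> x = \<iota> a"
      using x by (rule frac_carrier)
    show ?thesis using mem_iff[OF Q x a(2,3)] mem_iff[OF R x a(2,3)] e by simp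
  qed
  moreover have "Q \<subseteq> carrier B" "R \<subseteq> carrier B"
    using additive_subgroup.a_subset[OF ideal.axioms(1)[OF primeideal.axioms(1)]] Q(1) R(1) by blast+
  ultimately show ?thesis by blast
qed

text \<open>\<open>Q\<close> is the part inside \<open>B\<close> of the prime that \<open>P\<close>
  generates in \<open>A[1/f]\<close>, described by numerators. It contracts to \<open>P\<close>
  because \<open>f^k b\<close> in \<open>P\<close> with \<open>f\<close> outside \<open>P\<close>
  forces \<open>b\<close> into \<open>P\<close>.\<close>

lemma spec_pt_surj:
  assumes P: "primeideal P A" and fP: "f \<notin> P"
  obtains Q where "primeideal Q B" "\<iota> f \<notin> Q" "spec_pt A B \<iota> Q = P"
proof -
  interpret P: primeideal P A by fact
  define Q where "Q = {x \<in> carrier B. \<exists>k::nat. \<exists>a\<in>P. \<iota> (f [^]\<^bsub>A\<^esub> k) \<otimes>\<^bsub>B\<^esub> x = \<iota> a}"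
  have fc: "f [^]\<^bsub>A\<^esub> (k::nat) \<in> carrier A - P" for k using fP f_closed by (intro P.compl_nat_pow) simp
  have QI: "x \<in> Q" if "x \<in> carrier B" "a \<in> P" "\<iota> (f [^]\<^bsub>A\<^esub> (k::nat)) \<otimes>\<^bsub>B\<^esub> x = \<iota> a" for x a k
    using that unfolding Q_def by blast
  have QE: "\<exists>k a. x \<in> carrier B \<and> a \<in> P \<and> a \<in> carrier A \<and> \<iota> (f [^]\<^bsub>A\<^esub> (k::nat)) \<otimes>\<^bsub>B\<^esub> x = \<iota> a" if "x \<in> Q" for x
    using that P.Icarr unfolding Q_def by blast
  have pow: "f [^]\<^bsub>A\<^esub> k \<otimes>\<^bsub>A\<^esub> f [^]\<^bsub>A\<^esub> m = f [^]\<^bsub>A\<^esub> (k + m)" for k m :: nat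
    using f_closed by (simp add: A.nat_pow_mult)
  note aP = additive_subgroup.a_closed[OF P.additive_subgroup_axioms]
    and zP = additive_subgroup.zero_closed[OF P.additive_subgroup_axioms]
  have mult: "x \<otimes>\<^bsub>B\<^esub> y \<in> Q" if x: "x \<in> Q" and y: "y \<in> carrier B" for x y
  proof -
    obtain k a where a: "x \<in> carrier B" "a \<in> P" "a \<in> carrier A" "\<iota> (f [^]\<^bsub>A\<^esub> (k::nat)) \<otimes>\<^bsub>B\<^esub> x = \<iota> a"
      using QE[OF x] by blast
    obtain m b where b: "b \<in> ideal_pow A I m" "b \<in> carrier A" "\<iota> (f [^]\<^bsub>A\<^esub> m) \<otimes>\<^bsub>B\<^esub> y = \<iota> b"
      using y by (rule frac_carrier)
    have "\<iota> (f [^]\<^bsub>A\<^esub> (k + m)) \<otimes>\<^bsub>B\<^esub> (x \<otimes>\<^bsub>B\<^esub> y) = \<iota> (a \<otimes>\<^bsub>A\<^esub> b)"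
      using frac_mult[OF a(1) y a(3) b(2) pow_closed pow_closed a(4) b(3)] unfolding pow .
    then show ?thesis by (rule QI[OF B.m_closed[OF a(1) y] P.I_r_closed[OF a(2) b(2)]])
  qed
  have Qc: "x \<in> carrier B" if "x \<in> Q" for x using that by (simp add: Q_def)
  have idl: "ideal Q B"
  proof (rule idealI[OF B.ring_axioms])
    show "subgroup Q (add_monoid B)"
    proof (rule group.subgroupI[OF B.a_group])
      show "Q \<subseteq> carrier (add_monoid B)" using Qc by auto
      have "\<zero>\<^bsub>B\<^esub> \<in> Q" using \<iota>_closed[OF pow_closed[of 0]] by (intro QI[of _ "\<zero>\<^bsub>A\<^esub>" 0] zP) (simp_all add: \<iota>_zero)
      then show "Q \<noteq> {}" by blast
    next
      fix x assume x: "x \<in> Q"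
      \<comment> \<open>Closure under negatives is reduced to closure under multiples.\<close>
      have "\<ominus>\<^bsub>B\<^esub> x = x \<otimes>\<^bsub>B\<^esub> \<ominus>\<^bsub>B\<^esub> \<one>\<^bsub>B\<^esub>" using Qc[OF x] by (simp add: B.r_minus)
      then have "\<ominus>\<^bsub>B\<^esub> x \<in> Q" using mult[OF x, of "\<ominus>\<^bsub>B\<^esub> \<one>\<^bsub>B\<^esub>"] by simp
      then show "inv\<^bsub>add_monoid B\<^esub> x \<in> Q" unfolding a_inv_def .
    next
      fix x y assume x: "x \<in> Q" and y: "y \<in> Q"
      obtain k a where a: "x \<in> carrier B" "a \<in> P" "a \<in> carrier A" "\<iota> (f [^]\<^bsub>A\<^esub> (k::nat)) \<otimes>\<^bsub>B\<^esub> x = \<iota> a"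
        using QE[OF x] by blast
      obtain m b where b: "y \<in> carrier B" "b \<in> P" "b \<in> carrier A" "\<iota> (f [^]\<^bsub>A\<^esub> (m::nat)) \<otimes>\<^bsub>B\<^esub> y = \<iota> b"
        using QE[OF y] by blast
      have e: "\<iota> (f [^]\<^bsub>A\<^esub> (k + m)) \<otimes>\<^bsub>B\<^esub> (x \<oplus>\<^bsub>B\<^esub> y) = \<iota> (f [^]\<^bsub>A\<^esub> m \<otimes>\<^bsub>A\<^esub> a \<oplus>\<^bsub>A\<^esub> f [^]\<^bsub>A\<^esub> k \<otimes>\<^bsub>A\<^esub> b)"
        using frac_add[OF a(1) b(1) a(3) b(3) pow_closed pow_closed a(4) b(4)] unfolding pow .
      have "x \<oplus>\<^bsub>B\<^esub> y \<in> Q"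
        by (rule QI[OF B.a_closed[OF a(1) b(1)] aP[OF P.I_l_closed[OF a(2) pow_closed] P.I_l_closed[OF b(2) pow_closed]] e])
      then show "x \<otimes>\<^bsub>add_monoid B\<^esub> y \<in> Q" by simp
    qed
    fix x y assume x: "x \<in> Q" and y: "y \<in> carrier B"
    show "x \<otimes>\<^bsub>B\<^esub> y \<in> Q" by (rule mult[OF x y])
    then show "y \<otimes>\<^bsub>B\<^esub> x \<in> Q" using B.m_comm[OF Qc[OF x] y] by simp
  qed
  have pt: "\<iota> b \<in> Q \<longleftrightarrow> b \<in> P" if b: "b \<in> carrier A" for b
  proof
    assume "b \<in> P"
    then show "\<iota> b \<in> Q" using \<iota>_closed[OF b] by (intro QI[of _ b 0]) (simp_all add: \<iota>_one)
  next
    assume "\<iota> b \<in> Q"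
    then obtain k a where a: "a \<in> P" "a \<in> carrier A" "\<iota> (f [^]\<^bsub>A\<^esub> (k::nat)) \<otimes>\<^bsub>B\<^esub> \<iota> b = \<iota> a"
      using QE by blast
    have "f [^]\<^bsub>A\<^esub> k \<otimes>\<^bsub>A\<^esub> b = a" using a(2,3) b pow_closed[of k] by (intro \<iota>_eq) (simp_all add: \<iota>_mult)
    then show "b \<in> P" using P.I_prime[OF pow_closed[of k] b] a(1) fc[of k] by blast
  qed
  have one: "\<one>\<^bsub>B\<^esub> \<notin> Q" using pt[OF A.one_closed] P.compl_one by (simp add: \<iota>_one)
  have "primeideal Q B"
  proof (rule primeidealI[OF idl B.cring_axioms])
    show "carrier B \<noteq> Q" using one by blast
    fix x y assume x: "x \<in> carrier B" and y: "y \<in> carrier B" and xy: "x \<otimes>\<^bsub>B\<^esub> y \<in> Q"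
    obtain k a where a: "a \<in> ideal_pow A I k" "a \<in> carrier A" "\<iota> (f [^]\<^bsub>A\<^esub> k) \<otimes>\<^bsub>B\<^esub> x = \<iota> a"
      using x by (rule frac_carrier)
    obtain m b where b: "b \<in> ideal_pow A I m" "b \<in> carrier A" "\<iota> (f [^]\<^bsub>A\<^esub> m) \<otimes>\<^bsub>B\<^esub> y = \<iota> b"
      using y by (rule frac_carrier)
    have e: "\<iota> (f [^]\<^bsub>A\<^esub> k \<otimes>\<^bsub>A\<^esub> f [^]\<^bsub>A\<^esub> m) \<otimes>\<^bsub>B\<^esub> (x \<otimes>\<^bsub>B\<^esub> y) = \<iota> (a \<otimes>\<^bsub>A\<^esub> b)"
      by (rule frac_mult[OF x y a(2) b(2) pow_closed pow_closed a(3) b(3)])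
    have "\<iota> (f [^]\<^bsub>A\<^esub> k \<otimes>\<^bsub>A\<^esub> f [^]\<^bsub>A\<^esub> m) \<otimes>\<^bsub>B\<^esub> (x \<otimes>\<^bsub>B\<^esub> y) \<in> Q"
      by (rule ideal.I_l_closed[OF idl xy \<iota>_closed[OF A.m_closed[OF pow_closed pow_closed]]])
    then have "a \<otimes>\<^bsub>A\<^esub> b \<in> P" unfolding e using pt[OF A.m_closed[OF a(2) b(2)]] by simp
    then have "a \<in> P \<or> b \<in> P" by (rule P.I_prime[OF a(2) b(2)])
    then show "x \<in> Q \<or> y \<in> Q" using QI[OF x _ a(3)] QI[OF y _ b(3)] by blast
  qed
  moreover have "\<iota> f \<notin> Q" using pt[OF f_closed] fP by simp
  moreover have "spec_pt A B \<iota> Q = P"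
    unfolding spec_pt_def using pt P.Icarr by blast
  ultimately show ?thesis by (rule that)
qed

text \<open>The open set contains some \<open>basic_open B x\<close> around \<open>Q\<close>; let
  \<open>a\<close> be a numerator of \<open>x\<close>. Every prime of \<open>A\<close> avoiding
  \<open>a\<close> and \<open>f\<close> lifts to one avoiding \<open>\<iota> f\<close>, hence also
  \<open>x\<close>, so the basic open set of the product of \<open>a\<close> and \<open>f\<close>
  lies in the image.\<close>

lemma spec_pt_image_open:
  assumes V: "openin (zariski B) V" and Vf: "\<And>Q. Q \<in> V \<Longrightarrow> \<iota> f \<notin> Q"
  shows "openin (zariski A) (spec_pt A B \<iota> ` V)"
proof (rule openin_zariskiI)
  fix P assume "P \<in> spec_pt A B \<iota> ` V"
  then obtain Q where Q: "Q \<in> V" "P = spec_pt A B \<iota> Q" by (rule imageE[of P]) blast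
  have Qp: "primeideal Q B" by (rule openin_zariski_prime[OF V Q(1)])
  have Pp: "primeideal P A" unfolding Q(2) by (rule spec_pt_prime[OF A.cring_axioms B.cring_axioms hom Qp])
  obtain x where x: "x \<in> carrier B" "Q \<in> basic_open B x" "basic_open B x \<subseteq> V"
    using B.cring_axioms V Q(1) by (rule openin_zariskiE)
  obtain k a where a: "a \<in> ideal_pow A I k" "a \<in> carrier A" "\<iota> (f [^]\<^bsub>A\<^esub> k) \<otimes>\<^bsub>B\<^esub> x = \<iota> a"
    using x(1) by (rule frac_carrier)
  have "a \<notin> P" "f \<notin> P"
    using mem_iff[OF Qp Vf[OF Q(1)] x(1) a(2,3)] x(2) f_notin_spec_pt[of Q] Vf[OF Q(1)]
    by (simp_all add: Q(2) basic_open_def)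
  then have P: "P \<in> basic_open A (a \<otimes>\<^bsub>A\<^esub> f)"
    unfolding basic_open_inter[OF a(2) f_closed] using Pp by (simp add: basic_open_def)
  have "basic_open A (a \<otimes>\<^bsub>A\<^esub> f) \<subseteq> spec_pt A B \<iota> ` V"
  proof
    fix R assume "R \<in> basic_open A (a \<otimes>\<^bsub>A\<^esub> f)"
    then have R: "primeideal R A" "a \<notin> R" "f \<notin> R"
      unfolding basic_open_inter[OF a(2) f_closed] by (simp_all add: basic_open_def)
    obtain Q' where Q': "primeideal Q' B" "\<iota> f \<notin> Q'" "spec_pt A B \<iota> Q' = R"
      using R(1,3) by (rule spec_pt_surj)
    have "x \<notin> Q'" using mem_iff[OF Q'(1,2) x(1) a(2,3)] R(2) Q'(3) by simp
    then have "Q' \<in> V" using x(3) Q'(1) by (auto simp: basic_open_def)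
    then show "R \<in> spec_pt A B \<iota> ` V" using Q'(3) by blast
  qed
  then show "\<exists>c\<in>carrier A. P \<in> basic_open A c \<and> basic_open A c \<subseteq> spec_pt A B \<iota> ` V"
    using P A.m_closed[OF a(2) f_closed] by blast
qed

text \<open>Injectivity is local, by \<open>loc_map_inj\<close>. For surjectivity the values of a
  preimage are forced point by point, and the work lies in showing that they are locally given by
  one fraction over \<open>A\<close>.\<close>

lemma spec_map_section_bij:
  assumes V: "openin (zariski A) V" and Vf: "\<And>P. P \<in> V \<Longrightarrow> f \<notin> P"
  shows "bij_betw (snd (spec_map A B \<iota>) V) (carrier (spec_sec A V))
    (carrier (spec_sec B {Q. primeideal Q B \<and> spec_pt A B \<iota> Q \<in> V}))"
    (is "bij_betw ?c _ (carrier (spec_sec B ?pre))")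
proof -
  note A = A.cring_axioms and B = B.cring_axioms
  note inj_loc = loc_map_inj[OF A.domain_axioms B.domain_axioms hom inj]
  have ex: "\<exists>Q. primeideal Q B \<and> spec_pt A B \<iota> Q = P" if "P \<in> V" for P
    using spec_pt_surj[OF openin_zariski_prime[OF V that] Vf[OF that]] by metis
  \<comment> \<open>The point over \<open>P\<close>. It avoids \<open>\<iota> f\<close> because
    \<open>P\<close> avoids \<open>f\<close>, so it is unique by \<open>spec_pt_inj\<close>.\<close>
  define g where "g P = (SOME Q. primeideal Q B \<and> spec_pt A B \<iota> Q = P)" for P
  have g: "primeideal (g P) B" "spec_pt A B \<iota> (g P) = P" if "P \<in> V" for P
    using someI_ex[OF ex[OF that]] unfolding g_def by simp_all
  have gpt: "g (spec_pt A B \<iota> Q) = Q" if Q: "Q \<in> ?pre" for Q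
  proof (rule spec_pt_inj)
    have P: "spec_pt A B \<iota> Q \<in> V" and Qp: "primeideal Q B" using Q by simp_all
    show "primeideal (g (spec_pt A B \<iota> Q)) B" "primeideal Q B" "spec_pt A B \<iota> (g (spec_pt A B \<iota> Q)) = spec_pt A B \<iota> Q"
      using g[OF P] Qp by simp_all
    show "\<iota> f \<notin> Q" using Vf[OF P] f_notin_spec_pt by simp
    show "\<iota> f \<notin> g (spec_pt A B \<iota> Q)"
      using Vf[OF P] f_notin_spec_pt[of "g (spec_pt A B \<iota> Q)"] g(2)[OF P] by simp
  qed
  show ?thesis
  proof (rule bij_betw_imageI)
    show "inj_on ?c (carrier (spec_sec A V))"
    proof (rule inj_onI)
      fix s t assume s: "s \<in> carrier (spec_sec A V)" and t: "t \<in> carrier (spec_sec A V)" and e: "?c s = ?c t"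
      show "s = t"
      proof (rule spec_sec_eqI[OF spec_sec_extensional[OF s] spec_sec_extensional[OF t]])
        fix P assume P: "P \<in> V"
        have "?c s (g P) = ?c t (g P)" using e by simp
        then have "loc_map B \<iota> (g P) (s P) = loc_map B \<iota> (g P) (t P)"
          using g[OF P] P by (simp add: snd_spec_map[OF V s] snd_spec_map[OF V t])
        then show "s P = t P"
          using inj_onD[OF inj_loc[OF g(1)[OF P]]] spec_sec_value[OF s P] spec_sec_value[OF t P] g(2)[OF P] by simp
      qed
    qed
    show "?c ` carrier (spec_sec A V) = carrier (spec_sec B ?pre)"
    proof
      show "?c ` carrier (spec_sec A V) \<subseteq> carrier (spec_sec B ?pre)"
        using spec_map_section[OF A B hom V] by blast
      show "carrier (spec_sec B ?pre) \<subseteq> ?c ` carrier (spec_sec A V)"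
      proof
        fix t assume t: "t \<in> carrier (spec_sec B ?pre)"
        define s where "s = (\<lambda>P\<in>V. inv_into (carrier (loc A P)) (loc_map B \<iota> (g P)) (t (g P)))"
        \<comment> \<open>\<open>inv_into\<close> returns a true preimage only once one is known to
          exist. The local fraction supplies it, so the equation with \<open>t\<close> is proved
          together with the local form of \<open>s\<close>.\<close>
        have loc_s: "\<exists>W a b. openin (zariski A) W \<and> P \<in> W \<and> W \<subseteq> V \<and> frac_on A W s a b \<and>
          (\<forall>R\<in>W. loc_map B \<iota> (g R) (s R) = t (g R))" if P: "P \<in> V" for P
        proof -
          have gP: "g P \<in> ?pre" using g[OF P] P by simp
          with t obtain W x y where W: "openin (zariski B) W" "g P \<in> W" "W \<subseteq> ?pre" "frac_on B W t x y"
            by (rule spec_sec_carrierE)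
          have xy: "x \<in> carrier B" "y \<in> carrier B" using W(4) by (simp_all add: frac_on_def)
          obtain k a where a: "a \<in> ideal_pow A I k" "a \<in> carrier A" "\<iota> (f [^]\<^bsub>A\<^esub> k) \<otimes>\<^bsub>B\<^esub> x = \<iota> a"
            using xy(1) by (rule frac_carrier)
          obtain m b where b: "b \<in> ideal_pow A I m" "b \<in> carrier A" "\<iota> (f [^]\<^bsub>A\<^esub> m) \<otimes>\<^bsub>B\<^esub> y = \<iota> b"
            using xy(2) by (rule frac_carrier)
          \<comment> \<open>The fraction \<open>x/y\<close> becomes one with entries from
            \<open>A\<close> after expansion by \<open>f^(m+k)\<close>: the numerator is then
            \<open>f^m a\<close> and the denominator \<open>f^k b\<close>.\<close>
          let ?W = "spec_pt A B \<iota> ` W" and ?a = "f [^]\<^bsub>A\<^esub> m \<otimes>\<^bsub>A\<^esub> a" and ?b = "f [^]\<^bsub>A\<^esub> k \<otimes>\<^bsub>A\<^esub> b"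
          have Wf: "\<iota> f \<notin> Q" if "Q \<in> W" for Q
            using Vf[of "spec_pt A B \<iota> Q"] subsetD[OF W(3) that] f_notin_spec_pt by simp
          have ab: "?a \<in> carrier A" "?b \<in> carrier A" using a(2) b(2) pow_closed by simp_all
          have key: "?b \<notin> spec_pt A B \<iota> Q \<and> s (spec_pt A B \<iota> Q) = lfrac A (spec_pt A B \<iota> Q) ?a ?b \<and>
              loc_map B \<iota> Q (s (spec_pt A B \<iota> Q)) = t Q" if QW: "Q \<in> W" for Q
          proof -
            let ?R = "spec_pt A B \<iota> Q"
            have Q: "primeideal Q B" "?R \<in> V" "Q \<in> ?pre" using subsetD[OF W(3) QW] by simp_all
            interpret Q: primeideal Q B by (rule Q(1))
            interpret R: primeideal ?R A by (rule spec_pt_prime[OF A B hom Q(1)])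
            have tQ: "y \<in> carrier B - Q" "t Q = lfrac B Q x y" using W(4) QW xy(2) by (simp_all add: frac_on_def)
            have fR: "f [^]\<^bsub>A\<^esub> (n::nat) \<in> carrier A - ?R" for n
              using f_notin_spec_pt[of Q] Wf[OF QW] f_closed by (intro R.compl_nat_pow) simp
            have "b \<in> carrier A - ?R" using mem_iff[OF Q(1) Wf[OF QW] xy(2) b(2,3)] tQ(1) b(2) by simp
            then have bR: "?b \<in> carrier A - ?R" by (rule R.compl_mult[OF fR])
            let ?u = "\<iota> (f [^]\<^bsub>A\<^esub> m \<otimes>\<^bsub>A\<^esub> f [^]\<^bsub>A\<^esub> k)"
            have u: "?u \<in> carrier B - Q" by (rule spec_pt_compl[OF hom R.compl_mult[OF fR fR]])
            have fc: "\<iota> (f [^]\<^bsub>A\<^esub> (n::nat)) \<in> carrier B" for n by (rule \<iota>_closed[OF pow_closed])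
            have "\<iota> ?a = ?u \<otimes>\<^bsub>B\<^esub> x"
              using a(2) xy(1) fc pow_closed by (simp add: \<iota>_mult a(3)[symmetric] B.m_assoc)
            moreover have "\<iota> ?b = ?u \<otimes>\<^bsub>B\<^esub> y"
              using b(2) xy(2) fc pow_closed by (simp add: \<iota>_mult b(3)[symmetric] B.m_ac)
            ultimately have "lfrac B Q (\<iota> ?a) (\<iota> ?b) = t Q"
              using Q.lfrac_cancel[OF xy(1) tQ(1) u] tQ(2) by simp
            then have l: "loc_map B \<iota> Q (lfrac A ?R ?a ?b) = t Q"
              using loc_map_lfrac[OF A B hom Q(1) ab(1) bR] by simp
            have "s ?R = inv_into (carrier (loc A ?R)) (loc_map B \<iota> Q) (t Q)"
              using Q(2) gpt[OF Q(3)] by (simp add: s_def)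
            also have "\<dots> = lfrac A ?R ?a ?b"
              unfolding l[symmetric] by (rule inv_into_f_f[OF inj_loc[OF Q(1)] R.lfrac_closed[OF ab(1) bR]])
            finally show ?thesis using l bR by simp
          qed
          have WV: "?W \<subseteq> V" using W(3) by auto
          have "frac_on A ?W s ?a ?b" unfolding frac_on_def using ab key by blast
          moreover have "openin (zariski A) ?W" by (rule spec_pt_image_open[OF W(1) Wf])
          moreover have "P \<in> ?W" using W(2) g(2)[OF P] by (metis image_eqI)
          moreover have "\<forall>R\<in>?W. loc_map B \<iota> (g R) (s R) = t (g R)"
          proof
            fix R assume "R \<in> ?W"
            then obtain Q where Q: "Q \<in> W" "R = spec_pt A B \<iota> Q" by (rule imageE)
            have e: "g R = Q" unfolding Q(2) by (rule gpt[OF subsetD[OF W(3) Q(1)]])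
            show "loc_map B \<iota> (g R) (s R) = t (g R)"
              unfolding e unfolding Q(2) using key[OF Q(1)] by (elim conjE)
          qed
          ultimately show ?thesis using WV by blast
        qed
        have s: "s \<in> carrier (spec_sec A V)"
        proof (rule spec_sec_carrierI)
          show "s \<in> extensional V" by (simp add: s_def)
          fix P assume P: "P \<in> V"
          show "primeideal P A" by (rule openin_zariski_prime[OF V P])
          show "\<exists>W a b. openin (zariski A) W \<and> P \<in> W \<and> W \<subseteq> V \<and> frac_on A W s a b"
            using loc_s[OF P] by blast
        qed
        have "t = ?c s"
        proof (rule spec_sec_eqI[OF spec_sec_extensional[OF t]])
          show "?c s \<in> extensional ?pre" by (simp add: snd_spec_map[OF V s])
          fix Q assume Q: "Q \<in> ?pre"
          then have P: "spec_pt A B \<iota> Q \<in> V" by simp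
          have "loc_map B \<iota> (g (spec_pt A B \<iota> Q)) (s (spec_pt A B \<iota> Q)) = t (g (spec_pt A B \<iota> Q))"
            using loc_s[OF P] by blast
          then show "t Q = ?c s Q" using Q gpt[OF Q] by (simp add: snd_spec_map[OF V s])
        qed
        then show "t \<in> ?c ` carrier (spec_sec A V)" using s by blast
      qed
    qed
  qed
qed

end

section \<open>The blowup as an isomorphism where \<open>f\<close> is nonzero, and uniqueness of the
  lift\<close>

context affine_modification
begin

lemma blowup_maps: "fst (spec_map A B \<iota>) ` basic_open B (\<iota> f) \<subseteq> basic_open A f"
proof (rule image_subsetI)
  fix Q assume "Q \<in> basic_open B (\<iota> f)"
  then have Q: "primeideal Q B" "\<iota> f \<notin> Q" by (simp_all add: basic_open_def)
  then show "fst (spec_map A B \<iota>) Q \<in> basic_open A f"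
    using spec_pt_prime[OF A.cring_axioms B.cring_axioms hom Q(1)] f_notin_spec_pt[of Q]
    by (simp add: fst_spec_map basic_open_def)
qed

context
  fixes \<eta> :: "complex \<Rightarrow> 'a"
  assumes \<eta>: "\<And>k. \<eta> k \<in> carrier A"
begin

lemma presheaf_A: "presheaf (Spec A \<eta>)"
  by (rule presheaf_Spec[OF A.cring_axioms \<eta>])

lemma presheaf_B: "presheaf (Spec B (\<iota> \<circ> \<eta>))"
  using \<eta> \<iota>_closed by (intro presheaf_Spec[OF B.cring_axioms]) simp

lemma blowup_rmor: "spec_map A B \<iota> \<in> rmor (Spec B (\<iota> \<circ> \<eta>)) (Spec A \<eta>)"
  by (rule spec_map_rmor[OF A.cring_axioms B.cring_axioms hom \<eta>]) simp

lemma blowup_commutes: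
  assumes \<phi>: "\<phi> \<in> ring_hom A A" and \<phi>': "\<phi>' \<in> ring_hom B B" "\<And>a. a \<in> carrier A \<Longrightarrow> \<phi>' (\<iota> a) = \<iota> (\<phi> a)"
  shows "rcomp (Spec B (\<iota> \<circ> \<eta>)) (Spec B (\<iota> \<circ> \<eta>)) (Spec A \<eta>) (spec_map A B \<iota>) (spec_map B B \<phi>') =
    rcomp (Spec B (\<iota> \<circ> \<eta>)) (Spec A \<eta>) (Spec A \<eta>) (spec_map A A \<phi>) (spec_map A B \<iota>)"
  unfolding spec_map_comp[OF A.cring_axioms B.cring_axioms B.cring_axioms hom \<phi>'(1)]
    spec_map_comp[OF A.cring_axioms A.cring_axioms B.cring_axioms \<phi> hom]
  by (rule spec_map_cong[OF A.cring_axioms B.cring_axioms ring_hom_trans[OF hom \<phi>'(1)]]) (simp add: \<phi>'(2))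

lemma blowup_iso:
  "\<exists>\<tau>. rinverse (ropen_sub (Spec B (\<iota> \<circ> \<eta>)) (basic_open B (\<iota> f))) (ropen_sub (Spec A \<eta>) (basic_open A f))
    (rrestr (Spec B (\<iota> \<circ> \<eta>)) (Spec A \<eta>) (basic_open B (\<iota> f)) (basic_open A f) (spec_map A B \<iota>)) \<tau>"
  (is "\<exists>\<tau>. rinverse (ropen_sub ?S ?U') (ropen_sub ?T ?U) ?r \<tau>")
proof (rule rinverse_of_homeomorphism)
  note A = A.cring_axioms and B = B.cring_axioms
  let ?\<sigma> = "spec_map A B \<iota>"
  have U: "openin (rtop ?T) ?U" using openin_basic_open[OF f_closed] by simp
  have U': "openin (rtop ?S) ?U'" using openin_basic_open[OF \<iota>_closed[OF f_closed]] by simp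
  have U'p: "primeideal Q B" "\<iota> f \<notin> Q" if "Q \<in> ?U'" for Q using that by (simp_all add: basic_open_def)
  have fst\<sigma>: "fst ?\<sigma> Q = spec_pt A B \<iota> Q" if "Q \<in> ?U'" for Q
    by (rule fst_spec_map[OF U'p(1)[OF that]])
  have pt: "spec_pt A B \<iota> Q \<in> ?U \<longleftrightarrow> \<iota> f \<notin> Q" if "primeideal Q B" for Q
    using spec_pt_prime[OF A B hom that] f_notin_spec_pt by (simp add: basic_open_def)
  have ptU: "spec_pt A B \<iota> Q \<in> ?U" if "Q \<in> ?U'" for Q
    using pt[OF U'p(1)[OF that]] U'p(2)[OF that] by simp
  note UU = blowup_maps
  have tops: "topspace (rtop (ropen_sub ?S ?U')) = ?U'" "topspace (rtop (ropen_sub ?T ?U)) = ?U"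
    by (rule topspace_ropen_sub[OF U'], rule topspace_ropen_sub[OF U])
  show "presheaf (ropen_sub ?S ?U')" "presheaf (ropen_sub ?T ?U)"
    by (rule presheaf_ropen_sub[OF presheaf_B U'], rule presheaf_ropen_sub[OF presheaf_A U])
  show r: "?r \<in> rmor (ropen_sub ?S ?U') (ropen_sub ?T ?U)"
    by (rule rrestr_rmor[OF presheaf_B presheaf_A blowup_rmor U' U UU])
  have fstr: "fst ?r Q = spec_pt A B \<iota> Q" if "Q \<in> ?U'" for Q using fst\<sigma>[OF that] that by (simp add: rrestr_def)
  show "homeomorphic_map (rtop (ropen_sub ?S ?U')) (rtop (ropen_sub ?T ?U)) (fst ?r)"
  proof (rule bijective_open_imp_homeomorphic_map)
    show "continuous_map (rtop (ropen_sub ?S ?U')) (rtop (ropen_sub ?T ?U)) (fst ?r)"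
      by (rule rmor_continuous[OF r])
    show "open_map (rtop (ropen_sub ?S ?U')) (rtop (ropen_sub ?T ?U)) (fst ?r)"
      unfolding open_map_def openin_ropen_sub[OF U'] openin_ropen_sub[OF U]
    proof (intro allI impI, elim conjE)
      fix V assume V: "openin (rtop ?S) V" "V \<subseteq> ?U'"
      have e: "fst ?r ` V = spec_pt A B \<iota> ` V" using fstr subsetD[OF V(2)] by (intro image_cong) simp_all
      have "openin (zariski A) (spec_pt A B \<iota> ` V)"
        using V(1) U'p(2)[OF subsetD[OF V(2)]] by (intro spec_pt_image_open) simp_all
      moreover have "spec_pt A B \<iota> ` V \<subseteq> ?U" using ptU subsetD[OF V(2)] by (intro image_subsetI) simp
      ultimately show "openin (rtop ?T) (fst ?r ` V) \<and> fst ?r ` V \<subseteq> ?U" unfolding e by simp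
    qed
    show "fst ?r ` topspace (rtop (ropen_sub ?S ?U')) = topspace (rtop (ropen_sub ?T ?U))"
      unfolding tops
    proof
      show "fst ?r ` ?U' \<subseteq> ?U" by (rule image_subsetI) (simp only: fstr ptU)
      show "?U \<subseteq> fst ?r ` ?U'"
      proof
        fix P assume "P \<in> ?U"
        then have P: "primeideal P A" "f \<notin> P" by (simp_all add: basic_open_def)
        obtain Q where Q: "primeideal Q B" "\<iota> f \<notin> Q" "spec_pt A B \<iota> Q = P" using P by (rule spec_pt_surj)
        then have "Q \<in> ?U'" by (simp add: basic_open_def)
        then show "P \<in> fst ?r ` ?U'" using fstr Q(3) by (metis image_eqI)
      qed
    qed
    show "inj_on (fst ?r) (topspace (rtop (ropen_sub ?S ?U')))"
      unfolding tops
    proof (rule inj_onI)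
      fix Q R assume Q: "Q \<in> ?U'" and R: "R \<in> ?U'" and e: "fst ?r Q = fst ?r R"
      show "Q = R" using spec_pt_inj[OF U'p[OF Q] U'p[OF R]] e fstr[OF Q] fstr[OF R] by simp
    qed
  qed
  fix V assume "openin (rtop (ropen_sub ?T ?U)) V"
  then have V: "openin (rtop ?T) V" "V \<subseteq> ?U" using openin_ropen_sub[OF U] by auto
  then have oV: "openin (zariski A) V" and Vf: "\<And>P. P \<in> V \<Longrightarrow> f \<notin> P" by (auto simp: basic_open_def)
  let ?pre = "{Q. primeideal Q B \<and> spec_pt A B \<iota> Q \<in> V}"
  \<comment> \<open>For \<open>V\<close> inside \<open>?U\<close> the preimage under the blowup
    morphism already lies in \<open>?U'\<close>, so \<open>rrestr\<close> leaves the comorphism over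
    \<open>V\<close> unchanged.\<close>
  have sub: "?pre \<subseteq> ?U'" using Vf f_notin_spec_pt by (auto simp: basic_open_def)
  have pre: "rpre (ropen_sub ?S ?U') ?r V = ?pre"
    unfolding rpre_rrestr[OF U'] rpre_spec_map[OF B] using sub by blast
  have "snd ?r V s = snd ?\<sigma> V s" if s: "s \<in> carrier (spec_sec A V)" for s
  proof -
    have "snd ?r V s = restrict (snd ?\<sigma> V s) (?pre \<inter> ?U')"
    proof -
      have s': "s \<in> carrier (rsec ?T V)" using s by simp
      show ?thesis by (simp only: snd_rrestr[OF U V s'] rpre_spec_map[OF B] Spec_simps)
    qed
    also have "?pre \<inter> ?U' = ?pre" using sub by blast
    also have "restrict (snd ?\<sigma> V s) ?pre = snd ?\<sigma> V s"
      by (rule extensional_restrict[OF spec_sec_extensional[OF spec_map_section[OF A B hom oV s]]])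
    finally show ?thesis .
  qed
  then have "bij_betw (snd ?r V) (carrier (spec_sec A V)) (carrier (spec_sec B ?pre)) \<longleftrightarrow>
      bij_betw (snd ?\<sigma> V) (carrier (spec_sec A V)) (carrier (spec_sec B ?pre))"
    by (rule bij_betw_cong)
  then show "bij_betw (snd ?r V) (carrier (rsec (ropen_sub ?T ?U) V)) (carrier (rsec (ropen_sub ?S ?U') (rpre (ropen_sub ?S ?U') ?r V)))"
    using spec_map_section_bij[OF oV Vf] by (simp add: pre)
qed

text \<open>Every \<open>x\<close> in \<open>B\<close> satisfies \<open>\<iota>(f\<^sup>k) x = \<iota> a\<close>, so a comorphism compatible with \<open>\<phi>\<close> is forced on
  \<open>x\<close> by cancelling \<open>\<iota>(\<phi>(f\<^sup>k))\<close>; this works in the local rings because \<open>B\<close> is a domain.\<close>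

lemma lift_unique:
  assumes \<phi>: "\<phi> \<in> ring_hom A A" "\<And>k. \<phi> (\<eta> k) = \<eta> k" and \<phi>f: "\<phi> f \<noteq> \<zero>\<^bsub>A\<^esub>"
    and \<phi>': "\<phi>' \<in> ring_hom B B" "\<And>a. a \<in> carrier A \<Longrightarrow> \<phi>' (\<iota> a) = \<iota> (\<phi> a)"
    and F: "F \<in> rmor (Spec B (\<iota> \<circ> \<eta>)) (Spec B (\<iota> \<circ> \<eta>))"
    and comm: "rcomp (Spec B (\<iota> \<circ> \<eta>)) (Spec B (\<iota> \<circ> \<eta>)) (Spec A \<eta>) (spec_map A B \<iota>) F =
      rcomp (Spec B (\<iota> \<circ> \<eta>)) (Spec A \<eta>) (Spec A \<eta>) (spec_map A A \<phi>) (spec_map A B \<iota>)"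
  shows "F = spec_map B B \<phi>'"
proof (rule spec_map_unique[OF B.cring_axioms B.cring_axioms \<phi>'(1) _ _ F])
  note A = A.cring_axioms and B = B.cring_axioms
  let ?S = "Spec B (\<iota> \<circ> \<eta>)" and ?T = "Spec A \<eta>" and ?X = "{P. primeideal P A}" and ?Y = "{Q. primeideal Q B}"
  let ?c = "snd F ?Y"
  show "(\<iota> \<circ> \<eta>) k \<in> carrier B" for k using \<eta> \<iota>_closed by simp
  show "(\<iota> \<circ> \<eta>) k = \<phi>' ((\<iota> \<circ> \<eta>) k)" for k using \<phi>'(2)[OF \<eta>] \<phi>(2) by simp
  fix x assume x: "x \<in> carrier B"
  have oX: "openin (zariski A) ?X" and oY: "openin (zariski B) ?Y" by (rule openin_Collect_prime[OF A], rule openin_Collect_prime[OF B])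
  have pre\<sigma>: "rpre ?S (spec_map A B \<iota>) ?X = ?Y" and pre\<phi>: "rpre ?T (spec_map A A \<phi>) ?X = ?X"
    using spec_pt_prime[OF A B hom] spec_pt_prime[OF A A \<phi>(1)] by (auto simp: rpre_spec_map[OF B] rpre_spec_map[OF A])
  \<comment> \<open>The commuting square, evaluated on the global section \<open>a/1\<close> of the
    base.\<close>
  have base: "?c (const_sec B (\<iota> a)) = const_sec B (\<iota> (\<phi> a))" if a: "a \<in> carrier A" for a
  proof -
    have cs: "const_sec A a \<in> carrier (rsec ?T ?X)" using const_sec_closed[OF A a] by simp
    have oT: "openin (rtop ?T) ?X" using oX by simp
    have "?c (const_sec B (\<iota> a)) = snd (rcomp ?S ?S ?T (spec_map A B \<iota>) F) ?X (const_sec A a)"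
      unfolding snd_rcomp[OF oT cs] pre\<sigma> const_sec_spec_map[OF A B hom a] ..
    also have "\<dots> = const_sec B (\<iota> (\<phi> a))"
      unfolding comm snd_rcomp[OF oT cs] pre\<phi> const_sec_spec_map[OF A A \<phi>(1) a]
        const_sec_spec_map[OF A B hom ring_hom_closed[OF \<phi>(1) a]] ..
    finally show ?thesis .
  qed
  have preF: "rpre ?S F ?Y = ?Y"
    using rmor_point[OF F] by (auto simp: rpre_def topspace_zariski B)
  have cF: "?c \<in> ring_hom (spec_sec B ?Y) (spec_sec B ?Y)"
    using rmor_hom[OF F, of ?Y] oY by (simp add: preF)
  obtain k a where a: "a \<in> ideal_pow A I k" "a \<in> carrier A" "\<iota> (f [^]\<^bsub>A\<^esub> k) \<otimes>\<^bsub>B\<^esub> x = \<iota> a"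
    using x by (rule frac_carrier)
  let ?u = "f [^]\<^bsub>A\<^esub> k"
  have u: "?u \<in> carrier A" by (rule pow_closed)
  have \<phi>u: "\<phi> ?u \<in> carrier A" by (rule ring_hom_closed[OF \<phi>(1) u])
  have \<phi>u0: "\<iota> (\<phi> ?u) \<noteq> \<zero>\<^bsub>B\<^esub>"
  proof -
    have "\<phi> ?u \<noteq> \<zero>\<^bsub>A\<^esub>" by (rule hom_pow_nonzero[OF \<phi>(1) \<phi>f])
    then show ?thesis using \<iota>_eq[OF \<phi>u A.zero_closed] \<iota>_zero by auto
  qed
  have \<phi>'x: "\<phi>' x \<in> carrier B" by (rule ring_hom_closed[OF \<phi>'(1) x])
  note cl = const_sec_closed[OF B]
  have "const_sec B (\<iota> (\<phi> ?u)) \<otimes>\<^bsub>spec_sec B ?Y\<^esub> ?c (const_sec B x) = ?c (const_sec B (\<iota> ?u) \<otimes>\<^bsub>spec_sec B ?Y\<^esub> const_sec B x)"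
    unfolding ring_hom_mult[OF cF cl[OF \<iota>_closed[OF u]] cl[OF x]] base[OF u] ..
  also have "\<dots> = const_sec B (\<iota> (\<phi> a))"
    unfolding const_sec_mult[OF B \<iota>_closed[OF u] x, symmetric] a(3) by (rule base[OF a(2)])
  also have "\<iota> (\<phi> a) = \<iota> (\<phi> ?u) \<otimes>\<^bsub>B\<^esub> \<phi>' x"
    using arg_cong[OF a(3), of \<phi>'] ring_hom_mult[OF \<phi>'(1) \<iota>_closed[OF u] x] \<phi>'(2)[OF u] \<phi>'(2)[OF a(2)] by simp
  also have "const_sec B \<dots> = const_sec B (\<iota> (\<phi> ?u)) \<otimes>\<^bsub>spec_sec B ?Y\<^esub> const_sec B (\<phi>' x)"
    by (rule const_sec_mult[OF B \<iota>_closed[OF \<phi>u] \<phi>'x])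
  finally have e: "const_sec B (\<iota> (\<phi> ?u)) \<otimes>\<^bsub>spec_sec B ?Y\<^esub> ?c (const_sec B x) =
      const_sec B (\<iota> (\<phi> ?u)) \<otimes>\<^bsub>spec_sec B ?Y\<^esub> const_sec B (\<phi>' x)" .
  have cx: "?c (const_sec B x) \<in> carrier (spec_sec B ?Y)" by (rule ring_hom_closed[OF cF cl[OF x]])
  show "?c (const_sec B x) = const_sec B (\<phi>' x)"
  proof (rule spec_sec_eqI[OF spec_sec_extensional[OF cx] spec_sec_extensional[OF cl[OF \<phi>'x]]])
    fix Q assume Q: "Q \<in> ?Y"
    then have Qp: "primeideal Q B" by simp
    have "const_sec B (\<iota> (\<phi> ?u)) Q \<otimes>\<^bsub>loc B Q\<^esub> ?c (const_sec B x) Q = const_sec B (\<iota> (\<phi> ?u)) Q \<otimes>\<^bsub>loc B Q\<^esub> const_sec B (\<phi>' x) Q"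
      using fun_cong[OF e, of Q] Qp by (simp add: spec_sec_ops)
    then have "lfrac B Q (\<iota> (\<phi> ?u)) \<one>\<^bsub>B\<^esub> \<otimes>\<^bsub>loc B Q\<^esub> ?c (const_sec B x) Q =
        lfrac B Q (\<iota> (\<phi> ?u)) \<one>\<^bsub>B\<^esub> \<otimes>\<^bsub>loc B Q\<^esub> const_sec B (\<phi>' x) Q"
      using Qp by (simp add: const_sec_def[of B "\<iota> (\<phi> ?u)"])
    then show "?c (const_sec B x) Q = const_sec B (\<phi>' x) Q"
      by (rule B.loc_cancel[OF Qp \<iota>_closed[OF \<phi>u] \<phi>u0 spec_sec_value[OF cx Q] spec_sec_value[OF cl[OF \<phi>'x] Q]])
  qed
qed

end

text \<open>By \<open>div\<close> with exponent 1 every \<open>\<iota> i\<close> is a multiple of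
  \<open>\<iota> f\<close>. So \<open>I\<close> and \<open>f\<close> generate the same ideal of
  \<open>B\<close>, and a prime contains the image of \<open>I\<close> as soon as it contains
  \<open>\<iota> f\<close>.\<close>

lemma compl_exceptional: "{Q. primeideal Q B \<and> \<not> \<iota> ` I \<subseteq> Q} = basic_open B (\<iota> f)"
proof -
  have "\<iota> ` I \<subseteq> Q" if Q: "primeideal Q B" and fQ: "\<iota> f \<in> Q" for Q
  proof (rule image_subsetI)
    fix i assume i: "i \<in> I"
    interpret Q: primeideal Q B by fact
    have "i \<in> ideal_pow A I 1"
      using ideal_prod.prod[of "\<one>\<^bsub>A\<^esub>" "carrier A" i I A] i ideal.Icarr[OF I i] ideal_pow_Suc[of A I 0] ideal_pow_0[of A I] by simp
    then obtain x where x: "x \<in> carrier B" "\<iota> (f [^]\<^bsub>A\<^esub> (1::nat)) \<otimes>\<^bsub>B\<^esub> x = \<iota> i" using div by blast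
    then have "\<iota> i = \<iota> f \<otimes>\<^bsub>B\<^esub> x" using f_closed by simp
    then show "\<iota> i \<in> Q" using Q.I_r_closed[OF fQ x(1)] by simp
  qed
  then show ?thesis using f(1) by (auto simp: basic_open_def)
qed

lemma compl_divisor: "{P. primeideal P A \<and> \<not> PIdl\<^bsub>A\<^esub> f \<subseteq> P} = basic_open A f"
proof -
  have "PIdl\<^bsub>A\<^esub> f \<subseteq> P \<longleftrightarrow> f \<in> P" if "primeideal P A" for P
    using A.cgenideal_minimal[OF primeideal.axioms(1)[OF that]] A.cgenideal_self[OF f_closed] by blast
  then show ?thesis by (auto simp: basic_open_def)
qed

end

lemma preserves_vanishing:
  assumes A: "cring A" and \<eta>: "\<And>k. \<eta> k \<in> carrier A"
    and \<phi>: "\<phi> \<in> alg_aut A \<eta>" and \<psi>: "\<psi> \<in> alg_aut A \<eta>"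
    and inv: "\<And>a. a \<in> carrier A \<Longrightarrow> \<psi> (\<phi> a) = a" "\<And>a. a \<in> carrier A \<Longrightarrow> \<phi> (\<psi> a) = a"
    and J: "J \<subseteq> carrier A" "\<phi> ` J \<subseteq> J" "\<psi> ` J \<subseteq> J"
  shows "preserves (Spec A \<eta>) (spec_map A A \<phi>) (vanishing A J)"
proof (rule preservesI[OF presheaf_Spec[OF A \<eta>] spec_map_rinverse[OF A \<eta> \<phi> \<psi> inv]])
  fix V assume "openin (rtop (Spec A \<eta>)) V"
  then have V: "openin (zariski A) V" by simp
  show "vanishing A J V \<subseteq> carrier (rsec (Spec A \<eta>) V)" using vanishing_subset by simp
  show "snd (spec_map A A \<phi>) V ` vanishing A J V \<subseteq> vanishing A J (rpre (Spec A \<eta>) (spec_map A A \<phi>) V)"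
    unfolding rpre_spec_map[OF A] by (rule spec_map_vanishing[OF A A alg_aut_hom[OF \<phi>] V J(1,2)])
  show "snd (spec_map A A \<psi>) V ` vanishing A J V \<subseteq> vanishing A J (rpre (Spec A \<eta>) (spec_map A A \<psi>) V)"
    unfolding rpre_spec_map[OF A] by (rule spec_map_vanishing[OF A A alg_aut_hom[OF \<psi>] V J(1,3)])
qed

theorem corollary2p2:
  fixes A :: "('a, 'm) ring_scheme" and \<eta> :: "complex \<Rightarrow> 'a"
    and I :: "'a set" and f \<alpha> :: 'a and \<phi> :: "'a \<Rightarrow> 'a"
  assumes "affine_triple A \<eta> I f"
    and "\<phi> \<in> alg_aut A \<eta>"
    and "\<phi> ` I = I"
    and "\<alpha> \<in> Units A"
    and "\<phi> f = \<alpha> \<otimes>\<^bsub>A\<^esub> f"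
    and "A' = modif A I f"
    and "\<iota> = modif_emb A I f"
    and "\<eta>' = \<iota> \<circ> \<eta>"
    and "XA = Spec A \<eta>"
    and "XA' = Spec A' \<eta>'"
    and "\<sigma> = spec_map A A' \<iota>"
    and "\<phi>hat = spec_map A A \<phi>"
    and "D = vanishing A (PIdl\<^bsub>A\<^esub> f)"
    and "C = vanishing A I"
    and "E' = inv_img XA' XA \<sigma> C"
    and "U = topspace (rtop XA) - supp XA D"
    and "U' = topspace (rtop XA') - supp XA' E'"
  shows
    "(\<exists>!\<phi>'. \<phi>' \<in> alg_aut A' \<eta>' \<and> (\<forall>a\<in>carrier A. \<phi>' (\<iota> a) = \<iota> (\<phi> a))) \<and>
     \<phi>hat \<in> raut XA \<and> preserves XA \<phi>hat D \<and> preserves XA \<phi>hat C \<and>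
     (\<exists>!\<psi>. \<psi> \<in> raut XA' \<and> rcomp XA' XA' XA \<sigma> \<psi> = rcomp XA' XA XA \<phi>hat \<sigma>) \<and>
     (\<forall>\<phi>' \<psi>. \<phi>' \<in> alg_aut A' \<eta>' \<and> (\<forall>a\<in>carrier A. \<phi>' (\<iota> a) = \<iota> (\<phi> a)) \<and>
        \<psi> = spec_map A' A' \<phi>' \<longrightarrow>
        \<psi> \<in> raut XA' \<and> rcomp XA' XA' XA \<sigma> \<psi> = rcomp XA' XA XA \<phi>hat \<sigma> \<and> preserves XA' \<psi> E' \<and>
        (\<exists>\<tau>. rinverse (ropen_sub XA' U') (ropen_sub XA U) (rrestr XA' XA U' U \<sigma>) \<tau> \<and>
          rrestr XA' XA' U' U' \<psi> =
            rcomp (ropen_sub XA' U') (ropen_sub XA U) (ropen_sub XA' U') \<tau>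
              (rcomp (ropen_sub XA' U') (ropen_sub XA U) (ropen_sub XA U)
                (rrestr XA XA U U \<phi>hat) (rrestr XA' XA U' U \<sigma>))))"
proof -
  have dom: "domain A" and \<eta>hom: "\<eta> \<in> ring_hom (ring_of_type_algebra :: complex ring) A"
    and I: "ideal I A" and f: "f \<in> I" "f \<noteq> \<zero>\<^bsub>A\<^esub>"
    using assms(1) by (simp_all add: affine_triple_def affine_domain_def)
  have \<eta>: "\<eta> k \<in> carrier A" for k
    using ring_hom_closed[OF \<eta>hom, of k] by (simp add: ring_of_type_algebra_def)
  interpret M: affine_modification A A' \<iota> I f
    unfolding assms(6,7) by (rule affine_modification_modif[OF dom I f])
  note A = M.A.cring_axioms and B = M.B.cring_axioms and h = alg_aut_hom[OF assms(2)]
  have XA': "XA' = Spec A' (\<iota> \<circ> \<eta>)" using assms(8,10) by simp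
  have \<eta>'c: "(\<iota> \<circ> \<eta>) k \<in> carrier A'" for k using M.\<iota>_closed[OF \<eta>] by simp
  have pA: "presheaf XA" unfolding assms(9) by (rule M.presheaf_A[OF \<eta>])
  have pB: "presheaf XA'" unfolding XA' by (rule M.presheaf_B[OF \<eta>])
  have \<sigma>: "\<sigma> \<in> rmor XA' XA" unfolding XA' assms(9,11) by (rule M.blowup_rmor[OF \<eta>])
  have \<phi>\<eta>: "\<phi> (\<eta> k) = \<eta> k" for k using assms(2) by (simp add: alg_aut_def)
  obtain \<psi> \<beta> where \<psi>: "\<psi> \<in> alg_aut A \<eta>"
    and inv: "\<And>a. a \<in> carrier A \<Longrightarrow> \<psi> (\<phi> a) = a" "\<And>a. a \<in> carrier A \<Longrightarrow> \<phi> (\<psi> a) = a"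
    and \<psi>I: "\<psi> ` I \<subseteq> I" and \<beta>: "\<beta> \<in> Units A" and \<psi>f: "\<psi> f = \<beta> \<otimes>\<^bsub>A\<^esub> f" and \<phi>f0: "\<phi> f \<noteq> \<zero>\<^bsub>A\<^esub>"
    using M.alg_aut_inverse_semi_invariant[OF \<eta> assms(2-5)] by blast
  note k = alg_aut_hom[OF \<psi>]
  \<comment> \<open>Applied to \<open>\<phi>\<close> with the constant \<open>\<alpha>\<close> and
    to \<open>\<psi>\<close> with \<open>\<beta>\<close>; the two inclusions yield preservation of
    \<open>D\<close>.\<close>
  have principal: "\<theta> ` (PIdl\<^bsub>A\<^esub> f) \<subseteq> PIdl\<^bsub>A\<^esub> f"
    if \<theta>: "\<theta> \<in> ring_hom A A" and c: "c \<in> carrier A" and e: "\<theta> f = c \<otimes>\<^bsub>A\<^esub> f" for \<theta> c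
  proof (rule image_subsetI)
    fix x assume "x \<in> PIdl\<^bsub>A\<^esub> f"
    then obtain r where r: "r \<in> carrier A" "x = r \<otimes>\<^bsub>A\<^esub> f" by (auto simp: cgenideal_def)
    have "\<theta> x = (\<theta> r \<otimes>\<^bsub>A\<^esub> c) \<otimes>\<^bsub>A\<^esub> f"
      using ring_hom_mult[OF \<theta> r(1) M.f_closed] ring_hom_closed[OF \<theta> r(1)] c M.f_closed
      by (simp add: r(2) e M.A.m_assoc)
    then show "\<theta> x \<in> PIdl\<^bsub>A\<^esub> f"
      using ring_hom_closed[OF \<theta> r(1)] c M.A.m_closed unfolding cgenideal_def by blast
  qed
  have DI: "PIdl\<^bsub>A\<^esub> f \<subseteq> carrier A"
    by (rule additive_subgroup.a_subset[OF ideal.axioms(1)[OF M.A.cgenideal_ideal[OF M.f_closed]]])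
  have CI: "I \<subseteq> carrier A" by (rule additive_subgroup.a_subset[OF ideal.axioms(1)[OF I]])
  have inv_\<phi>: "rinverse XA XA \<phi>hat (spec_map A A \<psi>)"
    unfolding assms(9,12) by (rule spec_map_rinverse[OF A \<eta> assms(2) \<psi> inv])
  have rA: "\<phi>hat \<in> raut XA" using inv_\<phi> unfolding raut_def by blast
  have presD: "preserves XA \<phi>hat D"
    unfolding assms(9,12,13)
    by (rule preserves_vanishing[OF A \<eta> assms(2) \<psi> inv DI principal[OF h M.A.Units_closed[OF assms(4)] assms(5)]
          principal[OF k M.A.Units_closed[OF \<beta>] \<psi>f]])
  have presC: "preserves XA \<phi>hat C"
    unfolding assms(9,12,14) using assms(3) \<psi>I
    by (intro preserves_vanishing[OF A \<eta> assms(2) \<psi> inv CI]) simp_all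
  have U: "U = basic_open A f"
    unfolding assms(16,9,13) compl_supp_vanishing[OF A DI] by (rule M.compl_divisor)
  have U': "U' = basic_open A' (\<iota> f)"
  proof -
    have "topspace (rtop XA') - supp XA' E' = {Q. primeideal Q A' \<and> \<not> \<iota> ` I \<subseteq> Q}"
      unfolding assms(15,14,11,9) XA' by (rule compl_supp_inv_img[OF A B M.hom CI \<eta>]) simp
    then show ?thesis unfolding assms(17) M.compl_exceptional .
  qed
  have oU: "openin (rtop XA) U" unfolding assms(16) by (rule openin_compl_supp)
  have oU': "openin (rtop XA') U'" unfolding assms(17) by (rule openin_compl_supp)
  have "\<exists>\<tau>. rinverse (ropen_sub XA' U') (ropen_sub XA U) (rrestr XA' XA U' U \<sigma>) \<tau>"
    unfolding U U' XA' assms(9,11) by (rule M.blowup_iso[OF \<eta>])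
  then obtain \<tau> where \<tau>: "rinverse (ropen_sub XA' U') (ropen_sub XA U) (rrestr XA' XA U' U \<sigma>) \<tau>" ..
  have commutes: "rcomp XA' XA' XA \<sigma> (spec_map A' A' \<theta>') = rcomp XA' XA XA (spec_map A A \<theta>) \<sigma>"
    if "\<theta> \<in> ring_hom A A" "\<theta>' \<in> ring_hom A' A'" "\<And>a. a \<in> carrier A \<Longrightarrow> \<theta>' (\<iota> a) = \<iota> (\<theta> a)" for \<theta> \<theta>'
    unfolding XA' assms(9,11) by (rule M.blowup_commutes[OF \<eta> that])
  have C_sub: "C V \<subseteq> carrier (rsec XA V)" for V
    unfolding assms(9,14) using vanishing_subset by simp
  have C_comorphism: "snd (spec_map A A \<theta>) V ` C V \<subseteq> C (rpre XA (spec_map A A \<theta>) V)"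
    if \<theta>: "\<theta> \<in> ring_hom A A" "\<theta> ` I \<subseteq> I" and V: "openin (rtop XA) V" for \<theta> V
  proof -
    have oV: "openin (zariski A) V" using V unfolding assms(9) by simp
    show ?thesis
      unfolding assms(9,14) rpre_spec_map[OF A] by (rule spec_map_vanishing[OF A A \<theta>(1) oV CI \<theta>(2)])
  qed
  have lift: "\<chi> \<in> raut XA' \<and> rcomp XA' XA' XA \<sigma> \<chi> = rcomp XA' XA XA \<phi>hat \<sigma> \<and> preserves XA' \<chi> E' \<and>
      rrestr XA' XA' U' U' \<chi> = rcomp (ropen_sub XA' U') (ropen_sub XA U) (ropen_sub XA' U') \<tau>
        (rcomp (ropen_sub XA' U') (ropen_sub XA U) (ropen_sub XA U)
          (rrestr XA XA U U \<phi>hat) (rrestr XA' XA U' U \<sigma>))"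
    if \<phi>': "\<phi>' \<in> alg_aut A' \<eta>'" "\<forall>a\<in>carrier A. \<phi>' (\<iota> a) = \<iota> (\<phi> a)" and \<chi>: "\<chi> = spec_map A' A' \<phi>'" for \<phi>' \<chi>
  proof -
    have \<phi>'a: "\<phi>' \<in> alg_aut A' (\<iota> \<circ> \<eta>)" using \<phi>'(1) assms(8) by simp
    obtain \<psi>' where \<psi>': "\<psi>' \<in> alg_aut A' (\<iota> \<circ> \<eta>)"
      and inv': "\<And>x. x \<in> carrier A' \<Longrightarrow> \<psi>' (\<phi>' x) = x" "\<And>x. x \<in> carrier A' \<Longrightarrow> \<phi>' (\<psi>' x) = x"
      using alg_aut_inverse[OF M.B.ring_axioms \<phi>'a \<eta>'c] by blast
    note h' = alg_aut_hom[OF \<phi>'a] and k' = alg_aut_hom[OF \<psi>']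
    have e: "\<phi>' (\<iota> a) = \<iota> (\<phi> a)" if "a \<in> carrier A" for a using \<phi>'(2) that by blast
    \<comment> \<open>The inverse of the extension extends the inverse: write \<open>a\<close> as
      \<open>\<phi>(\<psi> a)\<close> and cancel \<open>\<psi>'\<close> against
      \<open>\<phi>'\<close>.\<close>
    have e': "\<psi>' (\<iota> a) = \<iota> (\<psi> a)" if a: "a \<in> carrier A" for a
    proof -
      have "\<psi> a \<in> carrier A" by (rule ring_hom_closed[OF k a])
      then have "\<psi>' (\<iota> (\<phi> (\<psi> a))) = \<iota> (\<psi> a)" using inv'(1)[OF M.\<iota>_closed] e by metis
      then show ?thesis using inv(2)[OF a] by simp
    qed
    have inv_\<chi>: "rinverse XA' XA' \<chi> (spec_map A' A' \<psi>')"
      unfolding XA' \<chi> by (rule spec_map_rinverse[OF B \<eta>'c \<phi>'a \<psi>' inv'])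
    have \<chi>aut: "\<chi> \<in> raut XA'" using inv_\<chi> unfolding raut_def by blast
    have comm: "rcomp XA' XA' XA \<sigma> \<chi> = rcomp XA' XA XA \<phi>hat \<sigma>"
      unfolding \<chi> assms(12) by (rule commutes[OF h h' e])
    \<comment> \<open>The square for the inverse pair supplies the second inclusion in the proof
      that \<open>E'\<close> is preserved.\<close>
    have comm': "rcomp XA' XA' XA \<sigma> (spec_map A' A' \<psi>') = rcomp XA' XA XA (spec_map A A \<psi>) \<sigma>"
      by (rule commutes[OF k k' e'])
    have presE: "preserves XA' \<chi> E'"
      unfolding assms(15)
    proof (rule preservesI[OF pB inv_\<chi>])
      fix V assume V: "openin (rtop XA') V"
      show "inv_img XA' XA \<sigma> C V \<subseteq> carrier (rsec XA' V)" unfolding inv_img_def by blast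
      have "snd \<phi>hat Z ` C Z \<subseteq> C (rpre XA \<phi>hat Z)" if "openin (rtop XA) Z" for Z
        unfolding assms(12) by (rule C_comorphism[OF h _ that]) (simp add: assms(3))
      then show "snd \<chi> V ` inv_img XA' XA \<sigma> C V \<subseteq> inv_img XA' XA \<sigma> C (rpre XA' \<chi> V)"
        by (rule inv_img_comorphism[OF pB pA rinverse_rmor(1)[OF inv_\<chi>] rinverse_rmor(1)[OF inv_\<phi>] \<sigma> comm C_sub _ V])
      show "snd (spec_map A' A' \<psi>') V ` inv_img XA' XA \<sigma> C V \<subseteq> inv_img XA' XA \<sigma> C (rpre XA' (spec_map A' A' \<psi>') V)"
        by (rule inv_img_comorphism[OF pB pA rinverse_rmor(2)[OF inv_\<chi>] rinverse_rmor(2)[OF inv_\<phi>] \<sigma> comm' C_sub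
              C_comorphism[OF k \<psi>I] V])
    qed
    let ?r = "rrestr XA' XA U' U \<sigma>" and ?c = "rrestr XA' XA' U' U' \<chi>" and ?p = "rrestr XA XA U U \<phi>hat"
    let ?S = "ropen_sub XA' U'" and ?T = "ropen_sub XA U"
    have mU: "fst \<phi>hat ` U \<subseteq> U" unfolding assms(16) by (rule preserves_compl[OF inv_\<phi> presD])
    have mU': "fst \<chi> ` U' \<subseteq> U'" unfolding assms(17) by (rule preserves_compl[OF inv_\<chi> presE])
    have m\<sigma>: "fst \<sigma> ` U' \<subseteq> U" unfolding U U' assms(11) by (rule M.blowup_maps)
    note r\<chi> = rinverse_rmor(1)[OF inv_\<chi>] and r\<phi> = rinverse_rmor(1)[OF inv_\<phi>]
    have c: "?c \<in> rmor ?S ?S" by (rule rrestr_rmor[OF pB pB r\<chi> oU' oU' mU'])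
    \<comment> \<open>The commuting square is restricted to the complements, where
      \<open>mU\<close>, \<open>mU'\<close> and \<open>m\<sigma>\<close> make the restrictions
      compose, and is then solved for \<open>\<chi>\<close> by composing with \<open>\<tau>\<close>
      on the left.\<close>
    have "rcomp ?S ?T ?T ?p ?r = rrestr XA' XA U' U (rcomp XA' XA XA \<phi>hat \<sigma>)"
      by (rule rrestr_rcomp[OF pB pA pA \<sigma> r\<phi> oU' oU oU m\<sigma> mU, symmetric])
    also have "\<dots> = rrestr XA' XA U' U (rcomp XA' XA' XA \<sigma> \<chi>)" unfolding comm ..
    also have "\<dots> = rcomp ?S ?S ?T ?r ?c"
      by (rule rrestr_rcomp[OF pB pB pA r\<chi> \<sigma> oU' oU' oU mU' m\<sigma>])
    finally have "rcomp ?S ?T ?S \<tau> (rcomp ?S ?T ?T ?p ?r) = rcomp ?S ?T ?S \<tau> (rcomp ?S ?S ?T ?r ?c)" by simp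
    also have "\<dots> = rcomp ?S ?S ?S (rcomp ?S ?T ?S \<tau> ?r) ?c"
      by (rule rcomp_assoc[OF c rinverse_rmor[OF \<tau>]])
    also have "rcomp ?S ?T ?S \<tau> ?r = rid ?S" using \<tau> by (simp add: rinverse_def)
    also have "rcomp ?S ?S ?S (rid ?S) ?c = ?c" by (rule rcomp_rid_left[OF c])
    finally show ?thesis using \<chi>aut comm presE by simp
  qed
  have ext: "\<exists>!\<phi>'. \<phi>' \<in> alg_aut A' \<eta>' \<and> (\<forall>a\<in>carrier A. \<phi>' (\<iota> a) = \<iota> (\<phi> a))"
    unfolding assms(8) by (rule M.alg_aut_extension[OF \<eta> assms(2-5)])
  have "\<exists>!\<chi>. \<chi> \<in> raut XA' \<and> rcomp XA' XA' XA \<sigma> \<chi> = rcomp XA' XA XA \<phi>hat \<sigma>"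
  proof -
    obtain \<phi>' where \<phi>': "\<phi>' \<in> alg_aut A' \<eta>'" "\<forall>a\<in>carrier A. \<phi>' (\<iota> a) = \<iota> (\<phi> a)"
      using ext by blast
    have h': "\<phi>' \<in> ring_hom A' A'" by (rule alg_aut_hom[OF \<phi>'(1)])
    have "\<chi> = spec_map A' A' \<phi>'"
      if \<chi>: "\<chi> \<in> raut XA'" "rcomp XA' XA' XA \<sigma> \<chi> = rcomp XA' XA XA \<phi>hat \<sigma>" for \<chi>
    proof -
      have \<chi>mor: "\<chi> \<in> rmor XA' XA'" using \<chi>(1) unfolding raut_def rinverse_def by blast
      show ?thesis
        by (rule M.lift_unique[where \<eta> = \<eta>, OF \<eta> h \<phi>\<eta> \<phi>f0 h' bspec[OF \<phi>'(2)]
              \<chi>mor[unfolded XA'] \<chi>(2)[unfolded XA' assms(9,11,12)]])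
    qed
    with lift[OF \<phi>' refl] show ?thesis by (intro ex1I[of _ "spec_map A' A' \<phi>'"]) simp_all
  qed
  note unique = this
  show ?thesis
  proof (intro conjI ext rA presD presC unique allI impI; elim conjE)
    fix \<phi>' \<chi>
    assume \<phi>': "\<phi>' \<in> alg_aut A' \<eta>'" "\<forall>a\<in>carrier A. \<phi>' (\<iota> a) = \<iota> (\<phi> a)" and \<chi>: "\<chi> = spec_map A' A' \<phi>'"
    note L = lift[OF \<phi>' \<chi>]
    show "\<chi> \<in> raut XA'" "rcomp XA' XA' XA \<sigma> \<chi> = rcomp XA' XA XA \<phi>hat \<sigma>" "preserves XA' \<chi> E'"
      using L by simp_all
    show "\<exists>\<tau>. rinverse (ropen_sub XA' U') (ropen_sub XA U) (rrestr XA' XA U' U \<sigma>) \<tau> \<and>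
        rrestr XA' XA' U' U' \<chi> =
          rcomp (ropen_sub XA' U') (ropen_sub XA U) (ropen_sub XA' U') \<tau>
            (rcomp (ropen_sub XA' U') (ropen_sub XA U) (ropen_sub XA U)
              (rrestr XA XA U U \<phi>hat) (rrestr XA' XA U' U \<sigma>))"
      using L by (intro exI[of _ \<tau>] conjI \<tau>) simp
  qed
qed

end
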